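(* Let $1<p<\infty$, let $k$ be a polynomial that is not identically $0$, let $\phi$ be the functional with kernel $k$, let $F\in A^p$ be the extremal function for $k$, and let $K(z)=\frac1z\int_0^z k(\zeta)\,d\zeta$. Then $F\in H^p$ and for every (analytic) polynomial $h$, \[ \frac{1}{2\pi}\int_0^{2\pi} |F(e^{i\theta})|^p h(e^{i\theta})\,d\theta = \frac{1}{2\pi\|\phi\|}\int_0^{2\pi} F\Big[\frac p2\, h\,\overline{k} + \Big(1-\frac p2\Big)(zh)'\,\overline{K}\Big]\,d\theta, \] where in the right-hand integral all functions are evaluated at $z=e^{i\theta}$ (boundary values).
   Context: $\mathbb{D}$ is the open unit disc and $\sigma$ is normalized area measure on $\mathbb{D}$. For $1<p<\infty$, $A^p$ is the Bergman space of analytic $f$ on $\mathbb{D}$ with $\|f\|_{A^p}=(\int_{\mathbb{D}}|f|^p\,d\sigma)^{1/p}<\infty$, and $H^p$ is the Hardy space of analytic $f$ with $\|f\|_{H^p}=\sup_{0<r<1}(\frac1{2\pi}\int_0^{2\pi}|f(re^{i\theta})|^p d\theta)^{1/p}<\infty$; $H^p$ functions have radial boundary values $f(e^{i\theta})$ a.e. Let $q=p/(p-1)$. For $k\in A^q$, $k\not\equiv0$, the functional with kernel $k$ is $\phi(f)=\int_{\mathbb{D}} f\,\overline{k}\,d\sigma$ on $A^p$, with norm $\|\phi\|$ in $(A^p)^*$. The extremal function for $k$ is the unique $F\in A^p$ with $\|F\|_{A^p}=1$ and $\operatorname{Re}\phi(F)=\sup_{\|g\|_{A^p}=1}\operatorname{Re}\phi(g)=\|\phi\|$.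 *)

theory Defs
  imports "HOL-Analysis.Analysis" "HOL-Computational_Algebra.Polynomial"
begin

definition disc_integral :: "(complex \<Rightarrow> complex) \<Rightarrow> complex" where
  "disc_integral f = (1 / of_real pi) * (LINT z:ball 0 1|lborel. f z)"

definition in_Bergman :: "real \<Rightarrow> (complex \<Rightarrow> complex) \<Rightarrow> bool" where
  "in_Bergman p f \<longleftrightarrow> f holomorphic_on ball 0 1 \<and>
     set_integrable lborel (ball 0 1) (\<lambda>z. norm (f z) powr p)"

definition Bergman_norm :: "real \<Rightarrow> (complex \<Rightarrow> complex) \<Rightarrow> real" where
  "Bergman_norm p f = ((1 / pi) * (LINT z:ball 0 1|lborel. norm (f z) powr p)) powr (1 / p)"

definition integral_mean :: "real \<Rightarrow> (complex \<Rightarrow> complex) \<Rightarrow> real \<Rightarrow> real" where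
  "integral_mean p f r = (1 / (2 * pi)) * (LBINT \<theta>=0..2*pi. norm (f (of_real r * cis \<theta>)) powr p)"

definition in_Hardy :: "real \<Rightarrow> (complex \<Rightarrow> complex) \<Rightarrow> bool" where
  "in_Hardy p f \<longleftrightarrow> f holomorphic_on ball 0 1 \<and> bdd_above (integral_mean p f ` {0<..<1})"

definition boundary_val :: "(complex \<Rightarrow> complex) \<Rightarrow> real \<Rightarrow> complex" where
  "boundary_val f \<theta> = Lim (at_left 1) (\<lambda>r. f (of_real r * cis \<theta>))"

definition kernel_functional :: "complex poly \<Rightarrow> (complex \<Rightarrow> complex) \<Rightarrow> complex" where
  "kernel_functional k f = disc_integral (\<lambda>z. f z * cnj (poly k z))"

definition functional_norm :: "real \<Rightarrow> complex poly \<Rightarrow> real" where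
  "functional_norm p k = (SUP g \<in> {g. in_Bergman p g \<and> Bergman_norm p g = 1}.
      norm (kernel_functional k g))"

definition is_extremal :: "real \<Rightarrow> complex poly \<Rightarrow> (complex \<Rightarrow> complex) \<Rightarrow> bool" where
  "is_extremal p k F \<longleftrightarrow> in_Bergman p F \<and> Bergman_norm p F = 1 \<and>
     Re (kernel_functional k F) = functional_norm p k"

text \<open>K(z) = (1/z) \<integral>_0^z k, written via the segment parametrization zeta = t z.\<close>
definition Kfun :: "complex poly \<Rightarrow> complex \<Rightarrow> complex" where
  "Kfun k z = (LBINT t=0..1. poly k (of_real t * z))"

end

theory Submission
  imports Defs "HOL-Complex_Analysis.Complex_Analysis"
begin

text \<open>
  Write \<open>F\<^sub>t(z) = F(e\<^sup>i\<^sup>tz)\<close>. Extremality gives \<open>\<integral> |F|\<^sup>p\<^sup>-\<^sup>2 cnj F g d\<sigma> = \<phi>(g) / \<parallel>\<phi>\<parallel>\<close> for all \<open>g\<close>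
  in \<open>A\<^sup>p\<close>. Since \<open>k\<close> is a polynomial, \<open>\<phi>(F\<^sub>t)\<close> is a trigonometric polynomial in \<open>t\<close>, so that
  the pairing of \<open>|F\<^sub>t|\<^sup>p\<^sup>-\<^sup>2 cnj F\<^sub>t - |F|\<^sup>p\<^sup>-\<^sup>2 cnj F\<close> with \<open>F\<^sub>t - F\<close>, a second difference
  of \<open>\<phi>(F\<^sub>t)\<close>, is \<open>O(t\<^sup>2)\<close>. By strong monotonicity of \<open>w \<mapsto> |w|\<^sup>p\<^sup>-\<^sup>2 w\<close> and Fatou's lemma,
  \<open>|F|\<^sup>p\<^sup>-\<^sup>1 |F'|\<close> is integrable over the disc. Hence \<open>|F|\<^sup>p\<^sup>-\<^sup>1 F\<close> has finite length on almost every
  radius, which yields the radial limits, an integrable bound for \<open>|F|\<^sup>p\<close> along radii and with it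
  membership in \<open>H\<^sup>p\<close>. It also justifies Green's formula up to the circle,
  \<open>1/2\<pi> \<integral> |F|\<^sup>p h d\<theta> = \<integral> |F|\<^sup>p\<^sup>-\<^sup>2 cnj F ((zh)' F + p/2 zh F') d\<sigma>\<close>. The first term is
  evaluated by the variational identity, the second by differentiating that identity for
  \<open>g = h F\<^sub>t\<close> at \<open>t = 0\<close>; comparing the moments of \<open>F\<close> on the disc with those on the circle
  finishes the proof.
\<close>

section \<open>Rotation invariance and polar coordinates\<close>

text \<open>The exponents fit together as follows. Formally, the O(t^2) bound says that the angular
  derivative of |F|^(p/2-1) F is square integrable. Multiplying it by |F|^(p/2), which is square
  integrable as well, yields an integrable |F|^(p-1) |F'|; \<open>rpow_diff_bound\<close> is this
  product for differences, where zeros of F cause no trouble. For p < 2 the factor |F|^(p-2) is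
  unbounded near zeros of F, so everything is phrased with \<open>rpow s w\<close> = |w|^s w, which
  is continuous at 0 for s > -1.

  All integrals in the final formula reduce to the disc moments M(m,j) of z^m F against the
  conjugate of z^j. The variational identity expresses the integral of |F|^p z^m through them,
  differentiating along rotations multiplies M(m,j) by j - m, and passing to the circle multiplies
  it by 2j + 2. The function K enters because its coefficients carry 1/(j+1), which turns the circle
  factor 2j + 2 into a constant.\<close>

lemma lborel_complex_eq:
  "(lborel :: complex measure) = distr (lborel \<Otimes>\<^sub>M lborel) borel (\<lambda>(x, y). Complex x y)"
proof (rule lborel_eqI)
  fix l u :: complex
  assume le: "\<And>b. b \<in> Basis \<Longrightarrow> l \<bullet> b \<le> u \<bullet> b"
  have le': "Re l \<le> Re u" "Im l \<le> Im u"
    using le[of 1] le[of \<i>] by (auto simp: Basis_complex_def)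
  have m: "(\<lambda>(x, y). Complex x y) \<in> borel_measurable (lborel \<Otimes>\<^sub>M lborel)"
    unfolding Complex_eq by measurable
  have "(\<lambda>(x, y). Complex x y) -` box l u = box (Re l) (Re u) \<times> box (Im l) (Im u)"
    by (auto simp: in_box_complex_iff box_real)
  then have "emeasure (distr (lborel \<Otimes>\<^sub>M lborel) borel (\<lambda>(x, y). Complex x y)) (box l u)
      = emeasure lborel (box (Re l) (Re u)) * emeasure lborel (box (Im l) (Im u))"
    using m by (simp add: emeasure_distr space_pair_measure lborel.emeasure_pair_measure_Times)
  also have "\<dots> = ennreal (\<Prod>b\<in>Basis. (u - l) \<bullet> b)"
    using le' by (simp add: Basis_complex_def box_real ennreal_mult'' inner_diff_left)
  finally show "emeasure (distr (lborel \<Otimes>\<^sub>M lborel) borel (\<lambda>(x, y). Complex x y)) (box l u)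
      = (\<Prod>b\<in>Basis. (u - l) \<bullet> b)" .
qed simp

lemma Complex_measurable [measurable]:
  assumes "f \<in> borel_measurable M" "g \<in> borel_measurable M"
  shows "(\<lambda>x. Complex (f x) (g x)) \<in> borel_measurable M"
  using assms unfolding Complex_eq by measurable

lemma nn_integral_lborel_complex:
  assumes [measurable]: "f \<in> borel_measurable borel"
  shows "(\<integral>\<^sup>+z. f z \<partial>lborel) = (\<integral>\<^sup>+x. \<integral>\<^sup>+y. f (Complex x y) \<partial>lborel \<partial>lborel)"
    and "(\<integral>\<^sup>+z. f z \<partial>lborel) = (\<integral>\<^sup>+y. \<integral>\<^sup>+x. f (Complex x y) \<partial>lborel \<partial>lborel)"
proof -
  have *: "(\<integral>\<^sup>+z. f z \<partial>lborel) = (\<integral>\<^sup>+w. f (Complex (fst w) (snd w)) \<partial>(lborel \<Otimes>\<^sub>M lborel))"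
    by (subst lborel_complex_eq, subst nn_integral_distr)
       (auto simp: case_prod_beta)
  show "(\<integral>\<^sup>+z. f z \<partial>lborel) = (\<integral>\<^sup>+x. \<integral>\<^sup>+y. f (Complex x y) \<partial>lborel \<partial>lborel)"
    unfolding * by (subst lborel.nn_integral_fst[symmetric]) auto
  show "(\<integral>\<^sup>+z. f z \<partial>lborel) = (\<integral>\<^sup>+y. \<integral>\<^sup>+x. f (Complex x y) \<partial>lborel \<partial>lborel)"
    unfolding * by (subst lborel_pair.nn_integral_snd[symmetric]) auto
qed

lemma nn_integral_lborel_shift:
  fixes a :: real and f :: "real \<Rightarrow> ennreal"
  assumes [measurable]: "f \<in> borel_measurable borel"
  shows "(\<integral>\<^sup>+x. f (x + a) \<partial>lborel) = (\<integral>\<^sup>+x. f x \<partial>lborel)"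
  by (subst (2) lborel_distr_plus[of a, symmetric], subst nn_integral_distr)
     (auto simp: add.commute)

text \<open>A shear translates each horizontal (or vertical) line by a constant, so Tonelli reduces
  the claim to translation invariance on the real line.\<close>

lemma nn_integral_shear:
  fixes f :: "complex \<Rightarrow> ennreal"
  assumes [measurable]: "f \<in> borel_measurable borel"
  shows "(\<integral>\<^sup>+z. f (z + of_real (a * Im z)) \<partial>lborel) = (\<integral>\<^sup>+z. f z \<partial>lborel)"
    and "(\<integral>\<^sup>+z. f (z + \<i> * of_real (a * Re z)) \<partial>lborel) = (\<integral>\<^sup>+z. f z \<partial>lborel)"
proof -
  have [simp]: "Complex x y + of_real (a * y) = Complex (x + a * y) y" 
    "Complex x y + \<i> * of_real (a * x) = Complex x (y + a * x)" for x y
    by (auto simp: complex_eq_iff)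
  show "(\<integral>\<^sup>+z. f (z + of_real (a * Im z)) \<partial>lborel) = (\<integral>\<^sup>+z. f z \<partial>lborel)"
    by (simp add: nn_integral_lborel_complex(2) nn_integral_lborel_shift[of "\<lambda>x. f (Complex x y)" for y] del: of_real_mult)
  show "(\<integral>\<^sup>+z. f (z + \<i> * of_real (a * Re z)) \<partial>lborel) = (\<integral>\<^sup>+z. f z \<partial>lborel)"
    by (simp add: nn_integral_lborel_complex(1) nn_integral_lborel_shift[of "\<lambda>y. f (Complex x y)" for x] del: of_real_mult)
qed

text \<open>A plane rotation is a product of three shears, so its invariance follows from that of
  shears, without determinants.\<close>

lemma nn_integral_rotate:
  fixes f :: "complex \<Rightarrow> ennreal"
  assumes [measurable]: "f \<in> borel_measurable borel" 
  shows "(\<integral>\<^sup>+z. f (cis t * z) \<partial>lborel) = (\<integral>\<^sup>+z. f z \<partial>lborel)"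
proof -
  have A: "(\<integral>\<^sup>+z. g (cis t * z) \<partial>lborel) = (\<integral>\<^sup>+z. g z \<partial>lborel)"
    if [measurable]: "g \<in> borel_measurable borel" and s: "sin t \<noteq> 0" for t and g :: "complex \<Rightarrow> ennreal"
  proof -
    \<comment> \<open>This is -tan(t/2), the coefficient of both horizontal shears in the
      factorization; the vertical shear between them has coefficient sin t.\<close>
    define a where "a = (cos t - 1) / sin t"
    define S where "S = (\<lambda>z. z + of_real (a * Im z))"
    define T where "T = (\<lambda>z. z + \<i> * of_real (sin t * Re z))"
    have [measurable]: "S \<in> borel_measurable borel" "T \<in> borel_measurable borel"
      unfolding S_def T_def by measurable
    have as: "a * sin t = cos t - 1" using s by (simp add: a_def)
    have ac: "a * (1 + cos t) = - sin t"
      using s sin_cos_squared_add[of t] by (simp add: a_def field_simps power2_eq_square)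
    have eq: "S (T (S z)) = cis t * z" for z
    proof -
      have "Re (S (T (S z))) = Re z * (1 + a * sin t) + Im z * (a + a * (1 + a * sin t))"
           "Im (S (T (S z))) = Im z * (1 + a * sin t) + sin t * Re z"
        by (simp_all add: S_def T_def algebra_simps)
      moreover have "a + a * (1 + a * sin t) = - sin t" "1 + a * sin t = cos t"
        using ac as by (simp_all add: algebra_simps)
      ultimately have "Re (S (T (S z))) = Re z * cos t - Im z * sin t"
           "Im (S (T (S z))) = Im z * cos t + sin t * Re z"
        by simp_all
      then show ?thesis by (simp add: complex_eq_iff mult.commute)
    qed
    have "(\<integral>\<^sup>+z. g (cis t * z) \<partial>lborel) = (\<integral>\<^sup>+z. g (S (T (S z))) \<partial>lborel)"
      by (simp add: eq)
    also have "\<dots> = (\<integral>\<^sup>+z. g (S (T z)) \<partial>lborel)"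
      by (subst nn_integral_shear(1)[of "\<lambda>z. g (S (T z))" a, symmetric]) (auto simp: S_def)
    also have "\<dots> = (\<integral>\<^sup>+z. g (S z) \<partial>lborel)"
      by (subst nn_integral_shear(2)[of "\<lambda>z. g (S z)" "sin t", symmetric]) (auto simp: T_def)
    also have "\<dots> = (\<integral>\<^sup>+z. g z \<partial>lborel)"
      by (subst nn_integral_shear(1)[of g a, symmetric]) (auto simp: S_def)
    finally show ?thesis .
  qed
  show ?thesis
  proof (cases "sin t = 0")
    case False
    then show ?thesis using A[of f t] by simp
  next
    \<comment> \<open>The shear coefficient divides by sin t. Splitting off a quarter turn leaves
      two rotations with sines 1 and -cos t, both nonzero.\<close>
    case True
    then have c: "cos t \<noteq> 0" using sin_zero_abs_cos_one by fastforce
    have "(\<integral>\<^sup>+z. f (cis t * z) \<partial>lborel) = (\<integral>\<^sup>+z. f (cis (t - pi/2) * (cis (pi/2) * z)) \<partial>lborel)"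
      by (simp only: mult.assoc[symmetric] cis_mult) simp
    also have "\<dots> = (\<integral>\<^sup>+z. f (cis (t - pi/2) * z) \<partial>lborel)"
      by (rule A[of "\<lambda>z. f (cis (t - pi/2) * z)" "pi/2"]) auto
    also have "\<dots> = (\<integral>\<^sup>+z. f z \<partial>lborel)"
      by (rule A) (use c in \<open>auto simp: sin_diff\<close>)
    finally show ?thesis .
  qed
qed

text \<open>Both measures give \<open>{..a}\<close> the area of the closed disc of radius a (0 for
  negative a), and these half-lines form an intersection-stable generator.\<close>

lemma distr_lborel_norm:
  "distr lborel borel (norm :: complex \<Rightarrow> real) = density lborel (\<lambda>r. ennreal (2 * pi * r) * indicator {0..} r)"
proof -
  have on_atMost: "emeasure (distr lborel borel (norm :: complex \<Rightarrow> real)) {..a}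
      = emeasure (density lborel (\<lambda>r. ennreal (2 * pi * r) * indicator {0..} r)) {..a}" for a
  proof (cases "a \<ge> 0")
    case False
    then have "(norm :: complex \<Rightarrow> real) -` {..a} = {}" "{..a} \<inter> {0..} = {}"
      by (auto dest: order_trans[OF norm_ge_zero])
    moreover have "(\<lambda>r. ennreal (2 * pi * r) * indicator {0..} r * indicator {..a} r) = (\<lambda>r. 0)"
      using False by (auto simp: indicator_def)
    ultimately show ?thesis by (simp add: emeasure_distr emeasure_density)
  next
    case True
    have "(norm :: complex \<Rightarrow> real) -` {..a} = cball 0 a" by (auto simp: dist_norm)
    then have "emeasure (distr lborel borel (norm :: complex \<Rightarrow> real)) {..a} = ennreal (pi * a\<^sup>2)"
      using True by (simp add: emeasure_distr emeasure_cball unit_ball_vol_2)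
    moreover have "emeasure (density lborel (\<lambda>r. ennreal (2 * pi * r) * indicator {0..} r)) {..a}
      = (\<integral>\<^sup>+r. ennreal (2 * pi * r) * indicator {0..a} r \<partial>lborel)"
      by (subst emeasure_density) (auto intro!: nn_integral_cong simp: indicator_def)
    moreover have "\<dots> = ennreal (pi * a\<^sup>2 - pi * 0\<^sup>2)"
      by (rule nn_integral_FTC_Icc[where F = "\<lambda>r. pi * r\<^sup>2"])
         (auto intro!: derivative_eq_intros simp: True)
    ultimately show ?thesis by simp
  qed
  show ?thesis
  proof (rule measure_eqI_generator_eq[where E = "range atMost" and A = "\<lambda>i. {..real i}" and \<Omega> = UNIV])
    show "Int_stable (range (atMost :: real \<Rightarrow> _))"
      by (auto simp: Int_stable_def)
    show "(\<Union>i. {..real i}) = UNIV" by (auto intro: real_arch_simple)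
    show "emeasure (distr lborel borel (norm :: complex \<Rightarrow> real)) {..real i} \<noteq> \<infinity>" for i
    proof -
      have "(norm :: complex \<Rightarrow> real) -` {..real i} = cball 0 (real i)" by (auto simp: dist_norm)
      then show ?thesis by (simp add: emeasure_distr emeasure_cball)
    qed
    show "sets (distr lborel borel (norm :: complex \<Rightarrow> real)) = sigma_sets UNIV (range atMost)"
      "sets (density lborel (\<lambda>r. ennreal (2 * pi * r) * indicator {0..} r)) = sigma_sets UNIV (range atMost)"
      by (simp_all add: borel_eq_atMost)
  qed (auto simp: on_atMost)
qed

text \<open>The argument of z merely shifts the window of integration, and a window of length 2 pi
  may be moved freely under a periodic integrand. What remains depends on z only through its
  modulus.\<close>

lemma nn_integral_circle_periodic:
  fixes f :: "complex \<Rightarrow> ennreal"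
  assumes [measurable]: "f \<in> borel_measurable borel" 
  shows "(\<integral>\<^sup>+t\<in>{0..2*pi}. f (cis t * z) \<partial>lborel) = (\<integral>\<^sup>+t\<in>{0..2*pi}. f (of_real (norm z) * cis t) \<partial>lborel)"
proof -
  define a where "a = Arg2pi z"
  have a: "0 \<le> a" "a < 2 * pi" using Arg2pi[of z] by (auto simp: a_def)
  have z: "z = of_real (norm z) * cis a" using Arg2pi[of z] unfolding a_def is_Arg_def cis_conv_exp by blast
  have rot: "cis t * z = of_real (norm z) * cis (t + a)" for t
    by (metis z cis_mult mult.left_commute mult.commute)
  define g where "g = (\<lambda>t. f (of_real (norm z) * cis t))"
  have [measurable]: "g \<in> borel_measurable borel"
    unfolding g_def cis_conv_exp by measurable
  have per: "g (t + 2 * pi) = g t" for t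
  proof -
    have "cis (t + 2 * pi) = cis t" by (simp add: complex_eq_iff)
    then show ?thesis by (simp add: g_def)
  qed
  have "(\<integral>\<^sup>+t\<in>{0..2*pi}. f (cis t * z) \<partial>lborel) = (\<integral>\<^sup>+t. g (t + a) * indicator {a..a+2*pi} (t + a) \<partial>lborel)"
    by (rule nn_integral_cong) (auto simp: g_def rot indicator_def)
  also have "\<dots> = (\<integral>\<^sup>+t. g t * indicator {a..a+2*pi} t \<partial>lborel)"
    by (rule nn_integral_lborel_shift) measurable
  also have "\<dots> = (\<integral>\<^sup>+t. g t * indicator {a..<2*pi} t + g t * indicator {2*pi..a+2*pi} t \<partial>lborel)"
    by (rule nn_integral_cong) (use a in \<open>auto simp: indicator_def\<close>)
  also have "\<dots> = (\<integral>\<^sup>+t. g t * indicator {a..<2*pi} t \<partial>lborel) + (\<integral>\<^sup>+t. g t * indicator {2*pi..a+2*pi} t \<partial>lborel)"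
    by (rule nn_integral_add) measurable
  also have "(\<integral>\<^sup>+t. g t * indicator {2*pi..a+2*pi} t \<partial>lborel)
      = (\<integral>\<^sup>+t. g (t + 2*pi) * indicator {2*pi..a+2*pi} (t + 2*pi) \<partial>lborel)"
    by (rule nn_integral_lborel_shift[symmetric]) measurable
  also have "\<dots> = (\<integral>\<^sup>+t. g t * indicator {0..a} t \<partial>lborel)"
    by (rule nn_integral_cong) (auto simp: per indicator_def)
  also have "(\<integral>\<^sup>+t. g t * indicator {a..<2*pi} t \<partial>lborel) + \<dots>
      = (\<integral>\<^sup>+t. g t * indicator {a..<2*pi} t + g t * indicator {0..a} t \<partial>lborel)"
    by (rule nn_integral_add[symmetric]) measurable
  also have "\<dots> = (\<integral>\<^sup>+t. g t * indicator {0..2*pi} t \<partial>lborel)"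
  proof (rule nn_integral_cong_AE)
    have "AE t in lborel. t \<noteq> a" "AE t in lborel. t \<noteq> 2 * pi" by (auto intro: AE_lborel_singleton)
    then show "AE t in lborel. g t * indicator {a..<2*pi} t + g t * indicator {0..a} t = g t * indicator {0..2*pi} t"
      by eventually_elim (use a in \<open>auto simp: indicator_def\<close>)
  qed
  finally show ?thesis by (simp add: g_def)
qed

lemma cis_measurable [measurable]: 
  "f \<in> borel_measurable M \<Longrightarrow> (\<lambda>x. cis (f x)) \<in> borel_measurable M"
  unfolding cis_conv_exp by measurable

text \<open>Rotation invariance is integrated over all angles and the order exchanged; the inner
  integral then depends on |z| only and is pushed forward by the norm. The factor 2 pi from the
  angles cancels the one in the density of |z|.\<close>

lemma nn_integral_polar:
  fixes f :: "complex \<Rightarrow> ennreal"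
  assumes [measurable]: "f \<in> borel_measurable borel" 
  shows "(\<integral>\<^sup>+z. f z \<partial>lborel)
    = (\<integral>\<^sup>+r\<in>{0..}. (\<integral>\<^sup>+t\<in>{0..2*pi}. ennreal r * f (of_real r * cis t) \<partial>lborel) \<partial>lborel)"
proof -
  have "ennreal (2 * pi) * (\<integral>\<^sup>+z. f z \<partial>lborel) = (\<integral>\<^sup>+t\<in>{0..2*pi}. (\<integral>\<^sup>+z. f (cis t * z) \<partial>lborel) \<partial>lborel)"
    unfolding nn_integral_rotate[OF assms] by (subst nn_integral_cmult_indicator) (auto simp: mult.commute)
  also have "\<dots> = (\<integral>\<^sup>+t. (\<integral>\<^sup>+z. f (cis t * z) * indicator {0..2*pi} t \<partial>lborel) \<partial>lborel)"
    by (subst nn_integral_multc) auto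
  also have "\<dots> = (\<integral>\<^sup>+z. (\<integral>\<^sup>+t\<in>{0..2*pi}. f (cis t * z) \<partial>lborel) \<partial>lborel)"
    by (rule lborel_pair.Fubini') measurable
  also have "\<dots> = (\<integral>\<^sup>+z. (\<integral>\<^sup>+t\<in>{0..2*pi}. f (of_real (norm z) * cis t) \<partial>lborel) \<partial>(lborel :: complex measure))"
    by (subst nn_integral_circle_periodic) auto
  also have "\<dots> = (\<integral>\<^sup>+r. (\<integral>\<^sup>+t\<in>{0..2*pi}. f (of_real r * cis t) \<partial>lborel) \<partial>distr lborel borel (norm :: complex \<Rightarrow> real))"
    by (subst nn_integral_distr) auto
  also have "\<dots> = (\<integral>\<^sup>+r. ennreal (2 * pi) * ((\<integral>\<^sup>+t\<in>{0..2*pi}. ennreal r * f (of_real r * cis t) \<partial>lborel) * indicator {0..} r) \<partial>lborel)"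
    unfolding distr_lborel_norm
    by (subst nn_integral_density)
       (auto intro!: nn_integral_cong simp: indicator_def mult_ac nn_integral_cmult ennreal_mult')
  also have "\<dots> = ennreal (2 * pi) * (\<integral>\<^sup>+r\<in>{0..}. (\<integral>\<^sup>+t\<in>{0..2*pi}. ennreal r * f (of_real r * cis t) \<partial>lborel) \<partial>lborel)"
    by (subst nn_integral_cmult) auto
  finally show ?thesis
    by (subst (asm) ennreal_mult_cancel_left) auto
qed

text \<open>As an identity of measures, polar coordinates also transfer integrability and Bochner
  integrals, not just integrals of nonnegative functions. The density removes negative radii and
  restricts the angle to one period.\<close>

lemma lborel_eq_distr_polar:
  "(lborel :: complex measure) = distr (density (lborel \<Otimes>\<^sub>M lborel)
      (\<lambda>(t, r). ennreal (r * indicator {0..} r * indicator {0..2*pi} t))) borel (\<lambda>(t, r). of_real r * cis t)"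
  (is "_ = distr ?M _ ?g")
proof (rule measure_eqI)
  fix A :: "complex set"
  assume "A \<in> sets lborel"
  then have [measurable]: "A \<in> sets borel" by simp
  have "emeasure lborel A = (\<integral>\<^sup>+z. indicator A z \<partial>lborel)" by simp
  also have "\<dots> = (\<integral>\<^sup>+r\<in>{0..}. (\<integral>\<^sup>+t\<in>{0..2*pi}. ennreal r * indicator A (of_real r * cis t) \<partial>lborel) \<partial>lborel)"
    by (rule nn_integral_polar) measurable
  also have "\<dots> = (\<integral>\<^sup>+r. \<integral>\<^sup>+t. ennreal (r * indicator {0..} r * indicator {0..2*pi} t) * indicator A (of_real r * cis t) \<partial>lborel \<partial>lborel)"
    by (subst nn_integral_multc[symmetric]) (auto intro!: nn_integral_cong simp: indicator_def)
  also have "\<dots> = (\<integral>\<^sup>+w. ennreal (snd w * indicator {0..} (snd w) * indicator {0..2*pi} (fst w))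
       * indicator A (of_real (snd w) * cis (fst w)) \<partial>(lborel \<Otimes>\<^sub>M lborel))"
    by (subst lborel_pair.nn_integral_snd[symmetric]) auto
  also have "\<dots> = (\<integral>\<^sup>+w. indicator A (of_real (snd w) * cis (fst w)) \<partial>?M)"
    by (subst nn_integral_density) (auto simp: case_prod_beta)
  also have "\<dots> = (\<integral>\<^sup>+z. indicator A z \<partial>distr ?M borel ?g)"
    by (subst nn_integral_distr) (auto simp: case_prod_beta)
  also have "\<dots> = emeasure (distr ?M borel ?g) A"
    by simp
  finally show "emeasure lborel A = emeasure (distr ?M borel ?g) A" .
qed simp

lemma polar_pair:
  fixes f :: "complex \<Rightarrow> 'b :: {banach, second_countable_topology}"
  assumes "set_borel_measurable borel (ball 0 R) f" 
  shows "set_integrable lborel (ball 0 R) f \<longleftrightarrow>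
      set_integrable (lborel \<Otimes>\<^sub>M lborel) ({0..2*pi} \<times> {0..<R}) (\<lambda>w. snd w *\<^sub>R f (of_real (snd w) * cis (fst w)))" (is ?A)
    and "(LINT z:ball 0 R|lborel. f z) =
      (LINT w:{0..2*pi} \<times> {0..<R}|(lborel \<Otimes>\<^sub>M lborel). snd w *\<^sub>R f (of_real (snd w) * cis (fst w)))" (is ?B)
proof -
  define g where "g = (\<lambda>z. indicator (ball 0 R) z *\<^sub>R f z)"
  have [measurable]: "g \<in> borel_measurable borel"
    using assms by (simp add: g_def set_borel_measurable_def)
  define d where "d = (\<lambda>(t, r). r * indicator {0..} r * indicator {0..2*pi} t :: real)"
  have d [measurable]: "d \<in> borel_measurable (lborel \<Otimes>\<^sub>M lborel)" unfolding d_def by measurable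
  have d0: "d w \<ge> 0" for w by (auto simp: d_def case_prod_beta indicator_def)
  define M where "M = density (lborel \<Otimes>\<^sub>M lborel) (\<lambda>w. ennreal (d w))"
  define c where "c = (\<lambda>(t, r). of_real r * cis t)"
  have c [measurable]: "c \<in> borel_measurable (lborel \<Otimes>\<^sub>M lborel)" unfolding c_def by measurable
  have cM [measurable]: "c \<in> borel_measurable M" unfolding M_def by measurable
  have L: "lborel = distr M borel c"
    unfolding M_def c_def d_def using lborel_eq_distr_polar by (simp add: case_prod_unfold)
  have eq: "d w *\<^sub>R g (c w) = indicator ({0..2*pi} \<times> {0..<R}) w *\<^sub>R (snd w *\<^sub>R f (of_real (snd w) * cis (fst w)))" for w
    by (auto simp: d_def c_def g_def case_prod_beta indicator_def norm_mult mem_Times_iff)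
  have "set_integrable lborel (ball 0 R) f \<longleftrightarrow> integrable lborel g"
    by (simp add: set_integrable_def g_def)
  also have "\<dots> \<longleftrightarrow> integrable M (\<lambda>w. g (c w))"
    by (subst L, subst integrable_distr_eq) auto
  also have "\<dots> \<longleftrightarrow> integrable (lborel \<Otimes>\<^sub>M lborel) (\<lambda>w. d w *\<^sub>R g (c w))"
    unfolding M_def using d0 by (subst integrable_density) auto
  finally show ?A by (simp add: eq set_integrable_def)
  have "(LINT z:ball 0 R|lborel. f z) = (LINT z|lborel. g z)"
    by (simp add: set_lebesgue_integral_def g_def)
  also have "\<dots> = (LINT w|M. g (c w))"
    by (subst L, subst integral_distr) auto
  also have "\<dots> = (LINT w|(lborel \<Otimes>\<^sub>M lborel). d w *\<^sub>R g (c w))"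
    unfolding M_def using d0 by (subst integral_density) auto
  finally show ?B by (simp add: eq set_lebesgue_integral_def)
qed

text \<open>Both orders of integration are recorded: the angle outside for arguments along single
  radii, the radius outside for arguments on single circles.\<close>

lemma polar_iterated:
  fixes f :: "complex \<Rightarrow> 'b :: {banach, second_countable_topology}"
  assumes f: "set_integrable lborel (ball 0 R) f" 
  shows "AE t in lborel. t \<in> {0..2*pi} \<longrightarrow> set_integrable lborel {0..<R} (\<lambda>r. r *\<^sub>R f (of_real r * cis t))" (is ?A)
    and "set_integrable lborel {0..2*pi} (\<lambda>t. LINT r:{0..<R}|lborel. r *\<^sub>R f (of_real r * cis t))" (is ?B)
    and "(LINT z:ball 0 R|lborel. f z) = (LINT t:{0..2*pi}|lborel. LINT r:{0..<R}|lborel. r *\<^sub>R f (of_real r * cis t))" (is ?C)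
    and "(LINT z:ball 0 R|lborel. f z) = (LINT r:{0..<R}|lborel. LINT t:{0..2*pi}|lborel. r *\<^sub>R f (of_real r * cis t))" (is ?D)
proof -
  have m: "set_borel_measurable borel (ball 0 R) f"
    using f by (auto simp: set_integrable_def set_borel_measurable_def)
  define g where "g = (\<lambda>w. indicator ({0..2*pi} \<times> {0..<R}) w *\<^sub>R (snd w *\<^sub>R f (of_real (snd w) * cis (fst w))))"
  have g: "integrable (lborel \<Otimes>\<^sub>M lborel) g"
    using f polar_pair(1)[OF m] by (simp add: g_def set_integrable_def)
  have gt: "g (t, r) = indicator {0..2*pi} t *\<^sub>R (indicator {0..<R} r *\<^sub>R (r *\<^sub>R f (of_real r * cis t)))" for t r
    by (auto simp: g_def indicator_def)
  have "AE t in lborel. integrable lborel (\<lambda>r. g (t, r))"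
    using lborel_pair.AE_integrable_fst'[OF g] by simp
  then show ?A
    by eventually_elim (auto simp: gt set_integrable_def)
  show ?B
    using lborel_pair.integrable_fst'[OF g]
    by (simp add: gt set_integrable_def set_lebesgue_integral_def del: scaleR_scaleR)
  have eq: "(LINT z:ball 0 R|lborel. f z) = integral\<^sup>L (lborel \<Otimes>\<^sub>M lborel) g"
    unfolding polar_pair(2)[OF m] by (simp add: g_def set_lebesgue_integral_def)
  show ?C unfolding eq
    using lborel_pair.integral_fst'[OF g]
    by (simp add: gt set_lebesgue_integral_def del: scaleR_scaleR)
  have g': "integrable (lborel \<Otimes>\<^sub>M lborel) (case_prod (\<lambda>t r. g (t, r)))"
    using g by simp
  have gt': "g (t, r) = indicator {0..<R} r *\<^sub>R (indicator {0..2*pi} t *\<^sub>R (r *\<^sub>R f (of_real r * cis t)))" for t r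
    by (auto simp: gt indicator_def)
  have *: "(LINT r|lborel. LINT t|lborel. g (t, r)) = integral\<^sup>L (lborel \<Otimes>\<^sub>M lborel) g"
    using lborel_pair.integral_snd[OF g'] by simp
  show ?D unfolding eq *[symmetric] unfolding set_lebesgue_integral_def gt'
    by (simp del: scaleR_scaleR)
qed

lemma distr_lborel_rotate: "distr lborel borel ((*) (cis t)) = (lborel :: complex measure)"
proof (rule measure_eqI)
  fix A :: "complex set"
  assume "A \<in> sets (distr lborel borel ((*) (cis t)))"
  then have [measurable]: "A \<in> sets borel" by simp
  show "emeasure (distr lborel borel ((*) (cis t))) A = emeasure lborel A"
    using nn_integral_rotate[of "indicator A" t]
    by (subst nn_integral_indicator[symmetric], simp, subst nn_integral_distr) auto
qed simp

lemma set_integral_rotate: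
  fixes f :: "complex \<Rightarrow> 'b :: {banach, second_countable_topology}"
  assumes "\<And>z. z \<in> A \<longleftrightarrow> cis t * z \<in> A" and f: "set_integrable lborel A f"
  shows "set_integrable lborel A (\<lambda>z. f (cis t * z))" 
    and "(LINT z:A|lborel. f (cis t * z)) = (LINT z:A|lborel. f z)"
proof -
  define g where "g = (\<lambda>z. indicator A z *\<^sub>R f z)"
  have g: "integrable lborel g" using f by (simp add: g_def set_integrable_def)
  then have [measurable]: "g \<in> borel_measurable borel" by auto
  have eq: "indicator A z *\<^sub>R f (cis t * z) = g (cis t * z)" for z
    using assms(1)[of z] by (auto simp: g_def indicator_def)
  have "integrable (distr lborel borel ((*) (cis t))) g" using g by (simp add: distr_lborel_rotate)
  then show "set_integrable lborel A (\<lambda>z. f (cis t * z))"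
    by (subst (asm) integrable_distr_eq) (auto simp: set_integrable_def eq)
  have "(LINT z:A|lborel. f (cis t * z)) = (LINT z|lborel. g (cis t * z))"
    by (simp add: set_lebesgue_integral_def eq)
  also have "\<dots> = (LINT z|distr lborel borel ((*) (cis t)). g z)"
    by (subst integral_distr) auto
  finally show "(LINT z:A|lborel. f (cis t * z)) = (LINT z:A|lborel. f z)"
    by (simp add: distr_lborel_rotate g_def set_lebesgue_integral_def)
qed

section \<open>Radial powers\<close>

text \<open>Three exponents matter. For s = p - 2 it is the duality map, 1/p times the gradient of
  |w|^p; for s = p/2 - 1 its squared modulus is |w|^p; for s = p - 1 its modulus is |w|^p and its
  differential is of size |w|^(p-1).\<close>

definition rpow :: "real \<Rightarrow> complex \<Rightarrow> complex" where
  "rpow s w = of_real (norm w powr s) * w"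

lemma rpow_0 [simp]: "rpow s 0 = 0"
  by (simp add: rpow_def)

lemma norm_rpow: "norm (rpow s w) = norm w powr (s + 1)"
  by (cases "w = 0") (auto simp: rpow_def norm_mult powr_add)

text \<open>Radial powers keep the argument and act on the modulus by the exponent s + 1, so the
  inverse has modulus exponent 1/(s+1).\<close>

lemma rpow_inverse:
  assumes "s > -1"
  shows "rpow (1 / (s + 1) - 1) (rpow s w) = w"
proof (cases "w = 0")
  case False
  have "(s + 1) * (1 / (s + 1) - 1) + s = 0"
    using assms by (simp add: field_simps)
  then have "norm w powr ((s + 1) * (1 / (s + 1) - 1)) * norm w powr s = 1"
    using False by (simp flip: powr_add)
  then have "complex_of_real (norm w powr ((s + 1) * (1 / (s + 1) - 1))) * of_real (norm w powr s) = 1"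
    by (metis of_real_1 of_real_mult)
  then show ?thesis
    unfolding rpow_def[of "1 / (s + 1) - 1"] norm_rpow powr_powr
    by (simp add: rpow_def mult.assoc[symmetric])
qed simp

section \<open>Differentiability and continuity of radial powers\<close>

lemma has_derivative_zero_superlinear:
  fixes g :: "'a::real_normed_vector \<Rightarrow> 'b::real_normed_vector"
  assumes "q > 1" "\<And>v. norm (g v) \<le> norm v powr q" 
  shows "(g has_derivative (\<lambda>_. 0)) (at 0)"
proof -
  have g0: "g 0 = 0" using assms(2)[of 0] by simp
  have "((\<lambda>v. norm v powr (q - 1)) \<longlongrightarrow> 0 powr (q - 1)) (at (0::'a))"
    using assms(1) by (intro tendsto_powr2 tendsto_norm_zero tendsto_ident_at) auto
  then have *: "((\<lambda>v::'a. norm v powr (q - 1)) \<longlongrightarrow> 0) (at 0)"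
    by simp
  have "((\<lambda>v. norm (g v) / norm v) \<longlongrightarrow> 0) (at 0)"
  proof (rule tendsto_sandwich[OF _ _ tendsto_const *])
    show "\<forall>\<^sub>F v in at 0. norm (g v) / norm v \<le> norm v powr (q - 1)"
    proof (intro always_eventually allI)
      fix v
      show "norm (g v) / norm v \<le> norm v powr (q - 1)"
        using assms(2)[of v] by (cases "v = 0") (auto simp: powr_diff divide_simps)
    qed
  qed auto
  then show ?thesis
    by (simp add: has_derivative_at g0)
qed

lemma has_derivative_norm_powr:
  fixes w :: complex
  assumes "p > 1"
  shows "((\<lambda>w. norm w powr p) has_derivative (\<lambda>v. p * Re (cnj (rpow (p - 2) w) * v))) (at w)"
proof (cases "w = 0")
  case True
  have "((\<lambda>w::complex. norm w powr p) has_derivative (\<lambda>_. 0)) (at 0)"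
    by (rule has_derivative_zero_superlinear[OF assms]) auto
  with True show ?thesis by simp
next
  case False
  have "((\<lambda>w. norm w powr p) has_derivative (\<lambda>v. norm w powr p * (0 * ln (norm w) + (v \<bullet> sgn w) * p / norm w))) (at w)"
    using False by (intro has_derivative_powr has_derivative_norm has_derivative_const) auto
  moreover have "norm w powr p * (0 * ln (norm w) + (v \<bullet> sgn w) * p / norm w) = p * Re (cnj (rpow (p - 2) w) * v)" for v
  proof -
    have "norm w powr p = norm w powr (p - 2) * (norm w * norm w)"
      using False by (simp add: powr_diff power2_eq_square)
    then show ?thesis using False
      by (simp add: rpow_def sgn_div_norm inner_complex_def field_simps)
  qed
  ultimately show ?thesis by simp
qed

text \<open>The constant p is 1 + (p - 1): the first summand comes from the factor w, the second
  from differentiating its modulus power. At w = 0 the differential vanishes since |w|^p is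
  superlinear.\<close>

lemma has_derivative_rpow:
  assumes "p > 1"
  obtains D where "((rpow (p - 1)) has_derivative D) (at w)"
    "\<And>v. norm (D v) \<le> p * norm w powr (p - 1) * norm v"
proof (cases "w = 0")
  case True
  have "(rpow (p - 1) has_derivative (\<lambda>_. 0)) (at 0)"
    by (rule has_derivative_zero_superlinear[OF assms]) (auto simp: norm_rpow)
  with True show ?thesis using that[of "\<lambda>_. 0"] by simp
next
  case False
  have 1: "((\<lambda>w. norm w powr (p - 1)) has_derivative (\<lambda>v. norm w powr (p - 1) * (0 * ln (norm w) + (v \<bullet> sgn w) * (p - 1) / norm w))) (at w)"
    using False by (intro has_derivative_powr has_derivative_norm has_derivative_const) auto
  have 2: "((\<lambda>w. (norm w powr (p - 1)) *\<^sub>R w) has_derivative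
     (\<lambda>v. (norm w powr (p - 1)) *\<^sub>R v + (norm w powr (p - 1) * (0 * ln (norm w) + (v \<bullet> sgn w) * (p - 1) / norm w)) *\<^sub>R w)) (at w)"
    by (rule has_derivative_scaleR[OF 1 has_derivative_ident])
  have 3: "rpow (p - 1) = (\<lambda>w. (norm w powr (p - 1)) *\<^sub>R w)"
    by (auto simp: rpow_def scaleR_conv_of_real)
  show ?thesis
  proof (rule that[OF 2[folded 3]])
    fix v
    have sg: "\<bar>v \<bullet> sgn w\<bar> \<le> norm v"
      using Cauchy_Schwarz_ineq2[of v "sgn w"] False by (simp add: norm_sgn)
    have "norm ((norm w powr (p - 1) * (0 * ln (norm w) + (v \<bullet> sgn w) * (p - 1) / norm w)) *\<^sub>R w)
       = norm w powr (p - 1) * ((p - 1) * \<bar>v \<bullet> sgn w\<bar>)"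
      using False assms by (simp add: abs_mult)
    also have "\<dots> \<le> norm w powr (p - 1) * ((p - 1) * norm v)"
      using assms sg by (intro mult_left_mono) auto
    finally show "norm ((norm w powr (p - 1)) *\<^sub>R v + (norm w powr (p - 1) * (0 * ln (norm w) + (v \<bullet> sgn w) * (p - 1) / norm w)) *\<^sub>R w)
      \<le> p * norm w powr (p - 1) * norm v"
      by (intro order_trans[OF norm_triangle_ineq]) (simp add: algebra_simps)
  qed
qed

lemma continuous_rpow:
  assumes "s > -1"
  shows "isCont (rpow s) w"
proof (cases "w = 0")
  case False
  then show ?thesis unfolding rpow_def[abs_def]
    by (intro continuous_intros) auto
next
  case True
  have "((\<lambda>v. norm v powr (s + 1)) \<longlongrightarrow> 0 powr (s + 1)) (at (0::complex))"
    using assms by (intro tendsto_powr2 tendsto_norm_zero tendsto_ident_at) auto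
  then have "((\<lambda>v. norm (rpow s v)) \<longlongrightarrow> 0) (at 0)"
    by (simp add: norm_rpow)
  then show ?thesis using True
    by (simp add: isCont_def tendsto_norm_zero_iff)
qed

lemma continuous_on_rpow [continuous_intros]:
  assumes "s > -1" "continuous_on S f"
  shows "continuous_on S (\<lambda>x. rpow s (f x))"
proof -
  have "continuous_on UNIV (rpow s)"
    using continuous_rpow[OF assms(1)] by (simp add: continuous_at_imp_continuous_on)
  then show ?thesis using assms(2) continuous_on_compose2 by blast
qed

lemma rpow_measurable [measurable]:
  "f \<in> borel_measurable M \<Longrightarrow> (\<lambda>x. rpow s (f x)) \<in> borel_measurable M"
  unfolding rpow_def by measurable

section \<open>Pointwise inequalities for radial powers\<close>

lemma rpow_mult_cnj: "cnj (rpow (p - 2) w) * w = of_real (norm w powr p)"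
proof (cases "w = 0")
  case False
  have "cnj (rpow (p - 2) w) * w = of_real (norm w powr (p - 2)) * (w * cnj w)"
    by (simp add: rpow_def)
  also have "\<dots> = of_real (norm w powr (p - 2) * norm w ^ 2)"
    by (simp add: complex_norm_square[symmetric])
  also have "norm w powr (p - 2) * norm w ^ 2 = norm w powr p"
    using False by (simp add: powr_diff)
  finally show ?thesis .
qed simp

text \<open>The lower bound is the arithmetic-geometric mean inequality. For the upper one, x
  y^(p-1) is a weighted geometric mean of (xy)^(p/2) and y^p when p >= 2, and of (xy)^(p/2) and x^p
  when p < 2; in both cases c is the weight of the mixed term.\<close>

lemma Young_bounds:
  fixes x y p :: real
  assumes "p > 1" "x > 0" "y > 0"
  defines "c \<equiv> min (2 / p) (2 - 2 / p)"
  defines "G \<equiv> x powr (p - 1) * y + x * y powr (p - 1)"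
  shows "2 * (x powr (p/2) * y powr (p/2)) \<le> G"
    and "G \<le> 2 * c * (x powr (p/2) * y powr (p/2)) + (1 - c) * (x powr p + y powr p)"
proof -
  have "(x powr (p/2) * y powr (p/2))\<^sup>2 = (x powr (p - 1) * y) * (x * y powr (p - 1))"
    using assms by (simp add: power_mult_distrib powr_diff powr_power)
  from arith_geo_mean[OF this] show "2 * (x powr (p/2) * y powr (p/2)) \<le> G"
    using assms by (simp add: G_def)
  show "G \<le> 2 * c * (x powr (p/2) * y powr (p/2)) + (1 - c) * (x powr p + y powr p)"
  proof (cases "p \<ge> 2")
    case True
    have c: "c = 2 / p" using True by (simp add: c_def field_simps min_def)
    have e: "p / 2 * (2/p) = 1" "p * (1 - 2 / p) = p - 2" using assms by (simp_all add: field_simps)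
    have Y: "x * y powr (p - 1) \<le> 2 / p * (x powr (p/2) * y powr (p/2)) + (1 - 2 / p) * y powr p" if "x > 0" "y > 0" for x y
    proof -
      have "(x powr (p/2) * y powr (p/2)) powr (2/p) * (y powr p) powr (1 - 2 / p) = x * y powr (p - 1)"
        using that assms(1) by (simp add: powr_mult powr_powr e) (simp add: powr_diff power2_eq_square)
      then show ?thesis
        using Youngs_inequality_0[of "2/p" "1 - 2/p" "x powr (p/2) * y powr (p/2)" "y powr p"] True that by auto
    qed
    show ?thesis
      using Y[of x y] Y[of y x] assms unfolding c G_def by (simp add: algebra_simps)
  next
    case False
    have c: "c = 2 - 2 / p" using False assms by (simp add: c_def field_simps min_def)
    have Y: "x * y powr (p - 1) \<le> (2 - 2 / p) * (x powr (p/2) * y powr (p/2)) + (2 / p - 1) * x powr p" if "x > 0" "y > 0" for x y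
    proof -
      have e: "p * (2 - 2/p) / 2 = p - 1" "p * (2 / p - 1) = 2 - p" using assms by (simp_all add: field_simps)
      have "(x powr (p/2) * y powr (p/2)) powr (2 - 2/p) * (x powr p) powr (2 / p - 1) = x * y powr (p - 1)"
        using that assms(1) by (simp add: powr_mult powr_powr e) (simp add: powr_diff power2_eq_square)
      then show ?thesis
        using Youngs_inequality_0[of "2 - 2/p" "2/p - 1" "x powr (p/2) * y powr (p/2)" "x powr p"] False that assms
        by (auto simp: field_simps)
    qed
    show ?thesis
      using Y[of x y] Y[of y x] assms unfolding c G_def by (simp add: algebra_simps)
  qed
qed

text \<open>With X = |a|^(p/2), Y = |b|^(p/2) and u the cosine of the angle between a and b, the
  left side is X^2 + Y^2 - u G, with G as in \<open>Young_bounds\<close>, and the squared norm on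
  the right is X^2 + Y^2 - 2 u X Y. The claim thus compares G with 2 X Y.\<close>

lemma rpow_monotone:
  assumes "p > 1"
  shows "Re ((cnj (rpow (p - 2) a) - cnj (rpow (p - 2) b)) * (a - b))
     \<ge> min (2 / p) (2 - 2 / p) * (norm (rpow (p/2 - 1) a - rpow (p/2 - 1) b))\<^sup>2"
proof -
  define c where "c = min (2 / p) (2 - 2 / p)"
  have c: "0 < c" "c \<le> 1" using assms by (auto simp: c_def field_simps min_def)
  show ?thesis
  proof (cases "a = 0 \<or> b = 0")
    case True
    have *: "c * (norm w powr (p/2))\<^sup>2 \<le> norm w powr p" for w :: complex
      using c by (cases "w = 0") (auto simp: mult_left_le_one_le powr_power)
    moreover have "Re (rpow (p - 2) w) * Re w + Im (rpow (p - 2) w) * Im w = norm w powr p" for w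
      using arg_cong[OF rpow_mult_cnj[of p w], of Re] by simp
    ultimately show ?thesis
      using True by (auto simp: norm_rpow c_def[symmetric])
  next
    case False
    define x y u where "x = norm a" "y = norm b" "u = Re (cnj a * b) / (x * y)"
    have xy: "x > 0" "y > 0" using False by (auto simp: x_y_u_def)
    have uxy: "Re (cnj a * b) = u * (x * y)" using xy by (simp add: x_y_u_def(3))
    have uxy': "Re (cnj b * a) = u * (x * y)" using uxy by (simp add: mult.commute)
    have "\<bar>Re (cnj a * b)\<bar> \<le> x * y"
      using abs_Re_le_cmod[of "cnj a * b"] by (simp add: norm_mult x_y_u_def)
    then have u: "\<bar>u\<bar> \<le> 1" using xy by (simp add: x_y_u_def(3))
    define X Y where "X = x powr (p/2)" "Y = y powr (p/2)"
    define G where "G = x powr (p - 1) * y + x * y powr (p - 1)"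
    have XY: "x powr p = X\<^sup>2" "y powr p = Y\<^sup>2" "X > 0" "Y > 0"
      using xy by (auto simp: X_Y_def powr_power)
    have G: "2 * (X * Y) \<le> G" "G \<le> 2 * c * (X * Y) + (1 - c) * (X\<^sup>2 + Y\<^sup>2)"
      using Young_bounds[OF assms xy] unfolding G_def c_def XY X_Y_def[symmetric] by auto
    have "Re ((cnj (rpow (p - 2) a) - cnj (rpow (p - 2) b)) * (a - b))
      = Re (cnj (rpow (p - 2) a) * a) + Re (cnj (rpow (p - 2) b) * b)
         - (x powr (p - 2) * Re (cnj a * b) + y powr (p - 2) * Re (cnj b * a))"
      by (simp add: rpow_def algebra_simps x_y_u_def)
    also have "\<dots> = X\<^sup>2 + Y\<^sup>2 - u * G"
      unfolding uxy uxy' rpow_mult_cnj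
      using xy by (simp add: x_y_u_def(1,2)[symmetric] XY G_def powr_diff field_simps power2_eq_square)
    finally have 1: "Re ((cnj (rpow (p - 2) a) - cnj (rpow (p - 2) b)) * (a - b)) = X\<^sup>2 + Y\<^sup>2 - u * G" .
    have "(norm (A - B))\<^sup>2 = (norm A)\<^sup>2 + (norm B)\<^sup>2 - 2 * Re (cnj A * B)" for A B :: complex
      by (simp add: cmod_power2) (simp add: power2_eq_square algebra_simps)
    then have "(norm (rpow (p/2 - 1) a - rpow (p/2 - 1) b))\<^sup>2
        = (norm (rpow (p/2 - 1) a))\<^sup>2 + (norm (rpow (p/2 - 1) b))\<^sup>2
         - 2 * Re (cnj (rpow (p/2 - 1) a) * rpow (p/2 - 1) b)" .
    also have "Re (cnj (rpow (p/2 - 1) a) * rpow (p/2 - 1) b)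
        = x powr (p/2 - 1) * y powr (p/2 - 1) * Re (cnj a * b)"
      by (simp add: rpow_def x_y_u_def algebra_simps)
    also have "(norm (rpow (p/2 - 1) a))\<^sup>2 + (norm (rpow (p/2 - 1) b))\<^sup>2
         - 2 * (x powr (p/2 - 1) * y powr (p/2 - 1) * Re (cnj a * b)) = X\<^sup>2 + Y\<^sup>2 - 2 * u * (X * Y)"
      unfolding uxy using xy by (simp add: norm_rpow X_Y_def x_y_u_def(1,2)[symmetric] powr_diff)
    finally have 2: "(norm (rpow (p/2 - 1) a - rpow (p/2 - 1) b))\<^sup>2 = X\<^sup>2 + Y\<^sup>2 - 2 * u * (X * Y)" .
    have "c * (X\<^sup>2 + Y\<^sup>2 - 2 * u * (X * Y)) \<le> X\<^sup>2 + Y\<^sup>2 - u * G"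
    \<comment> \<open>For nonnegative u the upper bound on G and u <= 1 suffice; for negative u the
      lower bound on G and c <= 1.\<close>
    proof (cases "u \<ge> 0")
      case True
      have "u * G \<le> u * (2 * c * (X * Y)) + u * ((1 - c) * (X\<^sup>2 + Y\<^sup>2))"
        using mult_left_mono[OF G(2) True] by (simp add: algebra_simps)
      also have "u * ((1 - c) * (X\<^sup>2 + Y\<^sup>2)) \<le> 1 * ((1 - c) * (X\<^sup>2 + Y\<^sup>2))"
        using u c by (intro mult_right_mono) auto
      finally show ?thesis by (simp add: algebra_simps)
    next
      case False
      have "c * (X * Y) \<le> 1 * (X * Y)" using c XY by (intro mult_right_mono) auto
      then have "(-u) * (2 * (c * (X * Y))) \<le> (-u) * G" using False G(1) by (intro mult_left_mono) auto
      moreover have "c * (X\<^sup>2 + Y\<^sup>2) \<le> 1 * (X\<^sup>2 + Y\<^sup>2)" using c by (intro mult_right_mono) auto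
      ultimately show ?thesis by (simp add: algebra_simps)
    qed
    then show ?thesis unfolding 1 2 c_def[symmetric] .
  qed
qed

lemma powr_mult_between:
  fixes x y :: real
  assumes "x > 0" "y > 0" "s \<ge> 0" "t \<ge> 0"
  shows "min (x powr (s + t)) (y powr (s + t)) \<le> x powr s * y powr t"
    and "x powr s * y powr t \<le> max (x powr (s + t)) (y powr (s + t))"
proof -
  define m M where "m = min x y" "M = max x y"
  have mM: "m > 0" "M > 0" "m \<le> x" "m \<le> y" "x \<le> M" "y \<le> M" using assms by (auto simp: m_M_def)
  have "m powr s * m powr t \<le> x powr s * y powr t"
    using mM assms by (intro mult_mono powr_mono2) auto
  moreover have "min (x powr (s + t)) (y powr (s + t)) \<le> m powr (s + t)" by (auto simp: m_M_def min_def)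
  ultimately show "min (x powr (s + t)) (y powr (s + t)) \<le> x powr s * y powr t" by (simp add: powr_add)
  have "x powr s * y powr t \<le> M powr s * M powr t"
    using mM assms by (intro mult_mono powr_mono2) auto
  moreover have "M powr (s + t) \<le> max (x powr (s + t)) (y powr (s + t))" by (auto simp: m_M_def max_def)
  ultimately show "x powr s * y powr t \<le> max (x powr (s + t)) (y powr (s + t))" by (simp add: powr_add)
qed

text \<open>This turns an L^2 estimate for differences of \<open>rpow (p/2 - 1)\<close> into an L^1
  estimate for |a|^(p-1) |a - b|: both factors on the right will be square integrable.\<close>

lemma rpow_diff_bound:
  assumes "p > 1"
  shows "norm a powr (p - 1) * norm (a - b)
    \<le> 2 * (norm a powr (p/2) + norm b powr (p/2)) * norm (rpow (p/2 - 1) a - rpow (p/2 - 1) b)"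
proof (cases "a = 0")
  case False
  define x y where "x = norm a" "y = norm b"
  define X Y where "X = x powr (p/2)" "Y = y powr (p/2)"
  define d where "d = norm (rpow (p/2 - 1) a - rpow (p/2 - 1) b)"
  have x: "x > 0" using False by (auto simp: x_y_def)
  have "\<bar>norm (rpow (p/2 - 1) a) - norm (rpow (p/2 - 1) b)\<bar> \<le> d"
    unfolding d_def by (rule norm_triangle_ineq3)
  then have XYd: "\<bar>X - Y\<bar> \<le> d" by (simp add: norm_rpow X_Y_def x_y_def)
  have nn: "X \<ge> 0" "Y \<ge> 0" "d \<ge> 0" by (auto simp: X_Y_def d_def)
  \<comment> \<open>Both products have total degree p in x and y, hence lie between the two pure
    powers x^p = X^2 and y^p = Y^2.\<close>
  have "\<bar>x powr (p - 1) * y - X * Y\<bar> \<le> \<bar>X\<^sup>2 - Y\<^sup>2\<bar>"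
  proof (cases "y = 0")
    case False
    then have y: "y > 0" by (auto simp: x_y_def)
    have e: "x powr p = X\<^sup>2" "y powr p = Y\<^sup>2" using x y by (auto simp: X_Y_def powr_power)
    have "min (X\<^sup>2) (Y\<^sup>2) \<le> x powr (p - 1) * y" "x powr (p - 1) * y \<le> max (X\<^sup>2) (Y\<^sup>2)"
      using powr_mult_between[of x y "p - 1" 1] assms x y by (simp_all add: e)
    moreover have "min (X\<^sup>2) (Y\<^sup>2) \<le> X * Y" "X * Y \<le> max (X\<^sup>2) (Y\<^sup>2)"
      using powr_mult_between[of x y "p/2" "p/2"] assms x y by (simp_all add: e X_Y_def)
    ultimately show ?thesis by (auto simp: min_def max_def split: if_splits)
  qed (auto simp: X_Y_def)
  also have "\<dots> = (X + Y) * \<bar>X - Y\<bar>"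
    using nn by (simp add: abs_mult power2_eq_square square_diff_square_factored)
  also have "\<dots> \<le> (X + Y) * d" using XYd nn by (intro mult_left_mono) auto
  finally have 1: "\<bar>x powr (p - 1) * y - X * Y\<bar> \<le> (X + Y) * d" .
  \<comment> \<open>The first term on the right carries the difference of the radial powers; the
    error is a real multiple of b, of modulus |x^(p-1) y - X Y|, which has just been
    estimated.\<close>
  have "of_real (x powr (p - 1)) * (a - b)
     = of_real X * (rpow (p/2 - 1) a - rpow (p/2 - 1) b)
       - of_real (x powr (p - 1) - X * y powr (p/2 - 1)) * b"
  proof -
    have "X * x powr (p/2 - 1) = x powr (p - 1)" by (simp add: X_Y_def flip: powr_add)
    then have "of_real (x powr (p - 1)) = complex_of_real X * of_real (x powr (p/2 - 1))"
      by (metis of_real_mult)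
    then show ?thesis
      by (simp add: rpow_def x_y_def algebra_simps)
  qed
  then have "norm (of_real (x powr (p - 1)) * (a - b))
     \<le> norm (of_real X * (rpow (p/2 - 1) a - rpow (p/2 - 1) b))
       + norm (of_real (x powr (p - 1) - X * y powr (p/2 - 1)) * b)"
    by (simp only: norm_triangle_ineq4)
  also have "norm (of_real (x powr (p - 1) - X * y powr (p/2 - 1)) * b) = \<bar>x powr (p - 1) * y - X * Y\<bar>"
  proof -
    have "norm (of_real (x powr (p - 1) - X * y powr (p/2 - 1)) * b) = \<bar>(x powr (p - 1) - X * y powr (p/2 - 1)) * y\<bar>"
      by (simp only: norm_mult norm_of_real) (simp add: x_y_def abs_mult)
    also have "y powr (p/2 - 1) * y = Y"
      by (cases "y = 0") (auto simp: X_Y_def powr_diff x_y_def)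
    then have "(x powr (p - 1) - X * y powr (p/2 - 1)) * y = x powr (p - 1) * y - X * Y"
      by (simp add: algebra_simps)
    finally show ?thesis .
  qed
  also have "norm (of_real X * (rpow (p/2 - 1) a - rpow (p/2 - 1) b)) = X * d"
    using nn by (simp add: norm_mult d_def)
  also have "X * d + \<bar>x powr (p - 1) * y - X * Y\<bar> \<le> (X + Y) * d + (X + Y) * d"
    using 1 nn by (intro add_mono mult_right_mono) auto
  also have "\<dots> = 2 * (X + Y) * d" by (simp add: algebra_simps)
  finally show ?thesis
    by (simp add: norm_mult x_y_def[symmetric] X_Y_def[symmetric] d_def[symmetric])
qed simp

text \<open>The graph of the convex function |w|^p lies above its tangent at b; Young's inequality
  with exponents p and p/(p-1) proves this without differentiating.\<close>

lemma norm_powr_convex: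
  fixes a b :: complex
  assumes "p > 1"
  shows "norm b powr p + p * Re (cnj (rpow (p - 2) b) * (a - b)) \<le> norm a powr p"
proof -
  have "Re (cnj (rpow (p - 2) b) * a) \<le> norm (cnj (rpow (p - 2) b) * a)"
    by (rule complex_Re_le_cmod)
  also have "\<dots> = norm a * norm b powr (p - 1)"
    by (simp add: norm_mult norm_rpow)
  also have "\<dots> \<le> norm a powr p / p + (norm b powr (p - 1)) powr (p / (p - 1)) / (p / (p - 1))"
    using assms by (intro Youngs_inequality) (auto simp: field_simps)
  also have "(norm b powr (p - 1)) powr (p / (p - 1)) = norm b powr p"
    using assms by (simp add: powr_powr)
  finally have "p * Re (cnj (rpow (p - 2) b) * a) \<le> p * (norm a powr p / p + norm b powr p / (p / (p - 1)))"
    using assms by (intro mult_left_mono) auto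
  also have "\<dots> = norm a powr p + (p - 1) * norm b powr p"
    using assms by (simp add: field_simps)
  finally show ?thesis
    using rpow_mult_cnj[of p b] by (simp add: right_diff_distrib algebra_simps)
qed

section \<open>Bergman spaces and the variational identity\<close>

lemma cnj_measurable [measurable]:
  "f \<in> borel_measurable M \<Longrightarrow> (\<lambda>x. cnj (f x)) \<in> borel_measurable M"
  by (rule borel_measurable_continuous_on[of cnj]) (auto intro: continuous_intros)

text \<open>This measure is not normalized: the disc has mass pi, so factors 1/pi appear where sigma
  is meant. Restricting the space turns set integrals over the disc into plain integrals over a
  finite measure.\<close>

definition area :: "complex measure" where
  "area = restrict_space lborel (ball 0 1)"

lemma space_area [simp]: "space area = ball 0 1"
  by (simp add: area_def space_restrict_space)

lemma finite_area: "finite_measure area"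
  by standard (simp add: area_def emeasure_restrict_space space_restrict_space emeasure_ball)

interpretation area: finite_measure area
  by (rule finite_area)

lemma integrable_disc_iff:
  fixes f :: "complex \<Rightarrow> 'b :: {banach, second_countable_topology}"
  shows "integrable area f \<longleftrightarrow> set_integrable lborel (ball 0 1) f"
  unfolding area_def set_integrable_def by (subst integrable_restrict_space) auto

lemma integral_disc_eq:
  fixes f :: "complex \<Rightarrow> 'b :: {banach, second_countable_topology}"
  shows "(LINT z:ball 0 1|lborel. f z) = integral\<^sup>L area f"
  unfolding area_def set_lebesgue_integral_def by (subst integral_restrict_space) auto

lemma continuous_on_measurable_disc:
  fixes f :: "complex \<Rightarrow> 'b :: {banach, second_countable_topology}"
  assumes "continuous_on (ball 0 1) f"
  shows "f \<in> borel_measurable area"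
proof -
  have "f \<in> borel_measurable (restrict_space borel (ball 0 1))"
    by (rule borel_measurable_continuous_on_restrict[OF assms])
  moreover have "sets area = sets (restrict_space borel (ball 0 1 :: complex set))"
    unfolding area_def by (rule sets_restrict_space_cong) simp
  ultimately show ?thesis by (simp cong: measurable_cong_sets)
qed

lemma in_BergmanD:
  assumes "in_Bergman p f"
  shows "f holomorphic_on ball 0 1" "continuous_on (ball 0 1) f" "f \<in> borel_measurable area"
    "integrable area (\<lambda>z. norm (f z) powr p)"
  using assms unfolding in_Bergman_def integrable_disc_iff
  by (auto intro!: continuous_on_measurable_disc holomorphic_on_imp_continuous_on)

lemma in_BergmanI:
  assumes "f holomorphic_on ball 0 1" "integrable area (\<lambda>z. norm (f z) powr p)"
  shows "in_Bergman p f"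
  using assms unfolding in_Bergman_def integrable_disc_iff by auto

lemma powr_add_le:
  fixes a b p :: real
  assumes "a \<ge> 0" "b \<ge> 0" "p \<ge> 0"
  shows "(a + b) powr p \<le> 2 powr p * (a powr p + b powr p)"
proof -
  have "(a + b) powr p \<le> (2 * max a b) powr p" using assms by (intro powr_mono2) auto
  also have "\<dots> = 2 powr p * max a b powr p" using assms by (simp add: powr_mult)
  also have "max a b powr p \<le> a powr p + b powr p" by (auto simp: max_def)
  finally show ?thesis by simp
qed

text \<open>Bounding both factors by the larger of a and b is enough in place of Hoelder's
  inequality wherever only integrability matters.\<close>

lemma powr_minus_one_mult_le:
  fixes a b p :: real
  assumes "a \<ge> 0" "b \<ge> 0" "p > 1"
  shows "a powr (p - 1) * b \<le> a powr p + b powr p"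
proof (cases "a \<le> b")
  case True
  have "a powr (p - 1) * b \<le> b powr (p - 1) * b" using True assms by (intro mult_right_mono powr_mono2) auto
  also have "\<dots> = b powr p" using assms by (cases "b = 0") (auto simp: powr_diff)
  finally show ?thesis by (simp add: add_increasing)
next
  case False
  have "a powr (p - 1) * b \<le> a powr (p - 1) * a" using False assms by (intro mult_left_mono) auto
  also have "\<dots> = a powr p" using assms by (cases "a = 0") (auto simp: powr_diff)
  finally show ?thesis by (simp add: add_increasing2)
qed

lemma le_one_plus_powr:
  fixes a p :: real
  assumes "a \<ge> 0" "p \<ge> 1"
  shows "a \<le> 1 + a powr p"
proof (cases "a \<le> 1")
  case True
  then show ?thesis by (simp add: add_increasing2)
next
  case False
  have "a powr 1 \<le> a powr p" using False assms by (intro powr_mono) auto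
  then show ?thesis using False by simp
qed

lemma poly_bounded_disc:
  fixes q :: "complex poly"
  obtains C where "C > 0" "\<And>z. z \<in> cball 0 1 \<Longrightarrow> norm (poly q z) \<le> C"
proof -
  have "bounded (poly q ` cball 0 1)"
    by (intro compact_imp_bounded compact_continuous_image continuous_intros) auto
  then obtain C where "C > 0" "\<forall>x\<in>poly q ` cball 0 1. norm x \<le> C" by (auto simp: bounded_pos)
  then show ?thesis using that by auto
qed

lemma integrable_disc_bound:
  fixes f :: "complex \<Rightarrow> 'b :: {banach, second_countable_topology}"
  assumes "integrable area g" "f \<in> borel_measurable area"
    "\<And>z. z \<in> ball 0 1 \<Longrightarrow> norm (f z) \<le> g z"
  shows "integrable area f"
  by (rule Bochner_Integration.integrable_bound[OF assms(1,2)], rule AE_I2) (use assms(3) in fastforce)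

lemma in_Bergman_add:
  assumes "p \<ge> 0" "in_Bergman p f" "in_Bergman p g"
  shows "in_Bergman p (\<lambda>z. f z + g z)"
proof (rule in_BergmanI)
  note [measurable] = in_BergmanD(3)[OF assms(2)] in_BergmanD(3)[OF assms(3)]
  show "(\<lambda>z. f z + g z) holomorphic_on ball 0 1"
    using assms by (intro holomorphic_intros) (auto dest: in_BergmanD)
  show "integrable area (\<lambda>z. norm (f z + g z) powr p)"
  proof (rule integrable_disc_bound)
    show "integrable area (\<lambda>z. 2 powr p * (norm (f z) powr p + norm (g z) powr p))"
      using assms by (auto dest: in_BergmanD)
    show "norm (norm (f z + g z) powr p) \<le> 2 powr p * (norm (f z) powr p + norm (g z) powr p)" for z
    proof -
      have "norm (f z + g z) powr p \<le> (norm (f z) + norm (g z)) powr p"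
        using assms by (intro powr_mono2 norm_triangle_ineq) auto
      also have "\<dots> \<le> 2 powr p * (norm (f z) powr p + norm (g z) powr p)"
        using assms by (intro powr_add_le) auto
      finally show ?thesis by simp
    qed
  qed measurable
qed

lemma in_Bergman_poly_mult:
  assumes "p \<ge> 0" "in_Bergman p f"
  shows "in_Bergman p (\<lambda>z. poly q z * f z)"
proof (rule in_BergmanI)
  obtain C where C: "C > 0" "\<And>z. z \<in> cball 0 1 \<Longrightarrow> norm (poly q z) \<le> C"
    using poly_bounded_disc[of q] by blast
  note [measurable] = in_BergmanD(3)[OF assms(2)]
  show hol: "(\<lambda>z. poly q z * f z) holomorphic_on ball 0 1"
    using assms by (intro holomorphic_intros) (auto dest: in_BergmanD)
  have [measurable]: "(\<lambda>z. poly q z * f z) \<in> borel_measurable area"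
    by (rule continuous_on_measurable_disc[OF holomorphic_on_imp_continuous_on[OF hol]])
  show "integrable area (\<lambda>z. norm (poly q z * f z) powr p)"
  proof (rule integrable_disc_bound)
    show "integrable area (\<lambda>z. C powr p * norm (f z) powr p)"
      using assms by (auto dest: in_BergmanD)
    show "norm (norm (poly q z * f z) powr p) \<le> C powr p * norm (f z) powr p" if "z \<in> ball 0 1" for z
      using that C(2)[of z] C(1) assms by (auto simp: norm_mult powr_mult intro!: mult_right_mono powr_mono2)
  qed measurable
qed

lemma in_Bergman_cmult:
  assumes "p \<ge> 0" "in_Bergman p f"
  shows "in_Bergman p (\<lambda>z. c * f z)"
  using in_Bergman_poly_mult[OF assms, of "[:c:]"] by simp

lemma in_Bergman_poly:
  assumes "p \<ge> 0"
  shows "in_Bergman p (poly q)"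
proof -
  have "in_Bergman p (\<lambda>z. 1)"
    by (rule in_BergmanI) auto
  from in_Bergman_poly_mult[OF assms this, of q] show ?thesis by simp
qed

lemma in_Bergman_integrable:
  assumes "p \<ge> 1" "in_Bergman p f"
  shows "integrable area f"
proof (rule integrable_disc_bound)
  show "integrable area (\<lambda>z. 1 + norm (f z) powr p)"
    using assms by (auto dest: in_BergmanD)
  show "norm (f z) \<le> 1 + norm (f z) powr p" for z
    using assms by (intro le_one_plus_powr) auto
qed (use assms in \<open>auto dest: in_BergmanD\<close>)

lemma integrable_mult_cnj_poly:
  assumes "integrable area f" 
  shows "integrable area (\<lambda>z. f z * cnj (poly q z))"
proof -
  obtain C where C: "C > 0" "\<And>z. z \<in> cball 0 1 \<Longrightarrow> norm (poly q z) \<le> C"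
    using poly_bounded_disc[of q] by blast
  have [measurable]: "(\<lambda>z. poly q z) \<in> borel_measurable area"
    by (intro continuous_on_measurable_disc continuous_intros)
  have [measurable]: "f \<in> borel_measurable area" using assms by auto
  show ?thesis
  proof (rule integrable_disc_bound)
    show "integrable area (\<lambda>z. C * norm (f z))" using assms by auto
    show "norm (f z * cnj (poly q z)) \<le> C * norm (f z)" if "z \<in> ball 0 1" for z
      using that C(2)[of z] by (auto simp: norm_mult mult.commute[of C] intro!: mult_left_mono)
  qed measurable
qed

section \<open>The functional and its norm\<close>

lemma kernel_functional_eq:
  "kernel_functional k f = 1 / of_real pi * integral\<^sup>L area (\<lambda>z. f z * cnj (poly k z))"
  by (simp add: kernel_functional_def disc_integral_def integral_disc_eq)

lemma Bergman_norm_eq: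
  "Bergman_norm p f = (1 / pi * integral\<^sup>L area (\<lambda>z. norm (f z) powr p)) powr (1 / p)"
  by (simp add: Bergman_norm_def integral_disc_eq)

lemma kernel_functional_add:
  assumes "integrable area f" "integrable area g"
  shows "kernel_functional k (\<lambda>z. f z + g z) = kernel_functional k f + kernel_functional k g"
  using assms[THEN integrable_mult_cnj_poly, of k] by (simp add: kernel_functional_eq algebra_simps)

lemma kernel_functional_cmult:
  "kernel_functional k (\<lambda>z. c * f z) = c * kernel_functional k f"
  by (simp add: kernel_functional_eq mult.assoc)

lemma Bergman_norm_cmult:
  assumes "p > 0"
  shows "Bergman_norm p (\<lambda>z. c * f z) = norm c * Bergman_norm p f"
proof -
  define I where "I = 1 / pi * integral\<^sup>L area (\<lambda>z. norm (f z) powr p)"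
  have I: "I \<ge> 0" by (simp add: I_def)
  have "Bergman_norm p (\<lambda>z. c * f z) = (norm c powr p * I) powr (1 / p)"
    by (simp add: Bergman_norm_eq norm_mult powr_mult I_def mult_ac)
  also have "\<dots> = norm c * I powr (1 / p)"
    using I assms by (simp add: powr_mult powr_powr)
  finally show ?thesis by (simp add: Bergman_norm_eq I_def)
qed

lemma Bergman_norm_1D:
  assumes "p > 0" "Bergman_norm p f = 1"
  shows "integral\<^sup>L area (\<lambda>z. norm (f z) powr p) = pi"
proof -
  define I where "I = 1 / pi * integral\<^sup>L area (\<lambda>z. norm (f z) powr p)"
  have I: "I \<ge> 0" by (simp add: I_def)
  have "I powr (1 / p) = 1" using assms by (simp add: Bergman_norm_eq I_def)
  then have "(I powr (1 / p)) powr p = 1" by simp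
  then have "I = 1" using I assms by (simp add: powr_powr)
  then show ?thesis by (simp add: I_def field_simps)
qed

lemma AE_disc_poly_nonzero:
  assumes "q \<noteq> 0"
  shows "AE z in area. poly q z \<noteq> 0"
proof -
  have "finite {z. poly q z = 0}" using assms by (rule poly_roots_finite)
  then have "{z. poly q z = 0} \<in> null_sets lborel" by (rule finite_imp_null_set_lborel)
  then have "AE z in lborel. poly q z \<noteq> 0" by (auto dest: AE_not_in)
  then show ?thesis unfolding area_def by (subst AE_restrict_space_iff) auto
qed

lemma Bergman_norm_zero_imp:
  assumes "p > 0" "in_Bergman p f" "Bergman_norm p f = 0"
  shows "AE z in area. f z = 0"
proof -
  have "integral\<^sup>L area (\<lambda>z. norm (f z) powr p) = 0"
    using assms by (simp add: Bergman_norm_eq)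
  then have "AE z in area. norm (f z) powr p = 0"
    using in_BergmanD(4)[OF assms(2)] by (subst (asm) integral_nonneg_eq_0_iff_AE) auto
  then show ?thesis by simp
qed

text \<open>The supremum in \<open>functional_norm\<close> is a real one and has its meaning only
  for a bounded set. Since the disc has finite area, the crude estimate |g| <= 1 + |g|^p
  suffices.\<close>

lemma kernel_functional_bounded:
  assumes "p > 1"
  shows "bdd_above ((\<lambda>g. norm (kernel_functional k g)) ` {g. in_Bergman p g \<and> Bergman_norm p g = 1})"
proof -
  obtain C where C: "C > 0" "\<And>z. z \<in> cball 0 1 \<Longrightarrow> norm (poly k z) \<le> C"
    using poly_bounded_disc[of k] by blast
  show ?thesis
  proof (rule bdd_aboveI2)
    fix g assume "g \<in> {g. in_Bergman p g \<and> Bergman_norm p g = 1}"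
    then have g: "in_Bergman p g" "Bergman_norm p g = 1" by auto
    have J: "integral\<^sup>L area (\<lambda>z. norm (g z) powr p) = pi"
      using g(2) assms by (intro Bergman_norm_1D) auto
    have "norm (integral\<^sup>L area (\<lambda>z. g z * cnj (poly k z))) \<le> (LINT z|area. C * (1 + norm (g z) powr p))"
    proof (rule Bochner_Integration.integral_norm_bound_integral)
      show "integrable area (\<lambda>z. g z * cnj (poly k z))"
        using g assms by (intro integrable_mult_cnj_poly in_Bergman_integrable) auto
      show "integrable area (\<lambda>z. C * (1 + norm (g z) powr p))"
        using in_BergmanD(4)[OF g(1)] by auto
      fix z assume "z \<in> space area"
      then have "norm (g z * cnj (poly k z)) \<le> norm (g z) * C"
        using C(2)[of z] by (auto simp: norm_mult intro!: mult_left_mono)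
      also have "norm (g z) \<le> 1 + norm (g z) powr p"
        using assms by (intro le_one_plus_powr) auto
      finally show "norm (g z * cnj (poly k z)) \<le> C * (1 + norm (g z) powr p)"
        using C by (simp add: mult.commute)
    qed
    also have "\<dots> = C * (measure area (ball 0 1) + pi)"
      using in_BergmanD(4)[OF g(1)] J by simp
    finally show "norm (kernel_functional k g) \<le> 1 / pi * (C * (measure area (ball 0 1) + pi))"
      by (simp add: kernel_functional_eq norm_mult norm_divide field_simps)
  qed
qed

text \<open>Scaling reduces to norm 1. If the norm is 0, then g vanishes almost everywhere and so
  does its image.\<close>

lemma kernel_functional_le:
  assumes "p > 1" "in_Bergman p g"
  shows "norm (kernel_functional k g) \<le> functional_norm p k * Bergman_norm p g"
proof (cases "Bergman_norm p g = 0")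
  case True
  have "AE z in area. g z = 0" using Bergman_norm_zero_imp[of p g] assms True by auto
  then have "AE z in area. g z * cnj (poly k z) = 0" by auto
  then have "kernel_functional k g = 0"
    by (simp add: kernel_functional_eq integral_eq_zero_AE)
  then show ?thesis using True by simp
next
  case False
  define n where "n = Bergman_norm p g"
  have n: "n > 0" using False by (simp add: n_def Bergman_norm_eq order_less_le)
  define g' where "g' = (\<lambda>z. of_real (1 / n) * g z)"
  have "in_Bergman p g'" unfolding g'_def using assms by (intro in_Bergman_cmult) auto
  moreover have "Bergman_norm p g' = 1"
    unfolding g'_def using n assms by (subst Bergman_norm_cmult) (auto simp: n_def[symmetric] norm_divide)
  ultimately have "norm (kernel_functional k g') \<le> functional_norm p k"
    unfolding functional_norm_def using kernel_functional_bounded[OF assms(1)]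
    by (intro cSUP_upper) auto
  also have "norm (kernel_functional k g') = norm (kernel_functional k g) / n"
    unfolding g'_def kernel_functional_cmult using n by (simp add: norm_mult norm_divide)
  finally show ?thesis using n by (simp add: n_def[symmetric] field_simps)
qed

text \<open>The test function is k itself: the functional maps it to its squared L^2 norm, which is
  nonzero because a nonzero polynomial has finitely many roots.\<close>

lemma functional_norm_pos:
  assumes "p > 1" "k \<noteq> 0"
  shows "functional_norm p k > 0"
proof -
  have B: "in_Bergman p (poly k)" "in_Bergman 2 (poly k)" using assms by (auto intro: in_Bergman_poly)
  have eq: "poly k z * cnj (poly k z) = of_real (norm (poly k z) powr 2)" for z
    by (subst complex_norm_square[symmetric]) simp
  have "kernel_functional k (poly k) \<noteq> 0"
  proof
    assume "kernel_functional k (poly k) = 0"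
    then have "integral\<^sup>L area (\<lambda>z. norm (poly k z) powr 2) = 0"
      by (simp only: kernel_functional_eq eq integral_complex_of_real) simp
    then have "Bergman_norm 2 (poly k) = 0" by (simp add: Bergman_norm_eq)
    from Bergman_norm_zero_imp[OF _ B(2) this] have "AE z in area. poly k z = 0" by simp
    with AE_disc_poly_nonzero[OF assms(2)] have "AE z in area. False"
      by eventually_elim auto
    then have "emeasure area (ball 0 1) = 0"
      using sets.top[of area] by (subst (asm) AE_iff_measurable) auto
    then show False
      by (auto simp: area_def emeasure_restrict_space emeasure_ball unit_ball_vol_2)
  qed
  then have "0 < norm (kernel_functional k (poly k))" by simp
  also have "\<dots> \<le> functional_norm p k * Bergman_norm p (poly k)"
    by (rule kernel_functional_le) (use assms B in auto)
  finally show ?thesis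
    by (auto simp: zero_less_mult_iff Bergman_norm_eq)
qed

section \<open>The variational identity\<close>

lemma integrable_rpow_mult:
  assumes "p > 1" "in_Bergman p f" "in_Bergman p g"
  shows "integrable area (\<lambda>z. cnj (rpow (p - 2) (f z)) * g z)"
proof -
  note [measurable] = in_BergmanD(3)[OF assms(2)] in_BergmanD(3)[OF assms(3)]
  show ?thesis
  proof (rule integrable_disc_bound)
    show "integrable area (\<lambda>z. norm (f z) powr p + norm (g z) powr p)"
      using assms by (auto dest: in_BergmanD)
    show "norm (cnj (rpow (p - 2) (f z)) * g z) \<le> norm (f z) powr p + norm (g z) powr p" for z
      using powr_minus_one_mult_le[of "norm (f z)" "norm (g z)" p] assms(1) by (simp add: norm_mult norm_rpow)
  qed measurable
qed

text \<open>For u_t = F + t g the norm inequality bounds the integral of |u_t|^p below by pi (1 + t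
  R/N)^p, while convexity bounds it above by pi plus p t times the pairing at u_t. Dividing by p t
  and letting t decrease to 0 gives the claim.\<close>

lemma extremal_variational_le:
  assumes p: "p > 1" and k: "k \<noteq> 0" and F: "is_extremal p k F" and g: "in_Bergman p g"
  shows "Re (kernel_functional k g) / functional_norm p k
    \<le> 1 / pi * (LINT z|area. Re (cnj (rpow (p - 2) (F z)) * g z))"
proof -
  define N where "N = functional_norm p k"
  have N: "N > 0" unfolding N_def using functional_norm_pos[OF p k] .
  define R where "R = Re (kernel_functional k g)"
  have FB: "in_Bergman p F" and F1: "Bergman_norm p F = 1" and Fe: "Re (kernel_functional k F) = N"
    using F by (auto simp: is_extremal_def N_def)
  note [measurable] = in_BergmanD(3)[OF FB] in_BergmanD(3)[OF g]
  have IF: "1 / pi * integral\<^sup>L area (\<lambda>z. norm (F z) powr p) = 1"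
    using Bergman_norm_1D[OF _ F1] p by simp
  define u where "u = (\<lambda>t z. F z + of_real t * g z)"
  have uB: "in_Bergman p (u t)" for t
    unfolding u_def using p FB g by (intro in_Bergman_add in_Bergman_cmult) auto
  have [measurable]: "u t \<in> borel_measurable area" for t using in_BergmanD(3)[OF uB] .
  define S where "S = (\<lambda>t. LINT z|area. Re (cnj (rpow (p - 2) (u t z)) * g z))"
  have Sint: "integrable area (\<lambda>z. Re (cnj (rpow (p - 2) (u t z)) * g z))" for t
    using integrable_rpow_mult[OF p uB g] by (rule integrable_Re)
  \<comment> \<open>Positivity of 1 + t R/N permits raising the norm inequality to the power p; R
    may be negative, so this holds only for small t.\<close>
  have main: "R / N \<le> 1 / pi * S t" if t: "t > 0" "1 + t * R / N > 0" for t
  proof -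
    define s where "s = 1 + t * R / N"
    define I where "I = 1 / pi * integral\<^sup>L area (\<lambda>z. norm (u t z) powr p)"
    have "N * s = Re (kernel_functional k (u t))"
      unfolding u_def using N in_Bergman_integrable[OF _ FB] in_Bergman_integrable[OF _ g] p
      by (subst kernel_functional_add)
         (auto simp: kernel_functional_cmult Fe R_def s_def field_simps)
    also have "\<dots> \<le> norm (kernel_functional k (u t))" by (rule complex_Re_le_cmod)
    also have "\<dots> \<le> N * I powr (1 / p)"
      using kernel_functional_le[OF p uB] by (simp add: N_def Bergman_norm_eq I_def)
    finally have "s \<le> I powr (1 / p)" using N by simp
    then have "s powr p \<le> (I powr (1 / p)) powr p" using that p by (intro powr_mono2) (auto simp: s_def)
    also have "\<dots> = I" using p by (simp add: powr_powr I_def)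
    finally have 1: "s powr p \<le> I" .
    \<comment> \<open>Bernoulli's inequality, read off from the tangent inequality at b = 1.\<close>
    have 2: "1 + p * (s - 1) \<le> s powr p"
    proof -
      have "s > 0" using that by (simp add: s_def)
      then show ?thesis
        using norm_powr_convex[OF p, of 1 "of_real s"] by (simp add: rpow_def)
    qed
    \<comment> \<open>The tangent is taken at u_t and evaluated at F; a tangent at F would bound the
      integral of |u_t|^p from the wrong side. This is why continuity of the pairing in t is needed
      afterwards.\<close>
    have "1 / pi * (LINT z|area. norm (u t z) powr p - p * t * Re (cnj (rpow (p - 2) (u t z)) * g z))
      \<le> 1 / pi * (LINT z|area. norm (F z) powr p)"
    proof (intro mult_left_mono integral_mono)
      fix z
      have "Re (cnj (rpow (p - 2) (u t z)) * (F z - u t z)) = - t * Re (cnj (rpow (p - 2) (u t z)) * g z)"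
        by (simp add: u_def algebra_simps)
      then show "norm (u t z) powr p - p * t * Re (cnj (rpow (p - 2) (u t z)) * g z) \<le> norm (F z) powr p"
        using norm_powr_convex[OF p, of "u t z" "F z"] by simp
    qed (use in_BergmanD(4)[OF uB] in_BergmanD(4)[OF FB] Sint in auto)
    also have "\<dots> = 1" by (rule IF)
    also have "(LINT z|area. norm (u t z) powr p - p * t * Re (cnj (rpow (p - 2) (u t z)) * g z))
       = (LINT z|area. norm (u t z) powr p) - p * t * S t"
      using in_BergmanD(4)[OF uB] Sint by (simp add: S_def del: Re_complex_div_gt_0)
    finally have "I - p * t * (1 / pi * S t) \<le> 1" by (simp add: I_def field_simps)
    with 1 2 have "p * t * (R / N) \<le> p * t * (1 / pi * S t)" by (simp add: s_def)
    then show ?thesis using p t by (subst (asm) mult_le_cancel_left_pos) auto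
  qed
  have lim: "(\<lambda>n. S (1 / real (Suc n))) \<longlonglongrightarrow> (LINT z|area. Re (cnj (rpow (p - 2) (F z)) * g z))"
    unfolding S_def
  proof (rule integral_dominated_convergence)
    show "integrable area (\<lambda>z. 2 powr p * (norm (F z) powr p + norm (g z) powr p))"
      using in_BergmanD(4)[OF g] in_BergmanD(4)[OF FB] by auto
    show "AE z in area. (\<lambda>n. Re (cnj (rpow (p - 2) (u (1 / real (Suc n)) z)) * g z))
        \<longlonglongrightarrow> Re (cnj (rpow (p - 2) (F z)) * g z)"
    proof (rule AE_I2)
      fix z
      have 0: "(\<lambda>n. 1 / real (Suc n)) \<longlonglongrightarrow> 0" using LIMSEQ_inverse_real_of_nat by (simp add: inverse_eq_divide)
      have "(\<lambda>n. F z + of_real (1 / real (Suc n)) * g z) \<longlonglongrightarrow> F z + of_real 0 * g z"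
        by (intro tendsto_intros 0)
      then have "(\<lambda>n. rpow (p - 2) (u (1 / real (Suc n)) z)) \<longlonglongrightarrow> rpow (p - 2) (F z)"
        using p by (intro isCont_tendsto_compose[OF continuous_rpow]) (auto simp: u_def)
      then show "(\<lambda>n. Re (cnj (rpow (p - 2) (u (1 / real (Suc n)) z)) * g z))
        \<longlonglongrightarrow> Re (cnj (rpow (p - 2) (F z)) * g z)"
        by (intro tendsto_intros)
    qed
    show "AE z in area. norm (Re (cnj (rpow (p - 2) (u (1 / real (Suc n)) z)) * g z))
       \<le> 2 powr p * (norm (F z) powr p + norm (g z) powr p)" for n
    proof (rule AE_I2)
      fix z
      let ?t = "1 / real (Suc n)"
      have "norm (Re (cnj (rpow (p - 2) (u ?t z)) * g z)) \<le> norm (cnj (rpow (p - 2) (u ?t z)) * g z)"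
        unfolding real_norm_def by (rule abs_Re_le_cmod)
      also have "\<dots> = norm (u ?t z) powr (p - 1) * norm (g z)"
        by (simp add: norm_mult norm_rpow)
      also have "\<dots> \<le> (norm (F z) + norm (g z)) powr (p - 1) * (norm (F z) + norm (g z))"
      proof (intro mult_mono powr_mono2)
        have "norm (u ?t z) \<le> norm (F z) + norm (of_real ?t * g z)" unfolding u_def by (rule norm_triangle_ineq)
        also have "norm (of_real ?t * g z) \<le> 1 * norm (g z)"
          unfolding norm_mult norm_of_real by (intro mult_right_mono) auto
        finally show "norm (u ?t z) \<le> norm (F z) + norm (g z)" by simp
      qed (use p in auto)
      also have "\<dots> = (norm (F z) + norm (g z)) powr p"
        by (cases "norm (F z) + norm (g z) = 0") (auto simp: powr_diff)
      also have "\<dots> \<le> 2 powr p * (norm (F z) powr p + norm (g z) powr p)"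
        using p by (intro powr_add_le) auto
      finally show "norm (Re (cnj (rpow (p - 2) (u ?t z)) * g z)) \<le> 2 powr p * (norm (F z) powr p + norm (g z) powr p)" .
    qed
  qed measurable
  have "eventually (\<lambda>n. 1 + 1 / real (Suc n) * R / N > 0) sequentially"
  proof -
    have "(\<lambda>n. 1 + inverse (real (Suc n)) * R / N) \<longlonglongrightarrow> 1 + 0 * R / N"
      using N by (intro tendsto_intros LIMSEQ_inverse_real_of_nat) auto
    then show ?thesis
      by (auto dest!: order_tendstoD(1)[where a = 0] simp: inverse_eq_divide)
  qed
  then have "eventually (\<lambda>n. R / N \<le> 1 / pi * S (1 / real (Suc n))) sequentially"
    by eventually_elim (rule main, auto)
  moreover have "(\<lambda>n. 1 / pi * S (1 / real (Suc n))) \<longlonglongrightarrow> 1 / pi * (LINT z|area. Re (cnj (rpow (p - 2) (F z)) * g z))"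
    by (intro tendsto_intros lim)
  ultimately show ?thesis unfolding R_def N_def
    by (intro tendsto_lowerbound[where F = sequentially]) auto
qed

text \<open>Both sides are complex linear in g: applying the inequality to -g gives equality of real
  parts, and then i g gives the imaginary parts.\<close>

lemma extremal_variational:
  assumes p: "p > 1" and k: "k \<noteq> 0" and F: "is_extremal p k F" and g: "in_Bergman p g"
  shows "1 / of_real pi * (LINT z|area. cnj (rpow (p - 2) (F z)) * g z)
     = kernel_functional k g / of_real (functional_norm p k)"
proof -
  define N where "N = functional_norm p k"
  define L where "L = (\<lambda>g. 1 / of_real pi * (LINT z|area. cnj (rpow (p - 2) (F z)) * g z))"
  have FB: "in_Bergman p F" using F by (auto simp: is_extremal_def)
  have ReL: "Re (L g) = 1 / pi * (LINT z|area. Re (cnj (rpow (p - 2) (F z)) * g z))"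
    if "in_Bergman p g" for g
  proof -
    have "Re (LINT z|area. cnj (rpow (p - 2) (F z)) * g z)
        = (LINT z|area. Re (cnj (rpow (p - 2) (F z)) * g z))"
      by (rule integral_Re[symmetric]) (use integrable_rpow_mult[OF p FB that] in auto)
    then show ?thesis unfolding L_def by (simp add: Re_divide_of_real)
  qed
  have Lc: "L (\<lambda>z. c * g z) = c * L g" for c g
    by (simp add: L_def mult.left_commute[of _ c])
  have le: "Re (kernel_functional k g) / N \<le> Re (L g)" if "in_Bergman p g" for g
    using extremal_variational_le[OF p k F that] by (simp add: ReL[OF that] N_def)
  have eq: "Re (kernel_functional k g) / N = Re (L g)" if "in_Bergman p g" for g
  proof (rule antisym)
    have "in_Bergman p (\<lambda>z. (-1) * g z)" using p that by (intro in_Bergman_cmult) auto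
    from le[OF this] show "Re (L g) \<le> Re (kernel_functional k g) / N"
      unfolding kernel_functional_cmult Lc by simp
  qed (rule le[OF that])
  have "in_Bergman p (\<lambda>z. \<i> * g z)" using p g by (intro in_Bergman_cmult) auto
  from eq[OF this] have "Im (kernel_functional k g) / N = Im (L g)"
    unfolding kernel_functional_cmult Lc by simp
  with eq[OF g] have "L g = kernel_functional k g / of_real N"
    by (simp add: complex_eq_iff)
  then show ?thesis by (simp add: L_def N_def)
qed

section \<open>Rotation differences of the extremal function\<close>

lemma integral_disc_rotate:
  fixes f :: "complex \<Rightarrow> 'b :: {banach, second_countable_topology}"
  assumes "integrable area f"
  shows "integrable area (\<lambda>z. f (cis t * z))"
    and "(LINT z|area. f (cis t * z)) = integral\<^sup>L area f"
proof -
  have r: "z \<in> ball 0 1 \<longleftrightarrow> cis t * z \<in> ball 0 1" for z by (simp add: norm_mult)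
  note * = set_integral_rotate[of "ball 0 1" t f, OF r, folded integrable_disc_iff, OF assms]
  show "integrable area (\<lambda>z. f (cis t * z))" using *(1) .
  show "(LINT z|area. f (cis t * z)) = integral\<^sup>L area f"
    using *(2) by (simp add: integral_disc_eq)
qed

lemma in_Bergman_rotate:
  assumes "in_Bergman p f"
  shows "in_Bergman p (\<lambda>z. f (cis t * z))"
proof (rule in_BergmanI)
  have "f \<circ> (\<lambda>z. cis t * z) holomorphic_on ball 0 1"
    by (rule holomorphic_on_compose_gen[OF _ in_BergmanD(1)[OF assms]])
       (auto intro!: holomorphic_intros simp: norm_mult)
  then show "(\<lambda>z. f (cis t * z)) holomorphic_on ball 0 1" by (simp add: o_def)
  show "integrable area (\<lambda>z. norm (f (cis t * z)) powr p)"
    by (rule integral_disc_rotate(1)[OF in_BergmanD(4)[OF assms]])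
qed

definition moment :: "nat \<Rightarrow> (complex \<Rightarrow> complex) \<Rightarrow> complex" where
  "moment j f = (LINT z|area. f z * cnj (z ^ j))"

lemma integrable_mult_cnj_power:
  assumes "integrable area f"
  shows "integrable area (\<lambda>z. f z * cnj (z ^ j))"
  using integrable_mult_cnj_poly[OF assms, of "monom 1 j"] by (simp add: poly_monom)

text \<open>Substituting the inverse rotation moves the phase onto the conjugated power.
  Consequently the functional, a finite combination of moments, is a trigonometric polynomial along
  rotations.\<close>

lemma moment_rotate:
  assumes "integrable area f"
  shows "moment j (\<lambda>z. f (cis t * z)) = cis (real j * t) * moment j f"
proof -
  define g where "g = (\<lambda>z. cis t ^ j * (f z * cnj (z ^ j)))"
  have g: "integrable area g"
    unfolding g_def by (intro integrable_mult_right integrable_mult_cnj_power assms)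
  have "cis t ^ j * cnj (cis t) ^ j = 1"
    by (simp add: cis_cnj cis_mult flip: power_mult_distrib)
  then have "f (cis t * z) * cnj (z ^ j) = (cis t ^ j * cnj (cis t) ^ j) * (f (cis t * z) * cnj (z ^ j))" for z
    by simp
  then have "f (cis t * z) * cnj (z ^ j) = g (cis t * z)" for z
    by (simp add: g_def power_mult_distrib mult_ac)
  then have "moment j (\<lambda>z. f (cis t * z)) = (LINT z|area. g (cis t * z))"
    by (simp add: moment_def)
  also have "\<dots> = integral\<^sup>L area g" by (rule integral_disc_rotate(2)[OF g])
  also have "\<dots> = cis (real j * t) * moment j f" unfolding g_def moment_def Complex.DeMoivre[symmetric] by simp
  finally show ?thesis .
qed

lemma kernel_functional_moments:
  assumes "integrable area f"
  shows "kernel_functional k f = 1 / of_real pi * (\<Sum>j\<le>degree k. cnj (coeff k j) * moment j f)"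
proof -
  have "f z * cnj (poly k z) = (\<Sum>j\<le>degree k. cnj (coeff k j) * (f z * cnj (z ^ j)))" for z
    by (simp add: poly_altdef sum_distrib_left mult_ac)
  then have "kernel_functional k f
    = 1 / of_real pi * (LINT z|area. (\<Sum>j\<le>degree k. cnj (coeff k j) * (f z * cnj (z ^ j))))"
    by (simp add: kernel_functional_eq)
  also have "(LINT z|area. (\<Sum>j\<le>degree k. cnj (coeff k j) * (f z * cnj (z ^ j))))
     = (\<Sum>j\<le>degree k. cnj (coeff k j) * moment j f)"
    unfolding moment_def
    by (subst Bochner_Integration.integral_sum)
       (use integrable_mult_cnj_power[OF assms] in \<open>auto simp del: complex_cnj_power\<close>)
  finally show ?thesis .
qed

text \<open>F' is bounded on a smaller closed disc and |e^(it) - 1| = 2 |sin(t/2)| <= |t|. This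
  supplies the dominating function away from the circle.\<close>

lemma norm_diff_le_deriv_rotate:
  assumes "f holomorphic_on ball 0 1" "\<rho> < 1"
  obtains B where "B \<ge> 0" "\<And>z t. norm z \<le> \<rho> \<Longrightarrow> norm (f (cis t * z) - f z) \<le> B * \<bar>t\<bar>"
proof -
  have sub: "cball 0 \<rho> \<subseteq> ball (0::complex) 1" using assms(2) by auto
  have cont: "continuous_on (ball 0 1) (deriv f)"
    using assms(1) by (intro holomorphic_on_imp_continuous_on holomorphic_deriv) auto
  then have "bounded (deriv f ` cball 0 \<rho>)"
    by (intro compact_imp_bounded compact_continuous_image continuous_on_subset[OF cont sub] compact_cball)
  then obtain B where B: "B > 0" "\<And>w. w \<in> cball 0 \<rho> \<Longrightarrow> norm (deriv f w) \<le> B"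
    unfolding bounded_pos by auto
  show ?thesis
  proof (rule that)
    show "B \<ge> 0" using B by simp
    fix z :: complex and t :: real assume z: "norm z \<le> \<rho>"
    have "norm (f (cis t * z) - f z) \<le> B * norm (cis t * z - z)"
    proof (rule field_differentiable_bound[of "cball 0 \<rho>" f "deriv f"])
      fix w :: complex assume "w \<in> cball 0 \<rho>"
      then show "(f has_field_derivative deriv f w) (at w within cball 0 \<rho>)"
        using assms(1) sub
        by (intro has_field_derivative_at_within[OF holomorphic_derivI[of _ "ball 0 1"]]) auto
    qed (use B z in \<open>auto simp: norm_mult\<close>)
    also have "cis t * z - z = (cis t - 1) * z" by (simp add: algebra_simps)
    also have "norm ((cis t - 1) * z) \<le> \<bar>t\<bar> * 1"
      unfolding norm_mult
    proof (rule mult_mono)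
      have "norm (cis t - 1) = 2 * \<bar>sin (t / 2)\<bar>"
        using dist_exp_i_1[of t] by (simp add: cis_conv_exp)
      also have "\<bar>sin (t / 2)\<bar> \<le> \<bar>t / 2\<bar>" by (rule abs_sin_x_le_abs_x)
      finally show "norm (cis t - 1) \<le> \<bar>t\<bar>" by simp
    qed (use z assms(2) in auto)
    finally show "norm (f (cis t * z) - f z) \<le> B * \<bar>t\<bar>" using B by simp
  qed
qed

lemma rotate_quotient_tendsto:
  assumes "f holomorphic_on ball 0 1" "z \<in> ball 0 1" "t \<longlonglongrightarrow> 0" "\<And>n. t n \<noteq> 0"
  shows "(\<lambda>n. (f (cis (t n) * z) - f z) / of_real (t n)) \<longlonglongrightarrow> \<i> * z * deriv f z"
proof -
  have d: "(f has_field_derivative deriv f z) (at (exp (\<i> * 0) * z))"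
    using holomorphic_derivI[OF assms(1) _ assms(2), of UNIV] by simp
  have "((\<lambda>s. exp (\<i> * s) * z) has_field_derivative \<i> * z) (at 0)"
    by (auto intro!: derivative_eq_intros)
  from DERIV_chain2[OF d this]
  have "((\<lambda>s. f (exp (\<i> * s) * z)) has_field_derivative deriv f z * (\<i> * z)) (at 0)" .
  then have "((\<lambda>h. (f (exp (\<i> * (0 + h)) * z) - f (exp (\<i> * 0) * z)) / h) \<longlongrightarrow> deriv f z * (\<i> * z)) (at 0)"
    by (rule DERIV_D)
  then have "((\<lambda>h. (f (exp (\<i> * h) * z) - f z) / h) \<longlongrightarrow> \<i> * z * deriv f z) (at 0)"
    by (simp add: mult_ac)
  moreover have "filterlim (\<lambda>n. complex_of_real (t n)) (at 0) sequentially"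
    using assms(3,4) tendsto_of_real[OF assms(3), where 'a = complex] by (simp add: filterlim_at)
  ultimately show ?thesis
    unfolding cis_conv_exp by (rule filterlim_compose)
qed

locale bergman_extremal =
  fixes p :: real and k :: "complex poly" and F :: "complex \<Rightarrow> complex"
  assumes p: "1 < p" and k: "k \<noteq> 0" and F: "is_extremal p k F"
begin

definition N where "N = functional_norm p k"

lemma N_pos: "N > 0" unfolding N_def by (rule functional_norm_pos[OF p k])

lemma F_Bergman: "in_Bergman p F"
  using F by (auto simp: is_extremal_def)

lemmas F_hol = in_BergmanD(1)[OF F_Bergman]
lemmas F_cont = in_BergmanD(2)[OF F_Bergman]
lemmas F_meas [measurable] = in_BergmanD(3)[OF F_Bergman]
lemmas F_powr_int = in_BergmanD(4)[OF F_Bergman]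

lemma F_int: "integrable area F"
  using in_Bergman_integrable[OF _ F_Bergman] p by simp

lemma F_powr_integral: "(LINT z|area. norm (F z) powr p) = pi"
  using F p by (intro Bergman_norm_1D) (auto simp: is_extremal_def)

lemma variational:
  assumes "in_Bergman p g"
  shows "(LINT z|area. cnj (rpow (p - 2) (F z)) * g z)
     = of_real (pi / N) * kernel_functional k g"
  using extremal_variational[OF p k F assms] N_pos by (simp add: N_def field_simps)

lemma kernel_functional_F: "kernel_functional k F = of_real N"
proof -
  have "of_real (pi / N) * kernel_functional k F = (LINT z|area. of_real (norm (F z) powr p))"
    using variational[OF F_Bergman] by (simp only: rpow_mult_cnj)
  also have "\<dots> = of_real pi" by (simp only: integral_complex_of_real F_powr_integral)
  finally show ?thesis using N_pos by (simp add: field_simps)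
qed

abbreviation Frot where "Frot t \<equiv> (\<lambda>z. F (cis t * z))"

lemmas Frot_Bergman = in_Bergman_rotate[OF F_Bergman]
lemmas Frot_meas [measurable] = in_BergmanD(3)[OF Frot_Bergman]
lemmas Frot_powr_int = in_BergmanD(4)[OF Frot_Bergman]

text \<open>The factors are the inverse of the monotonicity constant, pi/N from the variational
  identity, and a sum that bounds the second difference of the trigonometric polynomial through 2 (1
  - cos(jt)) <= (jt)^2.\<close>

definition rot_const where
  "rot_const = 1 / min (2 / p) (2 - 2 / p) * (pi / N)
     * (\<Sum>j\<le>degree k. norm (cnj (coeff k j) * moment j F / of_real pi) * (real j)\<^sup>2)"

lemma rot_const_nonneg: "rot_const \<ge> 0"
  unfolding rot_const_def using N_pos p
  by (intro mult_nonneg_nonneg sum_nonneg) (auto simp: field_simps)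

text \<open>Strong monotonicity bounds the integral by the real part of the pairing of A(F_t) - A(F)
  with F_t - F, where A is the conjugated duality map. Expanding that pairing leaves only values of
  the functional at F, F_t and F_(-t).\<close>

lemma
  shows rotation_difference_integrable:
    "integrable area (\<lambda>z. (norm (rpow (p/2 - 1) (Frot t z) - rpow (p/2 - 1) (F z)))\<^sup>2)"
    and rotation_difference_le:
    "(LINT z|area. (norm (rpow (p/2 - 1) (Frot t z) - rpow (p/2 - 1) (F z)))\<^sup>2) \<le> rot_const * t\<^sup>2"
proof -
  define c where "c = min (2 / p) (2 - 2 / p)"
  have c: "c > 0" using p by (auto simp: c_def field_simps)
  define X where "X = rpow (p/2 - 1)"
  define A where "A = (\<lambda>w. cnj (rpow (p - 2) w))"
  have [measurable]: "(\<lambda>z. X (f z)) \<in> borel_measurable area" if "f \<in> borel_measurable area" for f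
    using that unfolding X_def by measurable
  define a where "a = (\<lambda>j. cnj (coeff k j) * moment j F / of_real pi)"
  have phi_rot: "kernel_functional k (Frot t) = (\<Sum>j\<le>degree k. a j * cis (real j * t))" for t
    unfolding kernel_functional_moments[OF integral_disc_rotate(1)[OF F_int]] moment_rotate[OF F_int] a_def
    by (simp add: sum_distrib_left mult_ac)
  have X2: "(norm (X w))\<^sup>2 = norm w powr p" for w
    by (cases "w = 0") (auto simp: X_def norm_rpow powr_power)
  have int: "integrable area (\<lambda>z. (norm (X (Frot t z) - X (F z)))\<^sup>2)" for t
  proof (rule integrable_disc_bound)
    show "integrable area (\<lambda>z. 2 * (norm (Frot t z) powr p + norm (F z) powr p))"
      using Frot_powr_int F_powr_int by auto
    fix z
    have "(norm (X (Frot t z) - X (F z)))\<^sup>2 \<le> (norm (X (Frot t z)) + norm (X (F z)))\<^sup>2"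
      by (intro power_mono norm_triangle_ineq4) auto
    also have "\<dots> \<le> 2 * ((norm (X (Frot t z)))\<^sup>2 + (norm (X (F z)))\<^sup>2)"
      using sum_squares_bound[of "norm (X (Frot t z))" "norm (X (F z))"] by (simp add: power2_sum)
    finally show "norm ((norm (X (Frot t z) - X (F z)))\<^sup>2) \<le> 2 * (norm (Frot t z) powr p + norm (F z) powr p)"
      by (simp add: X2)
  qed measurable
  have main: "(LINT z|area. (norm (X (Frot t z) - X (F z)))\<^sup>2) \<le> (1 / c * (pi / N) * (\<Sum>j\<le>degree k. norm (a j) * (real j)\<^sup>2)) * t\<^sup>2" for t
  proof -
    have i1: "integrable area (\<lambda>z. A (F z) * g z)" if "in_Bergman p g" for g
      unfolding A_def using integrable_rpow_mult[OF p F_Bergman that] .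
    have i2: "integrable area (\<lambda>z. A (Frot t z) * g z)" if "in_Bergman p g" for g
      unfolding A_def using integrable_rpow_mult[OF p Frot_Bergman that] .
    note ints = i1[OF F_Bergman] i1[OF Frot_Bergman] i2[OF F_Bergman] i2[OF Frot_Bergman]
    have e: "(A (Frot t z) - A (F z)) * (Frot t z - F z)
      = A (Frot t z) * Frot t z - A (Frot t z) * F z - A (F z) * Frot t z + A (F z) * F z" for z
      by (simp add: algebra_simps)
    have int2: "integrable area (\<lambda>z. (A (Frot t z) - A (F z)) * (Frot t z - F z))"
      unfolding e using ints by auto
    have e1: "(LINT z|area. A (F z) * F z) = of_real pi"
      unfolding A_def variational[OF F_Bergman] kernel_functional_F using N_pos by simp
    have e2: "(LINT z|area. A (Frot t z) * Frot t z) = of_real pi"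
      using integral_disc_rotate(2)[OF i1[OF F_Bergman], of t] e1 by simp
    have e3: "(LINT z|area. A (F z) * Frot t z) = of_real (pi / N) * kernel_functional k (Frot t)"
      unfolding A_def by (rule variational[OF Frot_Bergman])
    \<comment> \<open>The variational identity needs the duality map at F itself, so the whole
      integrand is rotated back; the rotation then falls on the test function with the opposite
      sign.\<close>
    have "(LINT z|area. A (Frot t z) * F z) = (LINT z|area. A (F z) * Frot (-t) z)"
    proof -
      have r: "cis (-t) * (cis t * z) = z" for z by (simp add: mult.assoc[symmetric] cis_mult)
      then show ?thesis
        using integral_disc_rotate(2)[OF i1[OF Frot_Bergman[of "-t"]], of t] by (simp only: r)
    qed
    also have "\<dots> = of_real (pi / N) * kernel_functional k (Frot (-t))"
      unfolding A_def by (rule variational[OF Frot_Bergman])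
    finally have e4: "(LINT z|area. A (Frot t z) * F z) = of_real (pi / N) * kernel_functional k (Frot (-t))" .
    have "(LINT z|area. (A (Frot t z) - A (F z)) * (Frot t z - F z))
       = of_real pi - of_real (pi / N) * kernel_functional k (Frot (-t))
          - of_real (pi / N) * kernel_functional k (Frot t) + of_real pi"
      unfolding e using ints by (simp add: e1 e2 e3 e4)
    \<comment> \<open>The diagonal terms are written through the functional at F, which equals N, so
      that all four terms combine to a second difference.\<close>
    also have "of_real pi = of_real (pi / N) * (\<Sum>j\<le>degree k. a j)"
    proof -
      have "(\<Sum>j\<le>degree k. a j) = of_real N" using kernel_functional_F phi_rot[of 0] by simp
      then show ?thesis using N_pos by (simp only:) simp
    qed
    also have "of_real (pi / N) * (\<Sum>j\<le>degree k. a j) - of_real (pi / N) * kernel_functional k (Frot (-t))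
          - of_real (pi / N) * kernel_functional k (Frot t) + of_real (pi / N) * (\<Sum>j\<le>degree k. a j)
      = of_real (pi / N) * (\<Sum>j\<le>degree k. a j * of_real (2 * (1 - cos (real j * t))))"
    proof -
      have "a j - a j * cis (real j * (-t)) - a j * cis (real j * t) + a j = a j * of_real (2 * (1 - cos (real j * t)))" for j
        by (simp add: complex_eq_iff algebra_simps)
      then have *: "(\<Sum>j\<le>degree k. a j * of_real (2 * (1 - cos (real j * t)))) = 
        (\<Sum>j\<le>degree k. a j - a j * cis (real j * (-t)) - a j * cis (real j * t) + a j)" by simp
      show ?thesis unfolding * phi_rot by (simp only: sum.distrib sum_subtractf algebra_simps)
    qed
    finally have eq: "(LINT z|area. (A (Frot t z) - A (F z)) * (Frot t z - F z))
      = of_real (pi / N) * (\<Sum>j\<le>degree k. a j * of_real (2 * (1 - cos (real j * t))))" .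
    have "c * (LINT z|area. (norm (X (Frot t z) - X (F z)))\<^sup>2)
      = (LINT z|area. c * (norm (X (Frot t z) - X (F z)))\<^sup>2)" by simp
    also have "\<dots> \<le> (LINT z|area. Re ((A (Frot t z) - A (F z)) * (Frot t z - F z)))"
    proof (rule integral_mono)
      show "c * (norm (X (Frot t z) - X (F z)))\<^sup>2 \<le> Re ((A (Frot t z) - A (F z)) * (Frot t z - F z))" for z
        unfolding X_def A_def c_def by (rule rpow_monotone[OF p])
      show "integrable area (\<lambda>z. Re ((A (Frot t z) - A (F z)) * (Frot t z - F z)))"
        by (rule integrable_Re[OF int2])
    qed (use int in auto)
    also have "\<dots> = Re (LINT z|area. (A (Frot t z) - A (F z)) * (Frot t z - F z))"
      by (rule integral_Re[OF int2])
    also have "\<dots> \<le> norm (LINT z|area. (A (Frot t z) - A (F z)) * (Frot t z - F z))"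
      by (rule complex_Re_le_cmod)
    also have "\<dots> = pi / N * norm (\<Sum>j\<le>degree k. a j * of_real (2 * (1 - cos (real j * t))))"
      unfolding eq norm_mult norm_of_real using N_pos by simp
    also have "\<dots> \<le> pi / N * (\<Sum>j\<le>degree k. norm (a j) * (real j * t)\<^sup>2)"
    proof (intro mult_left_mono sum_norm_le)
      fix j
      have "1 - cos x \<le> x\<^sup>2 / 2" for x :: real
      proof -
        have "cos x = 1 - 2 * (sin (x/2))\<^sup>2" using cos_double_sin[of "x/2"] by simp
        moreover have "(sin (x/2))\<^sup>2 \<le> (x/2)\<^sup>2" using abs_sin_x_le_abs_x[of "x/2"] by (simp only: abs_le_square_iff)
        ultimately show ?thesis by (simp add: power_divide)
      qed
      from this[of "real j * t"] show "norm (a j * of_real (2 * (1 - cos (real j * t)))) \<le> norm (a j) * (real j * t)\<^sup>2"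
        unfolding norm_mult norm_of_real by (intro mult_left_mono) (auto simp: abs_of_nonneg)
    qed (use N_pos in auto)
    also have "\<dots> = pi / N * (\<Sum>j\<le>degree k. norm (a j) * (real j)\<^sup>2) * t\<^sup>2"
      by (simp add: sum_distrib_left power_mult_distrib mult_ac)
    finally show ?thesis using c N_pos by (simp add: field_simps)
  qed
  show "integrable area (\<lambda>z. (norm (rpow (p/2 - 1) (Frot t z) - rpow (p/2 - 1) (F z)))\<^sup>2)"
    using int[of t] by (simp add: X_def)
  show "(LINT z|area. (norm (rpow (p/2 - 1) (Frot t z) - rpow (p/2 - 1) (F z)))\<^sup>2) \<le> rot_const * t\<^sup>2"
    using main[of t] by (simp only: X_def rot_const_def c_def a_def)
qed

end

section \<open>Rotation quotients and their limit\<close>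

lemma ident_disc_meas [measurable]: "(\<lambda>z. z) \<in> borel_measurable area"
  by (rule continuous_on_measurable_disc) (rule continuous_on_id)

lemma inverse_Suc_tendsto_0: "(\<lambda>n. 1 / real (Suc n)) \<longlonglongrightarrow> 0"
  using LIMSEQ_inverse_real_of_nat by (simp add: inverse_eq_divide)

lemma disc_tail_tendsto_0:
  fixes g :: "complex \<Rightarrow> real"
  assumes g: "integrable area g"
  shows "(\<lambda>m. LINT z|area. indicator {z. 1 - 1 / real (Suc m) < norm z} z * g z) \<longlonglongrightarrow> 0"
proof -
  have [measurable]: "g \<in> borel_measurable area" using g by auto
  have [measurable]: "{z. 1 - 1 / real (Suc m) < norm z} \<inter> ball 0 1 \<in> sets area" for m
  proof -
    have "{z \<in> space area. 1 - 1 / real (Suc m) < norm z} \<in> sets area" by measurable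
    also have "{z \<in> space area. 1 - 1 / real (Suc m) < norm z} = {z. 1 - 1 / real (Suc m) < norm z} \<inter> ball 0 1" by auto
    finally show ?thesis .
  qed
  have "(\<lambda>m. LINT z|area. indicator ({z. 1 - 1 / real (Suc m) < norm z} \<inter> ball 0 1) z * g z) \<longlonglongrightarrow> (LINT z|area. 0)"
  proof (rule integral_dominated_convergence[where w = "\<lambda>z. norm (g z)"])
    show "AE z in area. (\<lambda>m. indicator ({z. 1 - 1 / real (Suc m) < norm z} \<inter> ball 0 1) z * g z) \<longlonglongrightarrow> 0"
    proof (rule AE_I2)
      fix z assume "z \<in> space area"
      then have "0 < 1 - norm z" by simp
      then have "\<forall>\<^sub>F m in sequentially. 1 / real (Suc m) < 1 - norm z"
        by (rule order_tendstoD(2)[OF inverse_Suc_tendsto_0])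
      then have "\<forall>\<^sub>F m in sequentially. indicator ({z. 1 - 1 / real (Suc m) < norm z} \<inter> ball 0 1) z * g z = 0"
        by eventually_elim (auto simp: indicator_def)
      then show "(\<lambda>m. indicator ({z. 1 - 1 / real (Suc m) < norm z} \<inter> ball 0 1) z * g z) \<longlonglongrightarrow> 0"
        by (rule tendsto_eventually)
    qed
  qed (use g in \<open>auto simp: indicator_def\<close>)
  moreover have "(LINT z|area. indicator ({z. 1 - 1 / real (Suc m) < norm z} \<inter> ball 0 1) z * g z)
     = (LINT z|area. indicator {z. 1 - 1 / real (Suc m) < norm z} z * g z)" for m
    by (rule Bochner_Integration.integral_cong) (auto simp: indicator_def)
  ultimately show ?thesis by simp
qed

context bergman_extremal
begin

text \<open>The power of |F| is taken at the unrotated point, matching the pairing of the fixed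
  duality map at F with difference quotients of F.\<close>

definition rot_quot :: "real \<Rightarrow> complex \<Rightarrow> real" where
  "rot_quot t z = norm (F z) powr (p - 1) * norm (Frot t z - F z) / \<bar>t\<bar>"

lemma rot_quot_nonneg: "rot_quot t z \<ge> 0"
  by (simp add: rot_quot_def)

lemma rot_quot_meas [measurable]: "rot_quot t \<in> borel_measurable area"
  unfolding rot_quot_def by measurable

lemma rot_quot_integrable: "integrable area (rot_quot t)"
proof (rule integrable_disc_bound)
  show "integrable area (\<lambda>z. 1 / \<bar>t\<bar> * (2 * norm (F z) powr p + norm (Frot t z) powr p))"
    using Frot_powr_int F_powr_int by auto
  fix z
  have "norm (F z) powr (p - 1) * norm (Frot t z - F z) \<le> norm (F z) powr (p - 1) * (norm (F z) + norm (Frot t z))"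
    using norm_triangle_ineq4[of "Frot t z" "F z"] by (intro mult_left_mono) auto
  also have "\<dots> = norm (F z) powr p + norm (F z) powr (p - 1) * norm (Frot t z)"
    by (cases "F z = 0") (auto simp: algebra_simps powr_diff)
  also have "\<dots> \<le> 2 * norm (F z) powr p + norm (Frot t z) powr p"
    using powr_minus_one_mult_le[of "norm (F z)" "norm (Frot t z)" p] p by simp
  finally show "norm (rot_quot t z) \<le> 1 / \<bar>t\<bar> * (2 * norm (F z) powr p + norm (Frot t z) powr p)"
    using rot_quot_nonneg[of t z] by (simp add: rot_quot_def divide_right_mono)
qed measurable

text \<open>Uniform in t, with a free parameter e: the second summand is small for small e, and the
  first then becomes small on a thin annulus E. Rotation invariance of E makes F and F_t contribute
  the same mass, hence 4/e from 2/e.\<close>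

lemma rot_quot_integral_bound:
  assumes t: "t \<noteq> 0" and e: "e > 0" and E [measurable]: "E \<in> sets area"
    and rot: "\<And>s z. cis s * z \<in> E \<longleftrightarrow> z \<in> E"
  shows "(LINT z|area. indicator E z * rot_quot t z)
       \<le> 4 / e * (LINT z|area. indicator E z * norm (F z) powr p) + e * rot_const"
proof -
    define d where "d = (\<lambda>z. norm (rpow (p/2 - 1) (Frot t z) - rpow (p/2 - 1) (F z)))"
    have ineq: "rot_quot t z \<le> 2 / e * (norm (F z) powr p + norm (Frot t z) powr p) + e / t\<^sup>2 * (d z)\<^sup>2" for z
    proof -
      define x y where "x = norm (F z) powr (p/2)" "y = norm (Frot t z) powr (p/2)"
      have xy: "x\<^sup>2 = norm (F z) powr p" "y\<^sup>2 = norm (Frot t z) powr p"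
        by (cases "F z = 0"; cases "Frot t z = 0"; auto simp: x_y_def powr_power)+
      have d': "norm (rpow (p/2 - 1) (F z) - rpow (p/2 - 1) (Frot t z)) = d z"
        by (simp add: d_def norm_minus_commute)
      have "norm (F z) powr (p - 1) * norm (Frot t z - F z) \<le> 2 * (x + y) * d z"
        using rpow_diff_bound[OF p, of "F z" "Frot t z"]
        unfolding d' by (simp add: x_y_def norm_minus_commute)
      then have "rot_quot t z \<le> 2 * (x + y) * (d z / \<bar>t\<bar>)"
        by (simp add: rot_quot_def divide_right_mono)
      \<comment> \<open>Cauchy-Schwarz in the weighted form 2ab <= a^2/e + e b^2, so that only the
        part without d has to be localized to E.\<close>
      also have "\<dots> \<le> (x + y)\<^sup>2 / e + e * (d z / \<bar>t\<bar>)\<^sup>2"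
        using sum_squares_bound[of "(x + y) / sqrt e" "sqrt e * (d z / \<bar>t\<bar>)"] e
        by (simp add: power_divide power_mult_distrib)
      also have "(x + y)\<^sup>2 / e \<le> (2 * (x\<^sup>2 + y\<^sup>2)) / e"
        using sum_squares_bound[of x y] e by (intro divide_right_mono) (auto simp: power2_sum)
      finally show ?thesis by (simp add: xy power_divide)
    qed
    have i1: "integrable area (\<lambda>z. indicator E z * norm (Frot s z) powr p)" for s
      using integrable_mult_indicator[OF E Frot_powr_int[of s]] by simp
    have i0: "integrable area (\<lambda>z. indicator E z * norm (F z) powr p)"
      using i1[of 0] by simp
    have i2: "integrable area (\<lambda>z. indicator E z * rot_quot t z)"
      using integrable_mult_indicator[OF E rot_quot_integrable[of t]] by simp
    have i3: "integrable area (\<lambda>z. (d z)\<^sup>2)" unfolding d_def by (rule rotation_difference_integrable)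
    have "(LINT z|area. indicator E z * rot_quot t z)
      \<le> (LINT z|area. 2 / e * (indicator E z * norm (F z) powr p + indicator E z * norm (Frot t z) powr p) + e / t\<^sup>2 * (d z)\<^sup>2)"
    proof (rule integral_mono)
      show "indicator E z * rot_quot t z \<le> 2 / e * (indicator E z * norm (F z) powr p + indicator E z * norm (Frot t z) powr p) + e / t\<^sup>2 * (d z)\<^sup>2" for z
        using ineq[of z] e by (auto simp: indicator_def)
    qed (use i0 i1 i2 i3 in auto)
    also have "\<dots> = 2 / e * ((LINT z|area. indicator E z * norm (F z) powr p) + (LINT z|area. indicator E z * norm (Frot t z) powr p))
        + e / t\<^sup>2 * (LINT z|area. (d z)\<^sup>2)"
      using i0 i1 i3 by simp
    also have "(LINT z|area. indicator E z * norm (Frot t z) powr p) = (LINT z|area. indicator E z * norm (F z) powr p)"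
    proof -
      have "indicator E (cis t * z) = (indicator E z :: real)" for z
        using rot[of t z] by (simp add: indicator_def)
      then show ?thesis using integral_disc_rotate(2)[OF i0, of t] by simp
    qed
    also have "e / t\<^sup>2 * (LINT z|area. (d z)\<^sup>2) \<le> e / t\<^sup>2 * (rot_const * t\<^sup>2)"
      using e rotation_difference_le[of t] by (intro mult_left_mono) (auto simp: d_def)
    also have "e / t\<^sup>2 * (rot_const * t\<^sup>2) = e * rot_const" using t by simp
    finally show "(LINT z|area. indicator E z * rot_quot t z)
       \<le> 4 / e * (LINT z|area. indicator E z * norm (F z) powr p) + e * rot_const"
      by simp
qed

text \<open>The pointwise limit of the rotation quotients; the factor z arises because the
  derivative is taken in the angle.\<close>

definition weight :: "complex \<Rightarrow> real" where
  "weight z = norm (F z) powr (p - 1) * norm (z * deriv F z)"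

lemma weight_nonneg: "weight z \<ge> 0" by (simp add: weight_def)

lemma rot_quot_tendsto:
  assumes "z \<in> ball 0 1" "t \<longlonglongrightarrow> 0" "\<And>n. t n \<noteq> 0"
  shows "(\<lambda>n. rot_quot (t n) z) \<longlonglongrightarrow> weight z"
proof -
  have "(\<lambda>n. norm (F z) powr (p - 1) * norm ((Frot (t n) z - F z) / of_real (t n)))
     \<longlonglongrightarrow> norm (F z) powr (p - 1) * norm (\<i> * z * deriv F z)"
    by (intro tendsto_intros rotate_quotient_tendsto F_hol assms)
  then show ?thesis by (simp add: rot_quot_def weight_def norm_divide norm_mult)
qed

lemma deriv_F_cont: "continuous_on (ball 0 1) (deriv F)"
  by (intro holomorphic_on_imp_continuous_on holomorphic_deriv F_hol) auto

lemma deriv_F_meas [measurable]: "deriv F \<in> borel_measurable area"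
  by (rule continuous_on_measurable_disc[OF deriv_F_cont])

lemma weight_meas [measurable]: "weight \<in> borel_measurable area"
  unfolding weight_def[abs_def] by measurable

text \<open>Fatou's lemma for rotation quotients with t = 1/(n+1); the uniform bound is
  \<open>rot_quot_integral_bound\<close> for the whole disc and e = 1.\<close>

lemma weight_int: "integrable area weight"
proof (rule integrableI_bounded)
  define t where "t = (\<lambda>n. 1 / real (Suc n))"
  have t: "t \<longlonglongrightarrow> 0" "\<And>n. t n \<noteq> 0" using inverse_Suc_tendsto_0 by (auto simp: t_def)
  have bound: "(LINT z|area. rot_quot (t n) z) \<le> 4 * pi + rot_const" for n
  proof -
    have "(LINT z|area. indicator (ball 0 1) z * rot_quot (t n) z)
       \<le> 4 / 1 * (LINT z|area. indicator (ball 0 1) z * norm (F z) powr p) + 1 * rot_const"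
      using sets.top[of area] t(2) by (intro rot_quot_integral_bound) (auto simp: norm_mult)
    moreover have "(LINT z|area. indicator (ball 0 1) z * rot_quot (t n) z) = (LINT z|area. rot_quot (t n) z)"
      by (rule Bochner_Integration.integral_cong) auto
    moreover have "(LINT z|area. indicator (ball 0 1) z * norm (F z) powr p) = (LINT z|area. norm (F z) powr p)"
      by (rule Bochner_Integration.integral_cong) auto
    ultimately show ?thesis by (simp add: F_powr_integral)
  qed
  have "(\<integral>\<^sup>+z. ennreal (norm (weight z)) \<partial>area)
     = (\<integral>\<^sup>+z. liminf (\<lambda>n. ennreal (rot_quot (t n) z)) \<partial>area)"
  proof (rule nn_integral_cong)
    fix z assume "z \<in> space area"
    then have "(\<lambda>n. rot_quot (t n) z) \<longlonglongrightarrow> weight z"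
      using t by (intro rot_quot_tendsto) auto
    then have "(\<lambda>n. ennreal (rot_quot (t n) z)) \<longlonglongrightarrow> ennreal (weight z)"
      by (rule tendsto_ennrealI)
    then show "ennreal (norm (weight z)) = liminf (\<lambda>n. ennreal (rot_quot (t n) z))"
      by (simp add: lim_imp_Liminf weight_nonneg)
  qed
  also have "\<dots> \<le> liminf (\<lambda>n. \<integral>\<^sup>+z. ennreal (rot_quot (t n) z) \<partial>area)"
    by (rule nn_integral_liminf) measurable
  also have "\<dots> \<le> ennreal (4 * pi + rot_const)"
  proof (rule Liminf_le)
    show "\<forall>\<^sub>F n in sequentially. (\<integral>\<^sup>+z. ennreal (rot_quot (t n) z) \<partial>area) \<le> ennreal (4 * pi + rot_const)"
      using bound rot_quot_nonneg rot_quot_integrable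
      by (intro always_eventually allI) (subst nn_integral_eq_integral, auto intro!: ennreal_leI)
  qed auto
  also have "\<dots> < \<infinity>" by simp
  finally show "(\<integral>\<^sup>+z. ennreal (norm (weight z)) \<partial>area) < \<infinity>" .
qed measurable

text \<open>The variational identity is only available for test functions in \<open>A\<^sup>p\<close>, to which \<open>z F'\<close> need not belong;
  it is reached as a limit of rotation quotients, the uniform integrability of which near the circle
  comes from \<open>rot_quot_integral_bound\<close>.\<close>

lemma rotation_quotient_limit:
  fixes q :: "complex poly"
  defines "G \<equiv> (\<lambda>z. cnj (rpow (p - 2) (F z)) * poly q z)"
  defines "t \<equiv> (\<lambda>n. 1 / real (Suc n))"
  shows "(\<lambda>n. LINT z|area. G z * ((Frot (t n) z - F z) / of_real (t n)))
     \<longlonglongrightarrow> (LINT z|area. G z * (\<i> * z * deriv F z))"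
proof -
  obtain H where H: "H > 0" "\<And>z. z \<in> cball 0 1 \<Longrightarrow> norm (poly q z) \<le> H"
    using poly_bounded_disc[of q] by blast
  have t: "t \<longlonglongrightarrow> 0" "\<And>n. t n \<noteq> 0" "\<And>n. \<bar>t n\<bar> = t n" using inverse_Suc_tendsto_0 by (auto simp: t_def)
  have [measurable]: "(\<lambda>z. poly q z) \<in> borel_measurable area"
    by (intro continuous_on_measurable_disc continuous_intros)
  have [measurable]: "G \<in> borel_measurable area" unfolding G_def by measurable
  define f where "f = (\<lambda>n z. G z * ((Frot (t n) z - F z) / of_real (t n)))"
  define g where "g = (\<lambda>z. G z * (\<i> * z * deriv F z))"
  have [measurable]: "f n \<in> borel_measurable area" "g \<in> borel_measurable area" for n
    unfolding f_def g_def by measurable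
  have Gle: "norm (G z) \<le> H * norm (F z) powr (p - 1)" if "z \<in> ball 0 1" for z
    using H(2)[of z] that by (auto simp: G_def norm_mult norm_rpow mult.commute[of H] intro!: mult_left_mono)
  have fle: "norm (f n z) \<le> H * rot_quot (t n) z" if "z \<in> ball 0 1" for n z
  proof -
    have "norm (f n z) = norm (G z) * (norm (Frot (t n) z - F z) / \<bar>t n\<bar>)"
      by (simp add: f_def norm_mult norm_divide)
    also have "\<dots> \<le> (H * norm (F z) powr (p - 1)) * (norm (Frot (t n) z - F z) / \<bar>t n\<bar>)"
      by (intro mult_right_mono Gle that) auto
    finally show ?thesis by (simp add: rot_quot_def)
  qed
  have gle: "norm (g z) \<le> H * weight z" if "z \<in> ball 0 1" for z
  proof -
    have "norm (g z) = norm (G z) * norm (z * deriv F z)"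
      by (simp add: g_def norm_mult)
    also have "\<dots> \<le> (H * norm (F z) powr (p - 1)) * norm (z * deriv F z)"
      by (intro mult_right_mono Gle that) auto
    finally show ?thesis by (simp add: weight_def)
  qed
  have fint: "integrable area (f n)" for n
    by (rule integrable_disc_bound[of "\<lambda>z. H * rot_quot (t n) z"]) (use rot_quot_integrable fle in auto)
  have gint: "integrable area g"
    by (rule integrable_disc_bound[of "\<lambda>z. H * weight z"]) (use weight_int gle in auto)
  define E where "E = (\<lambda>m. {z \<in> ball 0 1. 1 - 1 / real (Suc m) < norm (z :: complex)})"
  have Em [measurable]: "E m \<in> sets area" for m
  proof -
    have "{z \<in> space area. 1 - 1 / real (Suc m) < norm z} \<in> sets area" by measurable
    then show ?thesis by (simp add: E_def)
  qed
  have Eind: "(LINT z|area. indicator {z. 1 - 1 / real (Suc m) < norm z} z * h z)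
     = (LINT z|area. indicator (E m) z * h z)" for m and h :: "complex \<Rightarrow> real"
    by (rule Bochner_Integration.integral_cong) (auto simp: indicator_def E_def)
  have "(\<lambda>n. integral\<^sup>L area (f n)) \<longlonglongrightarrow> integral\<^sup>L area g"
    unfolding tendsto_iff
  proof (intro allI impI)
    fix \<epsilon> :: real assume \<epsilon>: "\<epsilon> > 0"
    \<comment> \<open>Chosen so that H e \<open>rot_const\<close> is at most a quarter of
      \<epsilon>; the summand 1 covers \<open>rot_const\<close> = 0.\<close>
    define e where "e = \<epsilon> / (4 * H * (rot_const + 1))"
    have e: "e > 0" using \<epsilon> H rot_const_nonneg by (auto simp: e_def)
    have "H * (e * rot_const) = \<epsilon> / 4 * (rot_const / (rot_const + 1))"
      using H rot_const_nonneg by (simp add: e_def)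
    also have "\<dots> \<le> \<epsilon> / 4 * 1" using \<epsilon> rot_const_nonneg by (intro mult_left_mono) auto
    finally have HeC: "H * (e * rot_const) \<le> \<epsilon> / 4" by simp
    \<comment> \<open>The annulus is fixed only after e, since e occurs in a denominator here; it
      serves all n simultaneously.\<close>
    define tail where "tail = (\<lambda>m. H * (4 / e * (LINT z|area. indicator (E m) z * norm (F z) powr p)) + H * (LINT z|area. indicator (E m) z * weight z))"
    have "tail
       \<longlonglongrightarrow> H * (4 / e * 0) + H * 0"
      using disc_tail_tendsto_0[OF F_powr_int] disc_tail_tendsto_0[OF weight_int]
      unfolding Eind tail_def by (intro tendsto_intros)
    then have "\<forall>\<^sub>F m in sequentially. tail m < \<epsilon> / 4"
      using \<epsilon> by (auto dest!: order_tendstoD(2)[where a = "\<epsilon> / 4"])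
    then obtain m where m: "tail m < \<epsilon> / 4"
      by (auto simp: eventually_sequentially)
    define h where "h = (\<lambda>n z. indicator (- E m) z *\<^sub>R (f n z - g z))"
    have hn: "(\<lambda>n. integral\<^sup>L area (h n)) \<longlonglongrightarrow> (LINT z|area. 0)"
    proof -
      \<comment> \<open>Off the annulus the quotients of F are bounded by B uniformly in n, so
        dominated convergence applies there.\<close>
      obtain B where B: "B \<ge> 0" "\<And>z t. norm z \<le> 1 - 1 / real (Suc m) \<Longrightarrow> norm (F (cis t * z) - F z) \<le> B * \<bar>t\<bar>"
        using norm_diff_le_deriv_rotate[OF F_hol, of "1 - 1 / real (Suc m)"] by auto
      have [measurable]: "h n \<in> borel_measurable area" for n
      proof -
        have "(\<lambda>z. (1 - indicator (E m) z) *\<^sub>R (f n z - g z)) \<in> borel_measurable area" by measurable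
        also have "(\<lambda>z. (1 - indicator (E m) z) *\<^sub>R (f n z - g z)) = h n"
          by (auto simp: h_def indicator_def)
        finally show ?thesis .
      qed
      show ?thesis
      proof (rule integral_dominated_convergence[where w = "\<lambda>z. H * B * (1 + norm (F z) powr p) + H * weight z"])
        show "integrable area (\<lambda>z. H * B * (1 + norm (F z) powr p) + H * weight z)"
          using F_powr_int weight_int by auto
        show "AE z in area. (\<lambda>n. h n z) \<longlonglongrightarrow> 0"
        proof (rule AE_I2)
          fix z assume "z \<in> space area"
          then have "(\<lambda>n. G z * ((Frot (t n) z - F z) / of_real (t n))) \<longlonglongrightarrow> G z * (\<i> * z * deriv F z)"
            using t by (intro tendsto_intros rotate_quotient_tendsto F_hol) auto
          then have "(\<lambda>n. f n z) \<longlonglongrightarrow> g z" by (simp add: f_def g_def)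
          then have "(\<lambda>n. indicator (- E m) z *\<^sub>R (f n z - g z)) \<longlonglongrightarrow> indicator (- E m) z *\<^sub>R (g z - g z)"
            by (intro tendsto_intros)
          then show "(\<lambda>n. h n z) \<longlonglongrightarrow> 0" by (simp add: h_def)
        qed
        show "AE z in area. norm (h n z) \<le> H * B * (1 + norm (F z) powr p) + H * weight z" for n
        proof (rule AE_I2)
          fix z assume z: "z \<in> space area"
          have rhs: "0 \<le> H * B * (1 + norm (F z) powr p) + H * weight z"
            using H B weight_nonneg[of z] by auto
          show "norm (h n z) \<le> H * B * (1 + norm (F z) powr p) + H * weight z"
          proof (cases "z \<in> E m")
            case True
            then show ?thesis using rhs by (simp add: h_def)
          next
            case False
            then have "norm z \<le> 1 - 1 / real (Suc m)" using z by (auto simp: E_def)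
            from B(2)[OF this, of "t n"] have "norm (Frot (t n) z - F z) / \<bar>t n\<bar> \<le> B"
              using t(2)[of n] by (simp add: field_simps)
            then have "rot_quot (t n) z \<le> norm (F z) powr (p - 1) * B"
              using mult_left_mono[of "norm (Frot (t n) z - F z) / \<bar>t n\<bar>" B "norm (F z) powr (p - 1)"]
              by (simp add: rot_quot_def)
            also have "\<dots> \<le> (1 + norm (F z) powr p) * B"
              using powr_minus_one_mult_le[of "norm (F z)" 1 p] p B by (intro mult_right_mono) auto
            finally have "H * rot_quot (t n) z \<le> H * ((1 + norm (F z) powr p) * B)"
              using H by (intro mult_left_mono) auto
            moreover have "norm (f n z - g z) \<le> H * rot_quot (t n) z + H * weight z"
              using fle[of z n] gle[of z] z norm_triangle_ineq4[of "f n z" "g z"] by simp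
            ultimately show ?thesis using False by (simp add: h_def mult_ac)
          qed
        qed
      qed auto
    qed
    have "\<forall>\<^sub>F n in sequentially. norm (integral\<^sup>L area (h n)) < \<epsilon> / 4"
      using hn[THEN tendsto_norm] \<epsilon> by (auto dest!: order_tendstoD(2)[where a = "\<epsilon> / 4"])
    then show "\<forall>\<^sub>F n in sequentially. dist (integral\<^sup>L area (f n)) (integral\<^sup>L area g) < \<epsilon>"
    proof eventually_elim
      case (elim n)
      have iE: "integrable area (\<lambda>z. indicator (E m) z *\<^sub>R (f n z - g z))"
        using integrable_mult_indicator[OF Em, of "\<lambda>z. f n z - g z" m] fint gint by auto
      have ih: "integrable area (h n)"
      proof -
        have "integrable area (\<lambda>z. (f n z - g z) - indicator (E m) z *\<^sub>R (f n z - g z))"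
          using iE fint gint by auto
        moreover have "(\<lambda>z. (f n z - g z) - indicator (E m) z *\<^sub>R (f n z - g z)) = h n"
          by (auto simp: h_def indicator_def)
        ultimately show ?thesis by simp
      qed
      have ir: "integrable area (\<lambda>z. indicator (E m) z * rot_quot (t n) z)"
           "integrable area (\<lambda>z. indicator (E m) z * weight z)"
        using integrable_mult_indicator[OF Em rot_quot_integrable[of "t n"], of m] integrable_mult_indicator[OF Em weight_int, of m] by auto
      have "integral\<^sup>L area (f n) - integral\<^sup>L area g = (LINT z|area. f n z - g z)"
        using fint gint by simp
      also have "\<dots> = (LINT z|area. h n z + indicator (E m) z *\<^sub>R (f n z - g z))"
        by (rule Bochner_Integration.integral_cong) (auto simp: h_def indicator_def)
      also have "\<dots> = integral\<^sup>L area (h n) + (LINT z|area. indicator (E m) z *\<^sub>R (f n z - g z))"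
        using iE ih by simp
      finally have "dist (integral\<^sup>L area (f n)) (integral\<^sup>L area g)
        \<le> norm (integral\<^sup>L area (h n)) + norm (LINT z|area. indicator (E m) z *\<^sub>R (f n z - g z))"
        by (simp add: dist_norm norm_triangle_ineq)
      also have "norm (LINT z|area. indicator (E m) z *\<^sub>R (f n z - g z))
        \<le> (LINT z|area. H * (indicator (E m) z * rot_quot (t n) z) + H * (indicator (E m) z * weight z))"
      proof (rule Bochner_Integration.integral_norm_bound_integral[OF iE])
        fix z assume z: "z \<in> space area"
        have "norm (f n z - g z) \<le> H * rot_quot (t n) z + H * weight z"
          using fle[of z n] gle[of z] z norm_triangle_ineq4[of "f n z" "g z"] by simp
        then show "norm (indicator (E m) z *\<^sub>R (f n z - g z)) \<le> H * (indicator (E m) z * rot_quot (t n) z) + H * (indicator (E m) z * weight z)"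
          by (auto simp: indicator_def)
      qed (use ir in auto)
      also have "\<dots> = H * (LINT z|area. indicator (E m) z * rot_quot (t n) z) + H * (LINT z|area. indicator (E m) z * weight z)"
        using ir by simp
      also have "H * (LINT z|area. indicator (E m) z * rot_quot (t n) z)
         \<le> H * (4 / e * (LINT z|area. indicator (E m) z * norm (F z) powr p) + e * rot_const)"
        using H e t(2) by (intro mult_left_mono rot_quot_integral_bound Em) (auto simp: E_def norm_mult)
      finally show ?case using m HeC elim \<epsilon> by (simp add: tail_def distrib_left)
    qed
  qed
  then show ?thesis by (simp add: f_def g_def)
qed

end

section \<open>Radial limits and the Hardy space\<close>

text \<open>The Cauchy form does not mention the limit. It therefore serves both to prove existence
  from tail estimates and to write the set of convergence by countable operations.\<close>

lemma ex_limit_at_left_iff_Cauchy: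
  fixes f :: "real \<Rightarrow> 'a::banach"
  shows "(\<exists>l. (f \<longlongrightarrow> l) (at_left b)) \<longleftrightarrow>
    (\<forall>e>0. \<exists>a<b. \<forall>r\<in>{a<..<b}. \<forall>s\<in>{a<..<b}. dist (f r) (f s) < e)" (is "_ = ?R")
proof
  assume "\<exists>l. (f \<longlongrightarrow> l) (at_left b)"
  then obtain l where l: "(f \<longlongrightarrow> l) (at_left b)" ..
  show ?R
  proof (intro allI impI)
    fix e :: real assume "e > 0"
    then have "\<forall>\<^sub>F r in at_left b. dist (f r) l < e / 2" by (intro tendstoD[OF l]) auto
    then obtain a where a: "a < b" "\<And>r. a < r \<Longrightarrow> r < b \<Longrightarrow> dist (f r) l < e / 2"
      unfolding eventually_at_left_field by blast
    have "dist (f r) (f s) < e" if "r \<in> {a<..<b}" "s \<in> {a<..<b}" for r s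
      by (rule dist_triangle_half_l[OF a(2) a(2)]) (use that in auto)
    with a(1) show "\<exists>a<b. \<forall>r\<in>{a<..<b}. \<forall>s\<in>{a<..<b}. dist (f r) (f s) < e" by blast
  qed
next
  assume R: ?R
  have "cauchy_filter (filtermap f (at_left b))"
    unfolding cauchy_filter_metric_filtermap
  proof (intro allI impI)
    fix e :: real assume "e > 0"
    then obtain a where a: "a < b" "\<forall>r\<in>{a<..<b}. \<forall>s\<in>{a<..<b}. dist (f r) (f s) < e" using R by blast
    have "\<forall>\<^sub>F r in at_left b. r \<in> {a<..<b}" using a by (intro eventually_at_leftI[of a]) auto
    with a show "\<exists>P. eventually P (at_left b) \<and> (\<forall>x y. P x \<and> P y \<longrightarrow> dist (f x) (f y) < e)" by blast
  qed
  then have "\<exists>l. filtermap f (at_left b) \<le> nhds l"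
    by (intro cauchy_filter_complete_converges[of _ UNIV] complete_UNIV) (auto simp: filtermap_bot_iff)
  then show "\<exists>l. (f \<longlongrightarrow> l) (at_left b)" by (simp add: filterlim_def)
qed

text \<open>The tails of an integrable function tend to 0 by dominated convergence, so a function
  whose increments they control is Cauchy.\<close>

lemma tendsto_at_left_of_tail_bound:
  fixes g :: "real \<Rightarrow> 'a::banach" and m :: "real \<Rightarrow> real"
  assumes ab: "a0 < b0"
    and int: "set_integrable lborel {a0..<b0} m" and nn: "\<And>s. s \<in> {a0..<b0} \<Longrightarrow> m s \<ge> 0"
    and le: "\<And>a b. a0 \<le> a \<Longrightarrow> a \<le> b \<Longrightarrow> b < b0 \<Longrightarrow> norm (g b - g a) \<le> (LINT s:{a..<b0}|lborel. m s)"
  shows "\<exists>L. (g \<longlongrightarrow> L) (at_left b0)"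
proof -
  define T where "T = (\<lambda>a. LINT s:{a..<b0}|lborel. m s)"
  define x where "x = (\<lambda>n. b0 - (b0 - a0) / real (Suc n))"
  have x1: "x n < b0" "x n \<ge> a0" for n
  proof -
    have "(b0 - a0) / real (Suc n) \<le> (b0 - a0) / 1" by (intro divide_left_mono) (use ab in auto)
    moreover have "(b0 - a0) / real (Suc n) > 0" using ab by simp
    ultimately show "x n < b0" "x n \<ge> a0" by (simp_all add: x_def)
  qed
  have xlim: "x \<longlonglongrightarrow> b0"
  proof -
    have "(\<lambda>n. b0 - (b0 - a0) * inverse (real (Suc n))) \<longlonglongrightarrow> b0 - (b0 - a0) * 0"
      by (intro tendsto_intros LIMSEQ_inverse_real_of_nat)
    then show ?thesis by (simp add: x_def[abs_def] divide_inverse)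
  qed
  define M where "M = (\<lambda>s. indicator {a0..<b0} s * m s)"
  have M: "integrable lborel M" using int by (simp add: M_def set_integrable_def)
  have Mnn: "M s \<ge> 0" for s using nn by (auto simp: M_def indicator_def)
  have TM: "T a = (\<integral>s. indicator {a..<b0} s * M s \<partial>lborel)" if "a0 \<le> a" for a
    unfolding T_def set_lebesgue_integral_def
    by (rule Bochner_Integration.integral_cong) (use that in \<open>auto simp: M_def indicator_def\<close>)
  have Mi: "integrable lborel (\<lambda>s. indicator {a..<b0} s * M s)" for a
    using integrable_mult_indicator[OF _ M, of "{a..<b0}"] by simp
  have Tmono: "T b \<le> T a" if "a0 \<le> a" "a \<le> b" for a b
    unfolding TM[OF that(1)] TM[OF order_trans[OF that]]
    by (intro integral_mono Mi) (use that Mnn in \<open>auto simp: indicator_def\<close>)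
  have "(\<lambda>n. \<integral>s. indicator {x n..<b0} s * M s \<partial>lborel) \<longlonglongrightarrow> (\<integral>s. 0 \<partial>(lborel :: real measure))"
  proof (rule integral_dominated_convergence[where w = M])
    show "AE s in lborel. (\<lambda>n. indicator {x n..<b0} s * M s) \<longlonglongrightarrow> 0"
    proof (rule AE_I2)
      fix s
      show "(\<lambda>n. indicator {x n..<b0} s * M s) \<longlonglongrightarrow> 0"
      proof (cases "s < b0")
        case True
        then have "\<forall>\<^sub>F n in sequentially. x n > s" by (rule order_tendstoD(1)[OF xlim])
        then have "\<forall>\<^sub>F n in sequentially. indicator {x n..<b0} s * M s = 0"
          by eventually_elim auto
        then show ?thesis by (rule tendsto_eventually)
      qed auto
    qed
  qed (use M Mnn in \<open>auto simp: indicator_def\<close>)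
  then have Tx: "(\<lambda>n. T (x n)) \<longlonglongrightarrow> 0"
    using x1 by (simp add: TM)
  have gT: "dist (g a) (g b) \<le> T c" if "a0 \<le> c" "c \<le> a" "a \<le> b" "b < b0" for a b c
    using le[of a b] Tmono[of c a] that by (simp add: T_def dist_norm norm_minus_commute)
  show ?thesis
    unfolding ex_limit_at_left_iff_Cauchy
  proof (intro allI impI)
    fix e :: real assume "e > 0"
    then obtain n where n: "T (x n) < e"
      using order_tendstoD(2)[OF Tx] by (auto simp: eventually_sequentially)
    have "dist (g r) (g s) < e" if "r \<in> {x n<..<b0}" "s \<in> {x n<..<b0}" for r s
      using gT[of "x n" r s] gT[of "x n" s r] that n x1[of n] by (cases "r \<le> s") (auto simp: dist_commute)
    then show "\<exists>a<b0. \<forall>r\<in>{a<..<b0}. \<forall>s\<in>{a<..<b0}. dist (g r) (g s) < e"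
      using x1(1) by blast
  qed
qed

lemma ray_has_vector_derivative:
  assumes "f holomorphic_on ball 0 1" "0 \<le> r" "r < 1"
  shows "((\<lambda>r. f (of_real r * cis t)) has_vector_derivative (cis t * deriv f (of_real r * cis t))) (at r within S)"
proof -
  have "((\<lambda>r. of_real r * cis t) has_vector_derivative cis t) (at r within S)"
    by (auto intro!: derivative_eq_intros has_vector_derivative_mult_right[of of_real 1, simplified] simp: has_vector_derivative_of_real)
  moreover have "(f has_field_derivative deriv f (of_real r * cis t)) (at (of_real r * cis t) within (\<lambda>r. of_real r * cis t) ` S)"
    using assms by (intro holomorphic_derivI[of f "ball 0 1"]) (auto simp: norm_mult)
  ultimately show ?thesis
    using field_vector_diff_chain_within by (fastforce simp: o_def)
qed

lemma circle_has_vector_derivative: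
  assumes "f holomorphic_on ball 0 1" "0 \<le> r" "r < 1"
  shows "((\<lambda>t. f (of_real r * cis t)) has_vector_derivative (\<i> * (of_real r * cis t) * deriv f (of_real r * cis t))) (at t within S)"
proof -
  have "((\<lambda>s. of_real r * exp (\<i> * s)) has_field_derivative \<i> * (of_real r * exp (\<i> * of_real t))) (at (of_real t))"
    by (auto intro!: derivative_eq_intros)
  from has_vector_derivative_real_field[OF this]
  have "((\<lambda>t. of_real r * cis t) has_vector_derivative (\<i> * (of_real r * cis t))) (at t within S)"
    unfolding cis_conv_exp by simp
  moreover have "(f has_field_derivative deriv f (of_real r * cis t)) (at (of_real r * cis t) within (\<lambda>t. of_real r * cis t) ` S)"
    using assms by (intro holomorphic_derivI[of f "ball 0 1"]) (auto simp: norm_mult)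
  ultimately show ?thesis
    using field_vector_diff_chain_within by (fastforce simp: o_def)
qed

lemma set_integrable_continuous_Icc:
  fixes f :: "real \<Rightarrow> 'b::euclidean_space"
  assumes "continuous_on {a..b} f"
  shows "set_integrable lborel {a..b} f"
  using borel_integrable_atLeastAtMost'[OF assms] by simp

section \<open>Variation of F along radii\<close>

context bergman_extremal
begin

lemma weight_cont: "continuous_on (ball 0 1) weight"
  unfolding weight_def[abs_def] using p
  by (intro continuous_intros F_cont deriv_F_cont continuous_on_powr') auto

text \<open>The factor r is the polar Jacobian. As \<open>weight\<close> contains |z| too, the
  integrand is r^2 |F|^(p-1) |F'|, which controls F only away from the origin.\<close>

definition ray_weight :: "real \<Rightarrow> real" where
  "ray_weight t = (LINT r:{0..<1}|lborel. r * weight (of_real r * cis t))"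

definition good_ray :: "real \<Rightarrow> bool" where
  "good_ray t \<longleftrightarrow> set_integrable lborel {0..<1} (\<lambda>r. r * weight (of_real r * cis t))"

lemma AE_good_ray: "AE t in lborel. t \<in> {0..2*pi} \<longrightarrow> good_ray t"
  using polar_iterated(1)[OF weight_int[unfolded integrable_disc_iff]] by (simp add: good_ray_def)

lemma ray_weight_int: "set_integrable lborel {0..2*pi} ray_weight"
  using polar_iterated(2)[OF weight_int[unfolded integrable_disc_iff]] by (simp add: ray_weight_def[abs_def])

text \<open>Along the radius the derivative of |F|^(p-1) F is at most p |F|^(p-1) |F'|, and 4 r^2 >=
  1 for r >= 1/2 restores the factor r^2 present in the integrand. The bound runs up to 1 rather
  than b so as to be a tail independent of b.\<close>

lemma ray_variation:
  assumes t: "good_ray t" and ab: "1/2 \<le> a" "a \<le> b" "b < 1"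
  shows "norm (rpow (p - 1) (F (of_real b * cis t)) - rpow (p - 1) (F (of_real a * cis t)))
     \<le> (LINT s:{a..<1}|lborel. 4 * p * (s * weight (of_real s * cis t)))"
proof -
  define g where "g = (\<lambda>r. rpow (p - 1) (F (of_real r * cis t)))"
  define m where "m = (\<lambda>s. 4 * p * (s * weight (of_real s * cis t)))"
  have "\<exists>D. (g has_vector_derivative D) (at r within {a..b}) \<and> norm D \<le> m r" if r: "r \<in> {a..b}" for r
  proof -
    let ?z = "of_real r * cis t"
    obtain D where D: "((rpow (p - 1)) has_derivative D) (at (F ?z))"
      "\<And>v. norm (D v) \<le> p * norm (F ?z) powr (p - 1) * norm v"
      using has_derivative_rpow[OF p] by blast
    have "((\<lambda>r. F (of_real r * cis t)) has_vector_derivative (cis t * deriv F ?z)) (at r within {a..b})"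
      using r ab by (intro ray_has_vector_derivative F_hol) auto
    then have "((\<lambda>r. F (of_real r * cis t)) has_derivative (\<lambda>h. h *\<^sub>R (cis t * deriv F ?z))) (at r within {a..b})"
      by (simp add: has_vector_derivative_def)
    from has_derivative_compose[OF this D(1)]
    have "(g has_derivative (\<lambda>h. D (h *\<^sub>R (cis t * deriv F ?z)))) (at r within {a..b})"
      by (simp add: g_def)
    moreover have "D (h *\<^sub>R v) = h *\<^sub>R D v" for h v
      using D(1) has_derivative_bounded_linear bounded_linear.linear linear_scale by blast
    ultimately have "(g has_vector_derivative D (cis t * deriv F ?z)) (at r within {a..b})"
      by (simp add: has_vector_derivative_def)
    moreover have "norm (D (cis t * deriv F ?z)) \<le> p * norm (F ?z) powr (p - 1) * norm (deriv F ?z)"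
      using D(2)[of "cis t * deriv F ?z"] by (simp add: norm_mult)
    moreover have "\<dots> \<le> (4 * (r * r)) * (p * norm (F ?z) powr (p - 1) * norm (deriv F ?z))"
    proof -
      have "1/2 * (1/2) \<le> r * r" using r ab by (intro mult_mono) auto
      then have "1 * (p * norm (F ?z) powr (p - 1) * norm (deriv F ?z))
          \<le> (4 * (r * r)) * (p * norm (F ?z) powr (p - 1) * norm (deriv F ?z))"
        using p by (intro mult_right_mono) auto
      then show ?thesis by simp
    qed
    moreover have "(4 * (r * r)) * (p * norm (F ?z) powr (p - 1) * norm (deriv F ?z)) = m r"
      using r ab by (simp add: m_def weight_def norm_mult)
    ultimately show ?thesis by (intro exI[of _ "D (cis t * deriv F ?z)"]) auto
  qed
  then obtain D where D: "\<And>r. r \<in> {a..b} \<Longrightarrow> (g has_vector_derivative D r) (at r within {a..b})"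
    "\<And>r. r \<in> {a..b} \<Longrightarrow> norm (D r) \<le> m r"
    by metis
  have hi: "(D has_integral (g b - g a)) {a..b}"
    by (rule fundamental_theorem_of_calculus) (use ab D in auto)
  have mcont: "continuous_on {a..b} m"
    unfolding m_def
    by (intro continuous_intros continuous_on_compose2[OF weight_cont])
       (use ab in \<open>auto simp: norm_mult cis_conv_exp intro!: continuous_intros\<close>)
  have mint: "set_integrable lborel {0..<1} m"
    using t unfolding m_def good_ray_def by simp
  have mab: "set_integrable lborel {a..b} m" "set_integrable lborel {a..<1} m"
    using ab by (auto intro: set_integrable_subset[OF mint])
  have "norm (g b - g a) = norm (integral {a..b} D)"
    using hi by (simp add: integral_unique)
  also have "\<dots> \<le> integral {a..b} m"
    by (rule Henstock_Kurzweil_Integration.integral_norm_bound_integral[OF has_integral_integrable[OF hi]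
        integrable_continuous_real[OF mcont] D(2)])
  also have "\<dots> = (LINT s:{a..b}|lborel. m s)"
    using set_borel_integral_eq_integral(2)[OF mab(1)] by simp
  also have "\<dots> \<le> (LINT s:{a..<1}|lborel. m s)"
  proof -
    have "m s \<ge> 0" if "s \<ge> 0" for s using that p weight_nonneg by (auto simp: m_def)
    then show ?thesis
      using mab ab unfolding set_lebesgue_integral_def set_integrable_def
      by (intro integral_mono) (auto simp: indicator_def)
  qed
  finally show ?thesis by (simp add: g_def m_def)
qed

text \<open>Finite variation gives a limit of |F|^(p-1) F; the continuous inverse radial power
  carries it over to F, also when the limit is 0.\<close>

lemma good_ray_limit:
  assumes t: "good_ray t"
  shows "\<exists>l. ((\<lambda>r. F (of_real r * cis t)) \<longlongrightarrow> l) (at_left 1)"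
proof -
  define m where "m = (\<lambda>s. 4 * p * (s * weight (of_real s * cis t)))"
  have mint: "set_integrable lborel {0..<1} m"
    using t unfolding m_def good_ray_def by simp
  have "\<exists>L. ((\<lambda>r. rpow (p - 1) (F (of_real r * cis t))) \<longlongrightarrow> L) (at_left 1)"
  proof (rule tendsto_at_left_of_tail_bound)
    show "set_integrable lborel {1/2..<1} m" by (rule set_integrable_subset[OF mint]) auto
    show "m s \<ge> 0" if "s \<in> {1/2..<1}" for s using that p weight_nonneg by (auto simp: m_def)
  qed (use ray_variation[OF t] in \<open>auto simp: m_def\<close>)
  then obtain L where L: "((\<lambda>r. rpow (p - 1) (F (of_real r * cis t))) \<longlongrightarrow> L) (at_left 1)" ..
  \<comment> \<open>That is 1/p - 1, left in the shape of \<open>rpow_inverse\<close> for the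
    exponent p - 1.\<close>
  define s where "s = 1 / (p - 1 + 1) - 1"
  have s: "s > -1" using p by (simp add: s_def)
  have "((\<lambda>r. rpow s (rpow (p - 1) (F (of_real r * cis t)))) \<longlongrightarrow> rpow s L) (at_left 1)"
    by (rule isCont_tendsto_compose[OF continuous_rpow[OF s] L])
  moreover have "rpow s (rpow (p - 1) w) = w" for w
    using rpow_inverse[of "p - 1" w] p unfolding s_def by simp
  ultimately have "((\<lambda>r. F (of_real r * cis t)) \<longlongrightarrow> rpow s L) (at_left 1)"
    by simp
  then show ?thesis by blast
qed

lemma good_ray_boundary_val:
  assumes "good_ray t"
  shows "((\<lambda>r. F (of_real r * cis t)) \<longlongrightarrow> boundary_val F t) (at_left 1)"
  using good_ray_limit[OF assms] unfolding boundary_val_def by (auto simp: tendsto_Lim)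

text \<open>Value at radius 1/2 plus the variation beyond it: since |F|^p is the modulus of
  |F|^(p-1) F, this dominates |F|^p on the outer half of a good radius.\<close>

definition ray_bound :: "real \<Rightarrow> real" where
  "ray_bound t = norm (F (of_real (1/2) * cis t)) powr p + 4 * p * ray_weight t"

lemma F_circle_continuous:
  assumes "0 \<le> r" "r < 1"
  shows "continuous_on S (\<lambda>t. F (of_real r * cis t))"
  using assms by (intro continuous_on_compose2[OF F_cont])
    (auto simp: norm_mult cis_conv_exp intro!: continuous_intros)

lemma ray_bound_int: "set_integrable lborel {0..2*pi} ray_bound"
  unfolding ray_bound_def[abs_def]
proof (rule set_integral_add)
  show "set_integrable lborel {0..2*pi} (\<lambda>t. norm (F (of_real (1/2) * cis t)) powr p)"
    using p by (intro set_integrable_continuous_Icc continuous_on_powr' continuous_intros F_circle_continuous) auto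
  show "set_integrable lborel {0..2*pi} (\<lambda>t. 4 * p * ray_weight t)"
    using ray_weight_int by simp
qed

lemma good_ray_le:
  assumes t: "good_ray t" and r: "1/2 \<le> r" "r < 1"
  shows "norm (F (of_real r * cis t)) powr p \<le> ray_bound t"
proof -
  define B where "B = rpow (p - 1)"
  have "norm (B (F (of_real r * cis t))) \<le> norm (B (F (of_real (1/2) * cis t)))
     + norm (B (F (of_real r * cis t)) - B (F (of_real (1/2) * cis t)))"
    by (metis add.commute diff_add_cancel norm_triangle_ineq)
  also have "norm (B (F (of_real r * cis t)) - B (F (of_real (1/2) * cis t)))
     \<le> (LINT s:{1/2..<1}|lborel. 4 * p * (s * weight (of_real s * cis t)))"
    unfolding B_def by (rule ray_variation[OF t]) (use r in auto)
  also have "\<dots> = 4 * p * (LINT s:{1/2..<1}|lborel. s * weight (of_real s * cis t))"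
    by simp
  also have "(LINT s:{1/2..<1}|lborel. s * weight (of_real s * cis t)) \<le> ray_weight t"
    unfolding ray_weight_def set_lebesgue_integral_def
  proof (rule integral_mono)
    have i: "set_integrable lborel {0..<1} (\<lambda>s. s * weight (of_real s * cis t))" using t by (simp add: good_ray_def)
    then show "integrable lborel (\<lambda>s. indicator {0..<1} s *\<^sub>R (s * weight (of_real s * cis t)))"
      by (simp add: set_integrable_def)
    have "set_integrable lborel {1/2..<1} (\<lambda>s. s * weight (of_real s * cis t))"
      by (rule set_integrable_subset[OF i]) auto
    then show "integrable lborel (\<lambda>s. indicator {1/2..<1} s *\<^sub>R (s * weight (of_real s * cis t)))"
      by (simp add: set_integrable_def)
  qed (use weight_nonneg in \<open>auto simp: indicator_def\<close>)
  finally show ?thesis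
    using p by (simp add: B_def norm_rpow ray_bound_def)
qed

text \<open>Radii beyond 1/2 are handled by the integrable majorant along almost all rays, the
  others by boundedness of F on a compact disc.\<close>

lemma F_in_Hardy: "in_Hardy p F"
proof -
  have eq: "integral_mean p F r = 1 / (2 * pi) * (LINT t:{0..2*pi}|lborel. norm (F (of_real r * cis t)) powr p)" for r
    unfolding integral_mean_def zero_ereal_def by (subst interval_integral_Icc) auto
  have cint: "set_integrable lborel {0..2*pi} (\<lambda>t. norm (F (of_real r * cis t)) powr p)" if "0 < r" "r < 1" for r
    using p that by (intro set_integrable_continuous_Icc continuous_on_powr' continuous_intros F_circle_continuous) auto
  have sub: "cball 0 (1/2) \<subseteq> ball (0::complex) 1" by auto
  have "bounded (F ` cball 0 (1/2))"
    by (intro compact_imp_bounded compact_continuous_image continuous_on_subset[OF F_cont sub] compact_cball)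
  then obtain B where B: "B > 0" "\<And>z. z \<in> cball 0 (1/2) \<Longrightarrow> norm (F z) \<le> B"
    unfolding bounded_pos by auto
  define H where "H = (LINT t:{0..2*pi}|lborel. B powr p + \<bar>ray_bound t\<bar>)"
  have Hint: "set_integrable lborel {0..2*pi} (\<lambda>t. B powr p + \<bar>ray_bound t\<bar>)"
    by (intro set_integral_add set_integrable_abs ray_bound_int set_integrable_continuous_Icc continuous_on_const)
  have "integral_mean p F r \<le> 1 / (2 * pi) * H" if r: "r \<in> {0<..<1}" for r
    unfolding eq
  proof (rule mult_left_mono)
    show "(LINT t:{0..2*pi}|lborel. norm (F (of_real r * cis t)) powr p) \<le> H"
      unfolding H_def
    proof (rule set_integral_mono_AE)
      show "AE t\<in>{0..2*pi} in lborel. norm (F (of_real r * cis t)) powr p \<le> B powr p + \<bar>ray_bound t\<bar>"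
        using AE_good_ray
      proof eventually_elim
        case (elim t)
        show ?case
        proof
          assume "t \<in> {0..2*pi}"
          show "norm (F (of_real r * cis t)) powr p \<le> B powr p + \<bar>ray_bound t\<bar>"
          proof (cases "r \<le> 1/2")
            case True
            then have "norm (F (of_real r * cis t)) \<le> B" using r by (intro B(2)) (auto simp: norm_mult)
            then have "norm (F (of_real r * cis t)) powr p \<le> B powr p" using p by (intro powr_mono2) auto
            then show ?thesis by simp
          next
            case False
            then show ?thesis using good_ray_le[of t r] elim \<open>t \<in> _\<close> r by (simp add: add_increasing)
          qed
        qed
      qed
    qed (use cint r Hint in auto)
  qed auto
  then have "bdd_above (integral_mean p F ` {0<..<1})" by (rule bdd_aboveI2)
  then show ?thesis using F_hol by (simp add: in_Hardy_def)
qed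

end

section \<open>Green's formula\<close>

text \<open>The shift by 2 keeps every radius in [1/2, 1), where \<open>good_ray_le\<close>
  applies.\<close>

definition rho_seq :: "nat \<Rightarrow> real" where "rho_seq n = 1 - 1 / real (n + 2)"

lemma rho_seq: "1/2 \<le> rho_seq n" "0 \<le> rho_seq n" "rho_seq n < 1"
  by (auto simp: rho_seq_def field_simps)

lemma rho_seq_tendsto: "rho_seq \<longlonglongrightarrow> 1"
proof -
  have "(\<lambda>n. 1 / real (n + 2)) \<longlonglongrightarrow> 0"
    using LIMSEQ_ignore_initial_segment[OF lim_1_over_n, of 2] by simp
  from tendsto_diff[OF tendsto_const this, of 1] show ?thesis by (simp add: rho_seq_def[abs_def])
qed

lemma rho_seq_at_left: "filterlim rho_seq (at_left 1) sequentially"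
  using rho_seq_tendsto rho_seq(3) by (auto simp: filterlim_at intro!: always_eventually less_imp_neq)

text \<open>By continuity in r the Cauchy condition need only be tested at rational radii, so the
  set of convergence is Borel. On it the limit may be taken along a sequence of radii.\<close>

lemma Lim_at_left_measurable:
  fixes f :: "real \<Rightarrow> real \<Rightarrow> complex"
  assumes meas: "\<And>r. 0 \<le> r \<Longrightarrow> r < 1 \<Longrightarrow> (\<lambda>t. f t r) \<in> borel_measurable borel"
    and cont: "\<And>t r. 0 < r \<Longrightarrow> r < 1 \<Longrightarrow> isCont (f t) r"
  shows "(\<lambda>t. Lim (at_left 1) (f t)) \<in> borel_measurable borel"
proof -
  define Q where "Q = (\<lambda>m. {r \<in> \<rat>. rho_seq m < r \<and> r < 1})"
  define x where "x = rho_seq"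
  have x: "0 < x n" "x n < 1" for n using rho_seq[of n] by (auto simp: x_def)
  have xlim: "x \<longlonglongrightarrow> 1" unfolding x_def by (rule rho_seq_tendsto)
  define C where "C = {t. \<exists>l. (f t \<longlongrightarrow> l) (at_left 1)}"
  have conv_iff: "t \<in> C \<longleftrightarrow> (\<forall>n. \<exists>m. \<forall>r\<in>Q m. \<forall>s\<in>Q m. dist (f t r) (f t s) \<le> 1 / real (Suc n))" for t
  proof
    assume "t \<in> C"
    show "\<forall>n. \<exists>m. \<forall>r\<in>Q m. \<forall>s\<in>Q m. dist (f t r) (f t s) \<le> 1 / real (Suc n)"
    proof
      fix n
      have "(0 :: real) < 1 / real (Suc n)" by simp
      then obtain b where b: "b < 1" "\<forall>r\<in>{b<..<1}. \<forall>s\<in>{b<..<1}. dist (f t r) (f t s) < 1 / real (Suc n)"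
        using \<open>t \<in> C\<close> unfolding C_def mem_Collect_eq ex_limit_at_left_iff_Cauchy by meson
      obtain m where "b < x m" using order_tendstoD(1)[OF xlim b(1)] by (auto simp: eventually_sequentially)
      then have "Q m \<subseteq> {b<..<1}" by (auto simp: Q_def x_def)
      then show "\<exists>m. \<forall>r\<in>Q m. \<forall>s\<in>Q m. dist (f t r) (f t s) \<le> 1 / real (Suc n)"
        using b(2) by (meson less_imp_le subsetD)
    qed
  next
    assume R: "\<forall>n. \<exists>m. \<forall>r\<in>Q m. \<forall>s\<in>Q m. dist (f t r) (f t s) \<le> 1 / real (Suc n)"
    have near: "\<exists>q\<in>Q m. dist (f t r) (f t q) < e" if e: "e > 0" and r: "r \<in> {x m<..<1}" for e r m
    proof -
      have "isCont (f t) r" by (rule cont) (use r x[of m] in auto)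
      then obtain d where d: "d > 0" "\<And>y. dist y r < d \<Longrightarrow> dist (f t y) (f t r) < e"
        using e unfolding continuous_at_eps_delta by blast
      obtain q where q: "q \<in> \<rat>" "r < q" "q < min (r + d) 1"
        using Rats_dense_in_real[of r "min (r + d) 1"] d r by auto
      then have "q \<in> Q m" using r by (auto simp: Q_def x_def)
      moreover have "dist (f t q) (f t r) < e" by (rule d(2)) (use q in \<open>auto simp: dist_real_def\<close>)
      ultimately show ?thesis by (metis dist_commute)
    qed
    show "t \<in> C"
      unfolding C_def mem_Collect_eq ex_limit_at_left_iff_Cauchy
    proof (intro allI impI)
      fix e :: real assume e: "e > 0"
      obtain n where n: "1 / real (Suc n) < e / 3"
        by (rule nat_approx_posE[of "e / 3"]) (use e in auto)
      obtain m where m: "\<forall>r\<in>Q m. \<forall>s\<in>Q m. dist (f t r) (f t s) \<le> 1 / real (Suc n)" using R by blast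
      have "dist (f t r) (f t s) < e" if rs: "r \<in> {x m<..<1}" "s \<in> {x m<..<1}" for r s
      proof -
        obtain q q' where q: "q \<in> Q m" "dist (f t r) (f t q) < e / 3" "q' \<in> Q m" "dist (f t s) (f t q') < e / 3"
          using near[of "e / 3" r m] near[of "e / 3" s m] rs e by auto
        then have "dist (f t q) (f t q') < e / 3" using m n by fastforce
        then show ?thesis using q
          dist_triangle[of "f t r" "f t s" "f t q"] dist_triangle2[of "f t q" "f t s" "f t q'"] by linarith
      qed
      then show "\<exists>a<1. \<forall>r\<in>{a<..<1}. \<forall>s\<in>{a<..<1}. dist (f t r) (f t s) < e"
        using x(2) by blast
    qed
  qed
  have Qc: "countable (Q m)" for m
    unfolding Q_def by (rule countable_subset[OF _ countable_rat]) auto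
  have Q01: "0 \<le> r \<and> r < 1" if "r \<in> Q m" for r m
    using that rho_seq[of m] by (auto simp: Q_def)
  have "C = (\<Inter>n. \<Union>m. {t. \<forall>r\<in>Q m. \<forall>s\<in>Q m. dist (f t r) (f t s) \<le> 1 / real (Suc n)})"
    using conv_iff by auto
  also have "\<dots> \<in> sets borel"
  proof (intro sets.countable_INT'' sets.countable_UN)
    fix n
    have *: "{t. \<forall>r\<in>Q m. \<forall>s\<in>Q m. dist (f t r) (f t s) \<le> 1 / real (Suc n)} \<in> sets borel" for m
    proof -
      have "{t. dist (f t r) (f t s) \<le> 1 / real (Suc n)} \<in> sets borel" if "r \<in> Q m" "s \<in> Q m" for r s
      proof -
        have [measurable]: "(\<lambda>t. f t r) \<in> borel_measurable borel" "(\<lambda>t. f t s) \<in> borel_measurable borel"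
          using that meas Q01 by blast+
        have "{t \<in> space borel. dist (f t r) (f t s) \<le> 1 / real (Suc n)} \<in> sets borel" by measurable
        then show ?thesis by simp
      qed
      then have "(\<Inter>r\<in>Q m. \<Inter>s\<in>Q m. {t. dist (f t r) (f t s) \<le> 1 / real (Suc n)}) \<in> sets borel"
        by (intro sets.countable_INT'' Qc) auto
      also have "(\<Inter>r\<in>Q m. \<Inter>s\<in>Q m. {t. dist (f t r) (f t s) \<le> 1 / real (Suc n)})
          = {t. \<forall>r\<in>Q m. \<forall>s\<in>Q m. dist (f t r) (f t s) \<le> 1 / real (Suc n)}" by auto
      finally show ?thesis .
    qed
    then show "range (\<lambda>m. {t. \<forall>r\<in>Q m. \<forall>s\<in>Q m. dist (f t r) (f t s) \<le> 1 / real (Suc n)}) \<subseteq> sets borel" by auto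
  qed auto
  finally have C: "C \<in> sets borel" .
  have [measurable]: "(\<lambda>t. lim (\<lambda>n. f t (x n))) \<in> borel_measurable borel"
    using meas x by (intro borel_measurable_lim_metric) (auto intro: less_imp_le)
  \<comment> \<open>without a limit, \<open>Lim\<close> is a fixed junk value\<close>
  have eq: "Lim (at_left 1) (f t) = (if t \<in> C then lim (\<lambda>n. f t (x n)) else (THE l. False))" for t
  proof (cases "t \<in> C")
    case True
    then obtain l where l: "(f t \<longlongrightarrow> l) (at_left 1)" by (auto simp: C_def)
    have "filterlim x (at_left 1) sequentially"
      unfolding x_def by (rule rho_seq_at_left)
    then have "(\<lambda>n. f t (x n)) \<longlonglongrightarrow> l" using l by (rule filterlim_compose[rotated])
    then show ?thesis using True l by (simp add: limI tendsto_Lim)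
  next
    case False
    then have "\<not> (f t \<longlongrightarrow> l) (at_left 1)" for l by (auto simp: C_def)
    then show ?thesis using False by (simp add: Topological_Spaces.Lim_def)
  qed
  show ?thesis unfolding eq using C by measurable
qed

lemma set_integrable_ball_continuous:
  fixes f :: "complex \<Rightarrow> 'b::{banach, second_countable_topology}"
  assumes "continuous_on (ball 0 1) f" "\<rho> < 1"
  shows "set_integrable lborel (ball 0 \<rho>) f"
proof -
  have "set_integrable lborel (cball 0 \<rho>) f"
    unfolding set_integrable_def using assms
    by (intro borel_integrable_compact continuous_on_subset[OF assms(1)]) auto
  then show ?thesis by (rule set_integrable_subset) auto
qed

lemma set_integral_Ico_FTC:
  fixes G :: "real \<Rightarrow> 'a::euclidean_space"
  assumes "a \<le> b" "\<And>x. a \<le> x \<Longrightarrow> x \<le> b \<Longrightarrow> (G has_vector_derivative g x) (at x within {a..b})"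
    "continuous_on {a..b} g"
  shows "(LINT x:{a..<b}|lborel. g x) = G b - G a" and "(LINT x:{a..b}|lborel. g x) = G b - G a"
proof -
  show *: "(LINT x:{a..b}|lborel. g x) = G b - G a"
    unfolding set_lebesgue_integral_def using assms by (intro integral_FTC_atLeastAtMost) auto
  have "set_integrable lborel {a..b} g" using borel_integrable_atLeastAtMost'[OF assms(3)] by simp
  then have m: "(\<lambda>x. indicator {a..b} x *\<^sub>R g x) \<in> borel_measurable lborel"
    by (auto simp: set_integrable_def)
  have "(\<lambda>x. indicator {a..<b} x *\<^sub>R (indicator {a..b} x *\<^sub>R g x)) \<in> borel_measurable lborel"
    using m by measurable
  also have "(\<lambda>x. indicator {a..<b} x *\<^sub>R (indicator {a..b} x *\<^sub>R g x)) = (\<lambda>x. indicator {a..<b} x *\<^sub>R g x)"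
    by (auto simp: indicator_def)
  finally have m': "(\<lambda>x. indicator {a..<b} x *\<^sub>R g x) \<in> borel_measurable lborel" .
  have "AE x in lborel. x \<noteq> b" by (rule AE_lborel_singleton)
  then have "AE x in lborel. indicator {a..<b} x *\<^sub>R g x = indicator {a..b} x *\<^sub>R g x"
    by eventually_elim (auto simp: indicator_def)
  then have "(LINT x:{a..<b}|lborel. g x) = (LINT x:{a..b}|lborel. g x)"
    unfolding set_lebesgue_integral_def using m m' by (intro integral_cong_AE) auto
  with * show "(LINT x:{a..<b}|lborel. g x) = G b - G a" by simp
qed

lemma set_integral_ball_tendsto:
  fixes f :: "complex \<Rightarrow> complex"
  assumes f: "integrable area f"
  shows "(\<lambda>n. LINT z:ball 0 (rho_seq n)|lborel. f z) \<longlonglongrightarrow> integral\<^sup>L area f"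
proof -
  define g where "g = (\<lambda>z. indicator (ball 0 1) z *\<^sub>R f z)"
  have g: "integrable lborel g" using f by (simp add: integrable_disc_iff set_integrable_def g_def)
  have [measurable]: "g \<in> borel_measurable borel" using g by auto
  have "(\<lambda>n. \<integral>z. indicator (ball 0 (rho_seq n)) z *\<^sub>R g z \<partial>lborel) \<longlonglongrightarrow> integral\<^sup>L lborel g"
  proof (rule integral_dominated_convergence[where w = "\<lambda>z. norm (g z)"])
    show "AE z in lborel. (\<lambda>n. indicator (ball 0 (rho_seq n)) z *\<^sub>R g z) \<longlonglongrightarrow> g z"
    proof (rule AE_I2)
      fix z
      show "(\<lambda>n. indicator (ball 0 (rho_seq n)) z *\<^sub>R g z) \<longlonglongrightarrow> g z"
      proof (cases "norm z < 1")
        case True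
        then have "\<forall>\<^sub>F n in sequentially. rho_seq n > norm z" by (rule order_tendstoD(1)[OF rho_seq_tendsto])
        then have "\<forall>\<^sub>F n in sequentially. indicator (ball 0 (rho_seq n)) z *\<^sub>R g z = g z"
          by eventually_elim auto
        then show ?thesis by (rule tendsto_eventually)
      qed (auto simp: g_def)
    qed
  qed (use g in \<open>auto simp: indicator_def\<close>)
  moreover have "indicator (ball 0 (rho_seq n)) z *\<^sub>R g z = indicator (ball 0 (rho_seq n)) z *\<^sub>R f z" for n z
    using rho_seq[of n] by (auto simp: g_def indicator_def)
  moreover have "integral\<^sup>L lborel g = integral\<^sup>L area f"
    using integral_disc_eq[of f] by (simp add: g_def set_lebesgue_integral_def)
  ultimately show ?thesis by (simp add: set_lebesgue_integral_def)
qed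

lemma disc_ray_cont:
  fixes f :: "complex \<Rightarrow> 'b::real_normed_vector"
  assumes "continuous_on (ball 0 1) f" "\<rho> < 1"
  shows "continuous_on {0..\<rho>} (\<lambda>r. r *\<^sub>R f (of_real r * cis t))"
  using assms(2) by (intro continuous_intros continuous_on_compose2[OF assms(1)])
    (auto intro!: continuous_intros simp: norm_mult)

lemma disc_circle_cont:
  fixes f :: "complex \<Rightarrow> 'b::real_normed_vector"
  assumes "continuous_on (ball 0 1) f" "0 \<le> r" "r < 1"
  shows "continuous_on S (\<lambda>t. f (of_real r * cis t))"
  using assms(2,3) by (intro continuous_on_compose2[OF assms(1)])
    (auto intro!: continuous_intros simp: norm_mult cis_conv_exp)

section \<open>Boundary values, and Green's formula on concentric discs and in the limit\<close>

context bergman_extremal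
begin

lemma boundary_val_measurable: "boundary_val F \<in> borel_measurable borel"
proof -
  have "(\<lambda>t. Lim (at_left 1) (\<lambda>r. F (of_real r * cis t))) \<in> borel_measurable borel"
  proof (rule Lim_at_left_measurable)
    fix r :: real assume r: "0 \<le> r" "r < 1"
    then show "(\<lambda>t. F (of_real r * cis t)) \<in> borel_measurable borel"
      by (intro borel_measurable_continuous_onI F_circle_continuous)
  next
    fix t r :: real assume r: "0 < r" "r < 1"
    have "((\<lambda>r. F (of_real r * cis t)) has_vector_derivative (cis t * deriv F (of_real r * cis t))) (at r)"
      using r by (intro ray_has_vector_derivative F_hol) auto
    then show "isCont (\<lambda>r. F (of_real r * cis t)) r" by (rule has_vector_derivative_continuous)
  qed
  then show ?thesis by (simp add: boundary_val_def[abs_def])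
qed

text \<open>A complex form of \<open>weight\<close>, with that modulus. Its parts are derivatives of
  |F|^p in polar coordinates: r d/dr |F|^p = p Re W and d/dt |F|^p = -p Im W.\<close>

definition W :: "complex \<Rightarrow> complex" where
  "W z = cnj (rpow (p - 2) (F z)) * (z * deriv F z)"

lemma W_cont: "continuous_on (ball 0 1) W"
  unfolding W_def[abs_def] using p by (intro continuous_intros F_cont deriv_F_cont) auto

lemma norm_powr_F_cont: "continuous_on (ball 0 1) (\<lambda>z. norm (F z) powr p)"
  using p by (intro continuous_intros F_cont continuous_on_powr') auto

lemma norm_powr_F_curve_derivative:
  assumes "((\<lambda>x. F (c x)) has_vector_derivative d) (at x within S)"
  shows "((\<lambda>x. norm (F (c x)) powr p) has_vector_derivative p * Re (cnj (rpow (p - 2) (F (c x))) * d)) (at x within S)"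
proof -
  have "((\<lambda>x. F (c x)) has_derivative (\<lambda>h. h *\<^sub>R d)) (at x within S)"
    using assms by (simp add: has_vector_derivative_def)
  from has_derivative_compose[OF this has_derivative_norm_powr[OF p]]
  show ?thesis by (simp add: has_vector_derivative_def algebra_simps)
qed

text \<open>The factor r^2 makes the derivative a multiple of the Jacobian r and makes the boundary
  term at the origin vanish.\<close>

lemma radial_part:
  fixes m :: nat
  assumes "0 \<le> r" "r < 1"
  shows "((\<lambda>r. of_real (r\<^sup>2 * norm (F (of_real r * cis t)) powr p) * (of_real r * cis t) ^ m) has_vector_derivative
     r *\<^sub>R (let z = of_real r * cis t in (of_real (2 + m) * of_real (norm (F z) powr p) + of_real (p * Re (W z))) * z ^ m)) (at r within S)"
proof -
  define z where "z = of_real r * cis t"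
  define d where "d = p * Re (cnj (rpow (p - 2) (F z)) * (cis t * deriv F z))"
  have 1: "((\<lambda>r. norm (F (of_real r * cis t)) powr p) has_vector_derivative d) (at r within S)"
    unfolding d_def z_def by (intro norm_powr_F_curve_derivative ray_has_vector_derivative F_hol assms)
  have 2: "((\<lambda>r. r\<^sup>2 * norm (F (of_real r * cis t)) powr p) has_real_derivative (r\<^sup>2 * d + 2 * r * norm (F z) powr p)) (at r within S)"
  proof -
    have "((\<lambda>r. r\<^sup>2) has_real_derivative 2 * r) (at r within S)" by (auto intro!: derivative_eq_intros)
    from DERIV_mult[OF this 1[folded has_real_derivative_iff_has_vector_derivative]]
    show ?thesis by (simp add: z_def mult_ac add_ac)
  qed
  have 3: "((\<lambda>r. r ^ m) has_real_derivative (real m * r ^ (m - 1))) (at r within S)"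
    by (auto intro!: derivative_eq_intros)
  have 4: "((\<lambda>r. (r\<^sup>2 * norm (F (of_real r * cis t)) powr p) * r ^ m) has_real_derivative
     ((r\<^sup>2 * d + 2 * r * norm (F z) powr p) * r ^ m + real m * r ^ (m - 1) * (r\<^sup>2 * norm (F z) powr p))) (at r within S)"
    using DERIV_mult[OF 2 3] by (simp add: z_def)
  have 5: "((\<lambda>r. of_real ((r\<^sup>2 * norm (F (of_real r * cis t)) powr p) * r ^ m) * cis t ^ m) has_vector_derivative
     of_real ((r\<^sup>2 * d + 2 * r * norm (F z) powr p) * r ^ m + real m * r ^ (m - 1) * (r\<^sup>2 * norm (F z) powr p)) * cis t ^ m) (at r within S)"
    using 4 by (intro has_vector_derivative_mult_left has_vector_derivative_of_real)
  have rd: "r * d = p * Re (W z)"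
    by (simp add: d_def W_def z_def algebra_simps)
  \<comment> \<open>For m = 0 the exponent m - 1 truncates, but both sides are then 0.\<close>
  have rm: "real m * r ^ (m - 1) * r = real m * r ^ m" by (cases m) auto
  have "(r\<^sup>2 * d + 2 * r * norm (F z) powr p) * r ^ m + real m * r ^ (m - 1) * (r\<^sup>2 * norm (F z) powr p)
    = r * ((2 + real m) * norm (F z) powr p + r * d) * r ^ m"
    using rm by (auto simp: power2_eq_square algebra_simps)
  then have eq: "of_real ((r\<^sup>2 * d + 2 * r * norm (F z) powr p) * r ^ m + real m * r ^ (m - 1) * (r\<^sup>2 * norm (F z) powr p)) * cis t ^ m
     = r *\<^sub>R ((of_real (2 + m) * of_real (norm (F z) powr p) + of_real (p * Re (W z))) * z ^ m)"
    unfolding rd by (simp add: z_def scaleR_conv_of_real power_mult_distrib)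
  show ?thesis
    using 5 unfolding eq Let_def z_def[symmetric]
    by (simp add: power_mult_distrib mult_ac)
qed

text \<open>As an angular derivative of a periodic function, this expression integrates to 0 over
  every circle.\<close>

lemma angular_part:
  fixes m :: nat
  assumes "0 \<le> r" "r < 1"
  shows "((\<lambda>t. of_real (norm (F (of_real r * cis t)) powr p) * (of_real r * cis t) ^ m) has_vector_derivative
     (let z = of_real r * cis t in (\<i> * of_nat m * of_real (norm (F z) powr p) - of_real (p * Im (W z))) * z ^ m)) (at t within S)"
proof -
  define z where "z = of_real r * cis t"
  have 1: "((\<lambda>t. norm (F (of_real r * cis t)) powr p) has_vector_derivative
       p * Re (cnj (rpow (p - 2) (F z)) * (\<i> * z * deriv F z))) (at t within S)"
    unfolding z_def by (intro norm_powr_F_curve_derivative circle_has_vector_derivative F_hol assms)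
  also have "p * Re (cnj (rpow (p - 2) (F z)) * (\<i> * z * deriv F z)) = - (p * Im (W z))"
    by (simp add: W_def algebra_simps)
  finally have 2: "((\<lambda>t. complex_of_real (norm (F (of_real r * cis t)) powr p)) has_vector_derivative
       of_real (- (p * Im (W z)))) (at t within S)"
    by (rule has_vector_derivative_of_real[unfolded has_real_derivative_iff_has_vector_derivative])
  have "((\<lambda>z. z ^ m) has_field_derivative of_nat m * z ^ (m - 1)) (at z)" for z :: complex
    by (auto intro!: derivative_eq_intros)
  then have d: "deriv (\<lambda>z. z ^ m) z = of_nat m * z ^ (m - 1)" for z :: complex
    by (rule DERIV_imp_deriv)
  have "((\<lambda>t. (of_real r * cis t) ^ m) has_vector_derivative (\<i> * z * deriv (\<lambda>z. z ^ m) z)) (at t within S)"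
    unfolding z_def by (rule circle_has_vector_derivative) (use assms in \<open>auto intro!: holomorphic_intros\<close>)
  also have "\<i> * z * deriv (\<lambda>z. z ^ m) z = \<i> * of_nat m * z ^ m"
    unfolding d by (cases m) auto
  finally have "((\<lambda>t. complex_of_real (norm (F (of_real r * cis t)) powr p) * (of_real r * cis t) ^ m) has_vector_derivative
     (of_real (norm (F z) powr p) * (\<i> * of_nat m * z ^ m) + of_real (- (p * Im (W z))) * z ^ m)) (at t within S)"
    using has_vector_derivative_mult[OF 2] by (simp add: z_def)
  then show ?thesis by (simp add: Let_def z_def algebra_simps)
qed

text \<open>The integrand is the combination f1 - i f2 of a radial and an angular derivative. The
  radial one integrates to the boundary term, the angular one to 0; F is smooth up to the smaller
  circle, so the fundamental theorem of calculus applies on every radius and circle.\<close>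

lemma Green_smaller_disc:
  fixes m :: nat
  assumes \<rho>: "0 \<le> \<rho>" "\<rho> < 1"
  shows "(LINT z:ball 0 \<rho>|lborel. (of_nat (2 + 2 * m) * of_real (norm (F z) powr p) + of_real p * W z) * z ^ m)
     = (LINT t:{0..2*pi}|lborel. of_real (\<rho>\<^sup>2 * norm (F (of_real \<rho> * cis t)) powr p) * (of_real \<rho> * cis t) ^ m)"
proof -
  define f1 f2 where "f1 = (\<lambda>z. (of_real (2 + m) * of_real (norm (F z) powr p) + of_real (p * Re (W z))) * z ^ m)"
    and "f2 = (\<lambda>z. (\<i> * of_nat m * of_real (norm (F z) powr p) - of_real (p * Im (W z))) * z ^ m)"
  have c1: "continuous_on (ball 0 1) f1" and c2: "continuous_on (ball 0 1) f2"
    unfolding f1_def f2_def by (intro continuous_intros W_cont norm_powr_F_cont)+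
  note i1 = set_integrable_ball_continuous[OF c1 \<rho>(2)] and i2 = set_integrable_ball_continuous[OF c2 \<rho>(2)]
  have 1: "(LINT z:ball 0 \<rho>|lborel. f1 z)
     = (LINT t:{0..2*pi}|lborel. of_real (\<rho>\<^sup>2 * norm (F (of_real \<rho> * cis t)) powr p) * (of_real \<rho> * cis t) ^ m)"
  proof -
    have "(LINT r:{0..<\<rho>}|lborel. r *\<^sub>R f1 (of_real r * cis t))
      = of_real (\<rho>\<^sup>2 * norm (F (of_real \<rho> * cis t)) powr p) * (of_real \<rho> * cis t) ^ m
        - of_real (0\<^sup>2 * norm (F (of_real 0 * cis t)) powr p) * (of_real 0 * cis t) ^ m" for t
    proof (rule set_integral_Ico_FTC(1))
      show "((\<lambda>r. of_real (r\<^sup>2 * norm (F (of_real r * cis t)) powr p) * (of_real r * cis t) ^ m) has_vector_derivative r *\<^sub>R f1 (of_real r * cis t)) (at r within {0..\<rho>})"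
        if "0 \<le> r" "r \<le> \<rho>" for r
        using radial_part[of r t m "{0..\<rho>}"] that \<rho> by (simp add: f1_def Let_def)
    qed (use \<rho> disc_ray_cont[OF c1] in auto)
    then show ?thesis unfolding polar_iterated(3)[OF i1] by simp
  qed
  have 2: "(LINT z:ball 0 \<rho>|lborel. f2 z) = 0"
  proof -
    have "(LINT t:{0..2*pi}|lborel. r *\<^sub>R f2 (of_real r * cis t)) = 0" if r: "r \<in> {0..<\<rho>}" for r
    proof -
      have "(LINT t:{0..2*pi}|lborel. f2 (of_real r * cis t))
        = of_real (norm (F (of_real r * cis (2*pi))) powr p) * (of_real r * cis (2*pi)) ^ m
         - of_real (norm (F (of_real r * cis 0)) powr p) * (of_real r * cis 0) ^ m"
      proof (rule set_integral_Ico_FTC(2))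
        show "((\<lambda>t. of_real (norm (F (of_real r * cis t)) powr p) * (of_real r * cis t) ^ m) has_vector_derivative f2 (of_real r * cis t)) (at t within {0..2*pi})"
          for t using angular_part[of r m t "{0..2*pi}"] r \<rho> by (simp add: f2_def Let_def)
      qed (use r \<rho> disc_circle_cont[OF c2] in auto)
      then show ?thesis by simp
    qed
    then have z: "(\<lambda>r. indicator {0..<\<rho>} r *\<^sub>R (LINT t:{0..2*pi}|lborel. r *\<^sub>R f2 (of_real r * cis t))) = (\<lambda>r. 0)"
      by (auto simp: indicator_def)
    show ?thesis unfolding polar_iterated(4)[OF i2] set_lebesgue_integral_def[of _ "{0..<\<rho>}"] z by simp
  qed
  \<comment> \<open>The real and imaginary parts of W recombine, and the two contributions of z^m
    add up: 2 + m from f1 and m from f2.\<close>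
  have "(of_nat (2 + 2 * m) * of_real (norm (F z) powr p) + of_real p * W z) * z ^ m = f1 z - \<i> * f2 z" for z
  proof -
    have "W z = of_real (Re (W z)) + \<i> * of_real (Im (W z))" by (rule complex_eq)
    then have "of_real p * W z = of_real (p * Re (W z)) + \<i> * of_real (p * Im (W z))"
      by (metis distrib_left mult.left_commute of_real_mult)
    then show ?thesis unfolding f1_def f2_def by (simp add: algebra_simps)
  qed
  then have "(LINT z:ball 0 \<rho>|lborel. (of_nat (2 + 2 * m) * of_real (norm (F z) powr p) + of_real p * W z) * z ^ m)
     = (LINT z:ball 0 \<rho>|lborel. f1 z - \<i> * f2 z)" by simp
  also have "\<dots> = (LINT z:ball 0 \<rho>|lborel. f1 z) - \<i> * (LINT z:ball 0 \<rho>|lborel. f2 z)"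
    using i1 i2 by (subst set_integral_diff) auto
  finally show ?thesis by (simp add: 1 2)
qed

lemma norm_W: "norm (W z) = weight z"
  by (simp add: W_def weight_def norm_mult norm_rpow)

lemma powr_mult_power_integrable:
  "integrable area (\<lambda>z. of_real (norm (F z) powr p) * z ^ m)" for m :: nat
proof (rule integrable_disc_bound[OF F_powr_int])
  show "norm (of_real (norm (F z) powr p) * z ^ m) \<le> norm (F z) powr p" if "z \<in> ball 0 1" for z :: complex
    using that by (auto simp: norm_mult norm_power intro!: mult_left_le power_le_one)
qed (intro continuous_on_measurable_disc continuous_intros norm_powr_F_cont)

lemma W_mult_power_integrable:
  "integrable area (\<lambda>z. W z * z ^ m)" for m :: nat
proof (rule integrable_disc_bound[OF weight_int])
  show "norm (W z * z ^ m) \<le> weight z" if "z \<in> ball 0 1" for z :: complex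
    using that weight_nonneg[of z] by (auto simp: norm_mult norm_W norm_power intro!: mult_left_le power_le_one)
qed (intro continuous_on_measurable_disc continuous_intros W_cont)

text \<open>Dominated convergence with majorant B (1 + \<open>ray_bound\<close>). It is stated for
  general G because it is applied both to |w|^p z^m and to w times mixed powers of z.\<close>

lemma boundary_integral_tendsto:
  fixes G :: "complex \<Rightarrow> complex \<Rightarrow> complex"
  assumes G: "continuous_on UNIV (\<lambda>(w, z). G w z)"
    and le: "\<And>w z. norm z \<le> 1 \<Longrightarrow> norm (G w z) \<le> B * (1 + norm w powr p)" and B: "B \<ge> 0"
  shows "set_integrable lborel {0..2*pi} (\<lambda>t. G (boundary_val F t) (cis t))"
    and "(\<lambda>n. LINT t:{0..2*pi}|lborel. G (F (of_real (rho_seq n) * cis t)) (of_real (rho_seq n) * cis t))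
      \<longlonglongrightarrow> (LINT t:{0..2*pi}|lborel. G (boundary_val F t) (cis t))"
proof -
  define s where "s = (\<lambda>n t. indicator {0..2*pi} t *\<^sub>R G (F (of_real (rho_seq n) * cis t)) (of_real (rho_seq n) * cis t))"
  define l where "l = (\<lambda>t. indicator {0..2*pi} t *\<^sub>R G (boundary_val F t) (cis t))"
  define w where "w = (\<lambda>t. indicator {0..2*pi} t *\<^sub>R (B * (1 + ray_bound t)))"
  have w: "integrable lborel w"
  proof -
    have "set_integrable lborel {0..2*pi} (\<lambda>t. B * (1 + ray_bound t))"
      by (intro set_integrable_mult_right set_integral_add ray_bound_int set_integrable_continuous_Icc continuous_on_const)
    then show ?thesis by (simp add: set_integrable_def w_def)
  qed
  have Gm: "(\<lambda>t. G (f t) (g t)) \<in> borel_measurable borel" 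
    if [measurable]: "f \<in> borel_measurable borel" "g \<in> borel_measurable borel" for f g :: "real \<Rightarrow> complex"
  proof -
    have "(\<lambda>(w, z). G w z) \<in> borel_measurable borel" by (rule borel_measurable_continuous_onI[OF G])
    moreover have "(\<lambda>t. (f t, g t)) \<in> borel_measurable borel" by measurable
    ultimately have "(\<lambda>t. (\<lambda>(w, z). G w z) (f t, g t)) \<in> borel_measurable borel"
      by (rule measurable_compose[rotated])
    then show ?thesis by simp
  qed
  have sm: "s n \<in> borel_measurable lborel" for n
  proof -
    have "(\<lambda>t. F (of_real (rho_seq n) * cis t)) \<in> borel_measurable borel"
      using rho_seq[of n] by (intro borel_measurable_continuous_onI F_circle_continuous) auto
    from Gm[OF this, of "\<lambda>t. of_real (rho_seq n) * cis t"] show ?thesis unfolding s_def by simp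
  qed
  have lm: "l \<in> borel_measurable lborel"
    using Gm[OF boundary_val_measurable, of cis] unfolding l_def by simp
  have lim: "AE t in lborel. (\<lambda>n. s n t) \<longlonglongrightarrow> l t"
    using AE_good_ray
  proof eventually_elim
    case (elim t)
    show ?case
    proof (cases "t \<in> {0..2*pi}")
      case True
      then have "((\<lambda>r. F (of_real r * cis t)) \<longlongrightarrow> boundary_val F t) (at_left 1)"
        using elim by (intro good_ray_boundary_val) auto
      then have a: "(\<lambda>n. F (of_real (rho_seq n) * cis t)) \<longlonglongrightarrow> boundary_val F t"
        by (rule filterlim_compose[OF _ rho_seq_at_left])
      have b: "(\<lambda>n. of_real (rho_seq n) * cis t) \<longlonglongrightarrow> of_real 1 * cis t"
        by (intro tendsto_intros rho_seq_tendsto)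
      have "isCont (\<lambda>(w, z). G w z) (boundary_val F t, of_real 1 * cis t)"
        using G by (simp add: continuous_on_eq_continuous_at)
      from isCont_tendsto_compose[OF this tendsto_Pair[OF a b]]
      have "(\<lambda>n. G (F (of_real (rho_seq n) * cis t)) (of_real (rho_seq n) * cis t)) \<longlonglongrightarrow> G (boundary_val F t) (cis t)"
        by simp
      then show ?thesis unfolding s_def l_def by (intro tendsto_intros)
    qed (simp add: s_def l_def)
  qed
  have bound: "AE t in lborel. norm (s n t) \<le> w t" for n
    using AE_good_ray
  proof eventually_elim
    case (elim t)
    show ?case
    proof (cases "t \<in> {0..2*pi}")
      case True
      have "norm (s n t) \<le> B * (1 + norm (F (of_real (rho_seq n) * cis t)) powr p)"
        unfolding s_def using True rho_seq[of n] by (simp, intro le) (auto simp: norm_mult)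
      also have "\<dots> \<le> B * (1 + ray_bound t)"
        using B True elim rho_seq[of n] by (intro mult_left_mono add_left_mono good_ray_le) auto
      finally show ?thesis using True by (simp add: w_def)
    qed (simp add: s_def w_def)
  qed
  show "set_integrable lborel {0..2*pi} (\<lambda>t. G (boundary_val F t) (cis t))"
    using integrable_dominated_convergence[OF lm sm w lim bound] by (simp add: set_integrable_def l_def)
  show "(\<lambda>n. LINT t:{0..2*pi}|lborel. G (F (of_real (rho_seq n) * cis t)) (of_real (rho_seq n) * cis t))
      \<longlonglongrightarrow> (LINT t:{0..2*pi}|lborel. G (boundary_val F t) (cis t))"
    using integral_dominated_convergence[OF lm sm w lim bound] by (simp add: set_lebesgue_integral_def s_def l_def)
qed

text \<open>The formula on discs of radius \<open>rho_seq n\<close> passes to the limit: the area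
  integrals because |F|^p and \<open>weight\<close> are integrable, the circle integrals by
  \<open>boundary_integral_tendsto\<close>.\<close>

lemma Green:
  fixes m :: nat
  shows "set_integrable lborel {0..2*pi} (\<lambda>t. of_real (norm (boundary_val F t) powr p) * cis t ^ m)"
    and "(LINT t:{0..2*pi}|lborel. of_real (norm (boundary_val F t) powr p) * cis t ^ m)
     = of_nat (2 + 2 * m) * (LINT z|area. of_real (norm (F z) powr p) * z ^ m)
       + of_real p * (LINT z|area. W z * z ^ m)"
proof -
  define G :: "complex \<Rightarrow> complex \<Rightarrow> complex" where "G = (\<lambda>w z. of_real (norm w powr p) * z ^ m)"
  have "continuous_on UNIV (\<lambda>x. G (fst x) (snd x))"
    unfolding G_def using p by (intro continuous_intros continuous_on_powr') auto
  then have Gc: "continuous_on UNIV (\<lambda>(w, z). G w z)" by (simp add: case_prod_unfold)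
  have Gle: "norm (G w z) \<le> 1 * (1 + norm w powr p)" if "norm z \<le> 1" for w z
  proof -
    have "norm (G w z) \<le> norm w powr p * 1"
      unfolding G_def norm_mult using that by (intro mult_mono) (auto simp: norm_power power_le_one)
    then show ?thesis by simp
  qed
  note lim = boundary_integral_tendsto[OF Gc Gle, simplified]
  show "set_integrable lborel {0..2*pi} (\<lambda>t. of_real (norm (boundary_val F t) powr p) * cis t ^ m)"
    using lim(1) by (simp add: G_def)
  define f where "f = (\<lambda>z. (of_nat (2 + 2 * m) * of_real (norm (F z) powr p) + of_real p * W z) * z ^ m)"
  have f_eq: "f z = of_nat (2 + 2 * m) * (of_real (norm (F z) powr p) * z ^ m) + of_real p * (W z * z ^ m)" for z
    by (simp add: f_def algebra_simps)
  have fint: "integrable area f" unfolding f_eq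
    by (intro Bochner_Integration.integrable_add integrable_mult_right powr_mult_power_integrable W_mult_power_integrable)
  have "(\<lambda>n. complex_of_real ((rho_seq n)\<^sup>2) * (LINT t:{0..2*pi}|lborel. G (F (of_real (rho_seq n) * cis t)) (of_real (rho_seq n) * cis t)))
     \<longlonglongrightarrow> of_real (1\<^sup>2) * (LINT t:{0..2*pi}|lborel. G (boundary_val F t) (cis t))"
    using boundary_integral_tendsto(2)[OF Gc Gle]     by (intro tendsto_intros rho_seq_tendsto) auto
  moreover have "complex_of_real ((rho_seq n)\<^sup>2) * (LINT t:{0..2*pi}|lborel. G (F (of_real (rho_seq n) * cis t)) (of_real (rho_seq n) * cis t))
    = (LINT z:ball 0 (rho_seq n)|lborel. f z)" for n
    unfolding f_def using rho_seq[of n]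
    by (subst Green_smaller_disc) (auto simp: G_def mult.assoc simp flip: set_integral_mult_right)
  ultimately have "(\<lambda>n. LINT z:ball 0 (rho_seq n)|lborel. f z) \<longlonglongrightarrow> (LINT t:{0..2*pi}|lborel. G (boundary_val F t) (cis t))"
    by simp
  moreover have "(\<lambda>n. LINT z:ball 0 (rho_seq n)|lborel. f z) \<longlonglongrightarrow> integral\<^sup>L area f"
    by (rule set_integral_ball_tendsto[OF fint])
  ultimately have "(LINT t:{0..2*pi}|lborel. G (boundary_val F t) (cis t)) = integral\<^sup>L area f"
    by (rule LIMSEQ_unique)
  also have "\<dots> = of_nat (2 + 2 * m) * (LINT z|area. of_real (norm (F z) powr p) * z ^ m)
       + of_real p * (LINT z|area. W z * z ^ m)"
    unfolding f_eq using powr_mult_power_integrable W_mult_power_integrable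
    by (subst Bochner_Integration.integral_add) (auto intro!: integrable_mult_right simp del: of_nat_add)
  finally show "(LINT t:{0..2*pi}|lborel. of_real (norm (boundary_val F t) powr p) * cis t ^ m)
     = of_nat (2 + 2 * m) * (LINT z|area. of_real (norm (F z) powr p) * z ^ m)
       + of_real p * (LINT z|area. W z * z ^ m)"
    by (simp only: G_def)
qed

end

section \<open>Boundary moments\<close>

text \<open>By Cauchy's formula c is 2 pi times the j-th Taylor coefficient of g; only its
  independence of r is exported.\<close>

lemma circle_coefficient:
  assumes g: "g holomorphic_on ball 0 1"
  obtains c where "\<And>r. 0 < r \<Longrightarrow> r < 1 \<Longrightarrow>
    (LINT t:{0..2*pi}|lborel. g (of_real r * cis t) * cnj (cis t ^ j)) = c * of_real (r ^ j)"
proof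
  fix r :: real assume r: "0 < r" "r < 1"
  define d where "d = (deriv ^^ j) g 0 / fact j"
  have sub: "cball 0 r \<subseteq> ball (0::complex) 1" using r by auto
  have "continuous_on (cball 0 r) g" "g holomorphic_on ball 0 r"
    using sub by (auto intro!: continuous_on_subset[OF holomorphic_on_imp_continuous_on[OF g]] holomorphic_on_subset[OF g])
  from Cauchy_has_contour_integral_higher_derivative_circlepath[OF this, of 0 j]
  have "((\<lambda>u. g u / (u - 0) ^ Suc j) has_contour_integral (2 * of_real pi * \<i> / fact j * (deriv ^^ j) g 0)) (circlepath 0 r)"
    using r by simp
  then have "((\<lambda>t. g (0 + of_real r * cis t) / (0 + of_real r * cis t - 0) ^ Suc j * of_real r * \<i> * cis t)
      has_integral (2 * of_real pi * \<i> / fact j * (deriv ^^ j) g 0)) {0..2*pi}"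
    unfolding circlepath_def by (subst (asm) has_contour_integral_part_circlepath_iff) auto
  from has_integral_mult_right[OF this, of "of_real (r ^ j) / \<i>"]
  have "((\<lambda>t. of_real (r ^ j) / \<i> * (g (0 + of_real r * cis t) / (0 + of_real r * cis t - 0) ^ Suc j * of_real r * \<i> * cis t))
      has_integral (of_real (r ^ j) / \<i> * (2 * of_real pi * \<i> / fact j * (deriv ^^ j) g 0))) {0..2*pi}" .
  also have "(\<lambda>t. of_real (r ^ j) / \<i> * (g (0 + of_real r * cis t) / (0 + of_real r * cis t - 0) ^ Suc j * of_real r * \<i> * cis t))
     = (\<lambda>t. g (of_real r * cis t) * cnj (cis t ^ j))"
  proof
    fix t
    have "cnj (cis t ^ j) = 1 / cis t ^ j"
      by (simp add: cis_cnj divide_inverse power_inverse flip: cis_inverse)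
    then show "of_real (r ^ j) / \<i> * (g (0 + of_real r * cis t) / (0 + of_real r * cis t - 0) ^ Suc j * of_real r * \<i> * cis t)
        = g (of_real r * cis t) * cnj (cis t ^ j)"
      using r by (simp add: field_simps)
  qed
  finally have hi: "((\<lambda>t. g (of_real r * cis t) * cnj (cis t ^ j)) has_integral (2 * of_real pi * d * of_real (r ^ j))) {0..2*pi}"
    by (simp add: d_def field_simps)
  have c: "continuous_on {0..2*pi} (\<lambda>t. g (of_real r * cis t) * cnj (cis t ^ j))"
  proof (intro continuous_intros continuous_on_compose2[OF holomorphic_on_imp_continuous_on[OF g]])
    show "(\<lambda>t. complex_of_real r * cis t) ` {0..2*pi} \<subseteq> ball 0 1" using r by (auto simp: norm_mult)
  qed
  have "set_integrable lborel {0..2*pi} (\<lambda>t. g (of_real r * cis t) * cnj (cis t ^ j))"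
    using borel_integrable_atLeastAtMost'[OF c] by simp
  from set_borel_integral_eq_integral(2)[OF this]
  show "(LINT t:{0..2*pi}|lborel. g (of_real r * cis t) * cnj (cis t ^ j)) = 2 * of_real pi * ((deriv ^^ j) g 0 / fact j) * of_real (r ^ j)"
    using hi by (simp add: integral_unique d_def)
qed

text \<open>Integrating t^j over [0,1] gives 1/(j+1); this form holds at z = 0 as well.\<close>

lemma Kfun_eq: "Kfun k z = (\<Sum>j\<le>degree k. coeff k j / of_nat (Suc j) * z ^ j)"
proof -
  define G where "G = (\<lambda>t. (\<Sum>j\<le>degree k. coeff k j / of_nat (Suc j) * z ^ j * of_real (t ^ Suc j)))"
  have "Kfun k z = (LINT t:{0..1}|lborel. poly k (of_real t * z))"
    unfolding Kfun_def zero_ereal_def one_ereal_def by (subst interval_integral_Icc) auto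
  also have "\<dots> = G 1 - G 0"
  proof (rule set_integral_Ico_FTC(2))
    fix t :: real
    have "((\<lambda>t. coeff k j / of_nat (Suc j) * z ^ j * of_real (t ^ Suc j)) has_vector_derivative
       (coeff k j / of_nat (Suc j) * z ^ j * of_real (real (Suc j) * t ^ j))) (at t within {0..1})" for j
      by (intro has_vector_derivative_mult_right has_vector_derivative_of_real)
         (auto intro!: derivative_eq_intros simp del: of_nat_Suc power_Suc)
    then have "(G has_vector_derivative (\<Sum>j\<le>degree k. coeff k j / of_nat (Suc j) * z ^ j * of_real (real (Suc j) * t ^ j))) (at t within {0..1})"
      unfolding G_def by (intro has_vector_derivative_sum) auto
    also have "(\<Sum>j\<le>degree k. coeff k j / of_nat (Suc j) * z ^ j * of_real (real (Suc j) * t ^ j)) = poly k (of_real t * z)"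
      unfolding poly_altdef
      by (intro sum.cong) (simp_all add: power_mult_distrib del: of_nat_Suc)
    finally show "(G has_vector_derivative poly k (of_real t * z)) (at t within {0..1})" .
  qed (auto intro!: continuous_intros)
  finally show ?thesis by (simp add: G_def)
qed

lemma poly_pderiv_pCons_0:
  "poly (pderiv (pCons 0 h)) z = (\<Sum>m\<le>degree h. of_nat (Suc m) * coeff h m * z ^ m)" for z :: complex
proof -
  have d: "degree (pderiv (pCons 0 h)) \<le> degree h"
    using degree_pderiv[of "pCons 0 h"] degree_pCons_le[of 0 h] by simp
  have "poly (pderiv (pCons 0 h)) z = (\<Sum>m\<le>degree (pderiv (pCons 0 h)). coeff (pderiv (pCons 0 h)) m * z ^ m)"
    by (rule poly_altdef)
  also have "\<dots> = (\<Sum>m\<le>degree h. coeff (pderiv (pCons 0 h)) m * z ^ m)"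
    using d by (intro sum.mono_neutral_left) (auto intro: coeff_eq_0)
  finally show ?thesis by (simp add: coeff_pderiv del: of_nat_Suc)
qed

lemma set_integrable_sum:
  fixes f :: "'i \<Rightarrow> 'a \<Rightarrow> 'b::{banach, second_countable_topology}"
  assumes "\<And>i. i \<in> I \<Longrightarrow> set_integrable M A (f i)"
  shows "set_integrable M A (\<lambda>x. \<Sum>i\<in>I. f i x)"
    and "(LINT x:A|M. \<Sum>i\<in>I. f i x) = (\<Sum>i\<in>I. LINT x:A|M. f i x)"
  using assms unfolding set_integrable_def set_lebesgue_integral_def scaleR_sum_right
  by (auto intro: Bochner_Integration.integral_sum)

lemma moment_cmult: "moment j (\<lambda>z. c * f z) = c * moment j f"
  by (simp add: moment_def mult.assoc)

section \<open>Moments of z^m F on the disc and on the circle\<close>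

context bergman_extremal
begin

definition mixed_moment :: "nat \<Rightarrow> nat \<Rightarrow> complex" where
  "mixed_moment m j = moment j (\<lambda>z. z ^ m * F z)"

lemma power_mult_F_Bergman: "in_Bergman p (\<lambda>z. z ^ m * F z)"
  using in_Bergman_poly_mult[OF _ F_Bergman, of "monom 1 m"] p by (simp add: poly_monom)

lemma power_mult_F_int: "integrable area (\<lambda>z. z ^ m * F z)"
  using in_Bergman_integrable[OF _ power_mult_F_Bergman] p by simp

text \<open>Since |F|^p z^m is the conjugated duality map times z^m F, this is the variational
  identity with test function z^m F.\<close>

lemma powr_mult_power_integral:
  "(LINT z|area. of_real (norm (F z) powr p) * z ^ m)
    = 1 / of_real N * (\<Sum>j\<le>degree k. cnj (coeff k j) * mixed_moment m j)"
proof -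
  have "(LINT z|area. of_real (norm (F z) powr p) * z ^ m)
     = (LINT z|area. cnj (rpow (p - 2) (F z)) * (z ^ m * F z))"
    by (simp add: rpow_mult_cnj[symmetric] mult_ac)
  also have "\<dots> = 1 / of_real N * (\<Sum>j\<le>degree k. cnj (coeff k j) * mixed_moment m j)"
    unfolding variational[OF power_mult_F_Bergman] kernel_functional_moments[OF power_mult_F_int]
    by (simp add: mixed_moment_def)
  finally show ?thesis .
qed

text \<open>The variational identity for z^m F_s is differentiated at s = 0. On the right each
  moment carries the phase e^(i(j-m)s), whose derivative is i(j - m); the left side converges to i
  times the integral by \<open>rotation_quotient_limit\<close>.\<close>

lemma W_mult_power_integral:
  "(LINT z|area. W z * z ^ m)
    = 1 / of_real N * (\<Sum>j\<le>degree k. cnj (coeff k j) * mixed_moment m j * (of_nat j - of_nat m))"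
proof -
  define t where "t = (\<lambda>n. 1 / real (Suc n))"
  have t0: "t n \<noteq> 0" for n by (simp add: t_def)
  have tlim: "t \<longlonglongrightarrow> 0" unfolding t_def by (rule inverse_Suc_tendsto_0)
  define G where "G = (\<lambda>z. cnj (rpow (p - 2) (F z)) * z ^ m)"
  have lim1: "(\<lambda>n. LINT z|area. G z * ((Frot (t n) z - F z) / of_real (t n)))
     \<longlonglongrightarrow> (LINT z|area. G z * (\<i> * z * deriv F z))"
    using rotation_quotient_limit[of "monom 1 m"] by (simp add: G_def t_def poly_monom)
  have rotB: "in_Bergman p (\<lambda>z. z ^ m * Frot s z)" for s
    using in_Bergman_poly_mult[OF _ Frot_Bergman, of "monom 1 m"] p by (simp add: poly_monom)
  \<comment> \<open>Only F is rotated here. Rotating z^m F as a whole contributes e^(ijs), and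
    undoing the rotation of z^m contributes e^(-ims).\<close>
  have mom: "moment j (\<lambda>z. z ^ m * Frot s z) = cis ((real j - real m) * s) * mixed_moment m j" for j s
  proof -
    have "cis (- (real m * s)) * cis s ^ m = 1"
      unfolding Complex.DeMoivre by (simp add: cis_mult)
    then have "z ^ m * Frot s z = cis (- (real m * s)) * ((cis s * z) ^ m * F (cis s * z))" for z
      by (simp add: power_mult_distrib mult.assoc[symmetric])
    then have "moment j (\<lambda>z. z ^ m * Frot s z) = cis (- (real m * s)) * moment j (\<lambda>z. (cis s * z) ^ m * F (cis s * z))"
      by (simp only: moment_cmult)
    also have "moment j (\<lambda>z. (cis s * z) ^ m * F (cis s * z)) = cis (real j * s) * mixed_moment m j"
      unfolding mixed_moment_def by (rule moment_rotate[OF power_mult_F_int])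
    also have "cis (- (real m * s)) * (cis (real j * s) * mixed_moment m j)
       = (cis (- (real m * s)) * cis (real j * s)) * mixed_moment m j"
      by (rule mult.assoc[symmetric])
    also have "cis (- (real m * s)) * cis (real j * s) = cis ((real j - real m) * s)"
      by (simp add: cis_mult algebra_simps)
    finally show ?thesis .
  qed
  have eq: "(LINT z|area. G z * ((Frot s z - F z) / of_real s))
     = 1 / of_real N * (\<Sum>j\<le>degree k. cnj (coeff k j) * mixed_moment m j * ((cis ((real j - real m) * s) - 1) / of_real s))"
    if s: "s \<noteq> 0" for s
  proof -
    have G_eq: "G z * ((Frot s z - F z) / of_real s)
      = 1 / of_real s * (cnj (rpow (p - 2) (F z)) * (z ^ m * Frot s z) - cnj (rpow (p - 2) (F z)) * (z ^ m * F z))" for z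
      by (simp add: G_def diff_divide_distrib algebra_simps)
    have "(LINT z|area. G z * ((Frot s z - F z) / of_real s))
       = 1 / of_real s * (of_real (pi / N) * kernel_functional k (\<lambda>z. z ^ m * Frot s z) - of_real (pi / N) * kernel_functional k (\<lambda>z. z ^ m * F z))"
      unfolding G_eq using integrable_rpow_mult[OF p F_Bergman rotB] integrable_rpow_mult[OF p F_Bergman power_mult_F_Bergman]
      by (simp add: variational[OF rotB] variational[OF power_mult_F_Bergman])
    also have "kernel_functional k (\<lambda>z. z ^ m * Frot s z) = 1 / of_real pi * (\<Sum>j\<le>degree k. cnj (coeff k j) * (cis ((real j - real m) * s) * mixed_moment m j))"
      using in_Bergman_integrable[OF _ rotB] p by (subst kernel_functional_moments) (auto simp: mom)
    also have "kernel_functional k (\<lambda>z. z ^ m * F z) = 1 / of_real pi * (\<Sum>j\<le>degree k. cnj (coeff k j) * mixed_moment m j)"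
      unfolding kernel_functional_moments[OF power_mult_F_int] by (simp add: mixed_moment_def)
    also have "1 / of_real s * (of_real (pi / N) * (1 / of_real pi * (\<Sum>j\<le>degree k. cnj (coeff k j) * (cis ((real j - real m) * s) * mixed_moment m j)))
         - of_real (pi / N) * (1 / of_real pi * (\<Sum>j\<le>degree k. cnj (coeff k j) * mixed_moment m j)))
      = 1 / of_real N * (1 / of_real s * ((\<Sum>j\<le>degree k. cnj (coeff k j) * (cis ((real j - real m) * s) * mixed_moment m j)) - (\<Sum>j\<le>degree k. cnj (coeff k j) * mixed_moment m j)))"
      by (simp add: algebra_simps)
    also have "1 / of_real s * ((\<Sum>j\<le>degree k. cnj (coeff k j) * (cis ((real j - real m) * s) * mixed_moment m j)) - (\<Sum>j\<le>degree k. cnj (coeff k j) * mixed_moment m j))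
      = (\<Sum>j\<le>degree k. cnj (coeff k j) * mixed_moment m j * ((cis ((real j - real m) * s) - 1) / of_real s))"
      unfolding sum_subtractf[symmetric] sum_distrib_left
      by (intro sum.cong) (auto simp: diff_divide_distrib algebra_simps)
    finally show ?thesis .
  qed
  have cis_lim: "(\<lambda>n. (cis (a * t n) - 1) / of_real (t n)) \<longlonglongrightarrow> \<i> * of_real a" for a :: real
  proof -
    have "((\<lambda>h. exp (\<i> * of_real a * h)) has_field_derivative (\<i> * of_real a)) (at 0)"
      by (auto intro!: derivative_eq_intros)
    from DERIV_D[OF this]
    have "((\<lambda>h. (exp (\<i> * of_real a * h) - 1) / h) \<longlongrightarrow> \<i> * of_real a) (at 0)" by simp
    moreover have "filterlim (\<lambda>n. complex_of_real (t n)) (at 0) sequentially"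
      using t0 tendsto_of_real[OF tlim, where 'a = complex] by (simp add: filterlim_at)
    ultimately have "(\<lambda>n. (exp (\<i> * of_real a * of_real (t n)) - 1) / of_real (t n)) \<longlonglongrightarrow> \<i> * of_real a"
      by (rule filterlim_compose)
    then show ?thesis by (simp add: cis_conv_exp mult.assoc)
  qed
  have lim2: "(\<lambda>n. LINT z|area. G z * ((Frot (t n) z - F z) / of_real (t n)))
     \<longlonglongrightarrow> 1 / of_real N * (\<Sum>j\<le>degree k. cnj (coeff k j) * mixed_moment m j * (\<i> * of_real (real j - real m)))"
    unfolding eq[OF t0] by (intro tendsto_intros cis_lim)
  have "(LINT z|area. G z * (\<i> * z * deriv F z))
    = 1 / of_real N * (\<Sum>j\<le>degree k. cnj (coeff k j) * mixed_moment m j * (\<i> * of_real (real j - real m)))"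
    by (rule LIMSEQ_unique[OF lim1 lim2])
  also have "(LINT z|area. G z * (\<i> * z * deriv F z)) = \<i> * (LINT z|area. W z * z ^ m)"
    by (simp add: G_def W_def mult_ac flip: integral_mult_right_zero)
  also have "1 / of_real N * (\<Sum>j\<le>degree k. cnj (coeff k j) * mixed_moment m j * (\<i> * of_real (real j - real m)))
     = \<i> * (1 / of_real N * (\<Sum>j\<le>degree k. cnj (coeff k j) * mixed_moment m j * (of_nat j - of_nat m)))"
    by (simp add: sum_distrib_left mult_ac)
  finally show ?thesis by (rule mult_left_cancel[OF complex_i_not_zero, THEN iffD1])
qed

text \<open>On the circle of radius r the integral is c r^(2j), so the boundary value is c, whereas
  the disc moment is the integral of c r^(2j+1) over [0,1], that is c/(2j+2).\<close>

lemma boundary_moment: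
  fixes m j :: nat
  shows "set_integrable lborel {0..2*pi} (\<lambda>t. boundary_val F t * (cis t ^ m * cnj (cis t ^ j)))"
    and "(LINT t:{0..2*pi}|lborel. boundary_val F t * (cis t ^ m * cnj (cis t ^ j)))
      = of_nat (2 * j + 2) * mixed_moment m j"
proof -
  define G where "G = (\<lambda>w z :: complex. w * (z ^ m * cnj (z ^ j)))"
  have "continuous_on UNIV (\<lambda>x. G (fst x) (snd x))"
    unfolding G_def by (intro continuous_intros)
  then have Gc: "continuous_on UNIV (\<lambda>(w, z). G w z)" by (simp add: case_prod_unfold)
  have Gle: "norm (G w z) \<le> 1 * (1 + norm w powr p)" if "norm z \<le> 1" for w z
  proof -
    have "norm (z ^ m * cnj (z ^ j)) \<le> 1"
      using that by (auto simp: norm_mult norm_power intro!: mult_le_one power_le_one)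
    then have "norm (G w z) \<le> norm w * 1"
      unfolding G_def norm_mult[of w] by (intro mult_left_mono) auto
    also have "norm w \<le> 1 + norm w powr p" using p by (intro le_one_plus_powr) auto
    finally show ?thesis by simp
  qed
  show "set_integrable lborel {0..2*pi} (\<lambda>t. boundary_val F t * (cis t ^ m * cnj (cis t ^ j)))"
    using boundary_integral_tendsto(1)[OF Gc Gle] by (simp add: G_def)
  define g where "g = (\<lambda>z. z ^ m * F z)"
  have ghol: "g holomorphic_on ball 0 1" unfolding g_def by (intro holomorphic_intros F_hol)
  obtain c where c: "\<And>r. 0 < r \<Longrightarrow> r < 1 \<Longrightarrow>
    (LINT t:{0..2*pi}|lborel. g (of_real r * cis t) * cnj (cis t ^ j)) = c * of_real (r ^ j)"
    using circle_coefficient[OF ghol, of j] by blast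
  have "(\<lambda>n. LINT t:{0..2*pi}|lborel. G (F (of_real (rho_seq n) * cis t)) (of_real (rho_seq n) * cis t)) \<longlonglongrightarrow> (LINT t:{0..2*pi}|lborel. G (boundary_val F t) (cis t))"
    using boundary_integral_tendsto(2)[OF Gc Gle] by simp
  moreover have "(LINT t:{0..2*pi}|lborel. G (F (of_real r * cis t)) (of_real r * cis t)) = c * of_real (r ^ (2 * j))" if r: "0 < r" "r < 1" for r
  proof -
    have "G (F (of_real r * cis t)) (of_real r * cis t) = of_real (r ^ j) * (g (of_real r * cis t) * cnj (cis t ^ j))" for t
      by (simp add: G_def g_def power_mult_distrib mult_ac)
    then have "(LINT t:{0..2*pi}|lborel. G (F (of_real r * cis t)) (of_real r * cis t))
      = (LINT t:{0..2*pi}|lborel. of_real (r ^ j) * (g (of_real r * cis t) * cnj (cis t ^ j)))"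
      by (simp only:)
    also have "\<dots> = of_real (r ^ j) * (LINT t:{0..2*pi}|lborel. g (of_real r * cis t) * cnj (cis t ^ j))"
      by (rule set_integral_mult_right)
    also have "\<dots> = c * of_real (r ^ (2 * j))"
      unfolding c[OF r] by (simp add: mult_2 power_add)
    finally show ?thesis .
  qed
  ultimately have "(\<lambda>n. c * of_real (rho_seq n ^ (2 * j))) \<longlonglongrightarrow> (LINT t:{0..2*pi}|lborel. G (boundary_val F t) (cis t))"
    using rho_seq by (simp add: less_le_trans[OF _ rho_seq(1)])
  moreover have "(\<lambda>n. c * of_real (rho_seq n ^ (2 * j))) \<longlonglongrightarrow> c * of_real (1 ^ (2 * j))"
    by (intro tendsto_intros rho_seq_tendsto)
  ultimately have bc: "(LINT t:{0..2*pi}|lborel. G (boundary_val F t) (cis t)) = c"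
    using LIMSEQ_unique by fastforce
  have gi: "set_integrable lborel (ball 0 1) (\<lambda>z. g z * cnj (z ^ j))"
    unfolding integrable_disc_iff[symmetric] g_def by (rule integrable_mult_cnj_power[OF power_mult_F_int])
  have inner: "(LINT t:{0..2*pi}|lborel. r *\<^sub>R (g (of_real r * cis t) * cnj ((of_real r * cis t) ^ j))) = c * of_real (r ^ (2 * j + 1))"
    if r: "0 \<le> r" "r < 1" for r
  proof (cases "r = 0")
    case False
    have "r *\<^sub>R (g (of_real r * cis t) * cnj ((of_real r * cis t) ^ j)) = of_real (r ^ Suc j) * (g (of_real r * cis t) * cnj (cis t ^ j))" for t
      by (simp add: scaleR_conv_of_real power_mult_distrib mult_ac)
    then have "(LINT t:{0..2*pi}|lborel. r *\<^sub>R (g (of_real r * cis t) * cnj ((of_real r * cis t) ^ j)))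
      = (LINT t:{0..2*pi}|lborel. of_real (r ^ Suc j) * (g (of_real r * cis t) * cnj (cis t ^ j)))"
      by (simp only:)
    also have "\<dots> = of_real (r ^ Suc j) * (LINT t:{0..2*pi}|lborel. g (of_real r * cis t) * cnj (cis t ^ j))"
      by (rule set_integral_mult_right)
    also have "(LINT t:{0..2*pi}|lborel. g (of_real r * cis t) * cnj (cis t ^ j)) = c * of_real (r ^ j)"
      by (rule c) (use r False in auto)
    also have "of_real (r ^ Suc j) * (c * of_real (r ^ j)) = c * of_real (r ^ (2 * j + 1))"
      by (simp add: mult_2 power_add)
    finally show ?thesis .
  qed simp
  have "moment j g = (LINT z:ball 0 1|lborel. g z * cnj (z ^ j))"
    by (simp add: moment_def integral_disc_eq)
  also have "\<dots> = (LINT r:{0..<1}|lborel. LINT t:{0..2*pi}|lborel. r *\<^sub>R (g (of_real r * cis t) * cnj ((of_real r * cis t) ^ j)))"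
    by (rule polar_iterated(4)[OF gi])
  also have "\<dots> = (LINT r:{0..<1}|lborel. c * of_real (r ^ (2 * j + 1)))"
    by (rule set_lebesgue_integral_cong) (use inner in auto)
  also have "\<dots> = c * of_real (1 ^ (2 * j + 2) / real (2 * j + 2)) - c * of_real (0 ^ (2 * j + 2) / real (2 * j + 2))"
  proof (rule set_integral_Ico_FTC(1))
    fix r :: real
    have "((\<lambda>r. r ^ Suc n / real (Suc n)) has_real_derivative r ^ n) (at r within {0..1})" for n
      by (auto intro!: derivative_eq_intros simp del: of_nat_Suc power_Suc)
    from this[of "2 * j + 1"]
    have "((\<lambda>r. r ^ (2 * j + 2) / real (2 * j + 2)) has_real_derivative r ^ (2 * j + 1)) (at r within {0..1})"
      by simp
    then show "((\<lambda>r. c * of_real (r ^ (2 * j + 2) / real (2 * j + 2))) has_vector_derivative c * of_real (r ^ (2 * j + 1))) (at r within {0..1})"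
      by (intro has_vector_derivative_mult_right has_vector_derivative_of_real)
  qed (auto intro!: continuous_intros)
  also have "\<dots> = c / of_nat (2 * j + 2)" by simp
  finally have "mixed_moment m j = c / of_nat (2 * j + 2)" by (simp add: mixed_moment_def g_def)
  moreover have "of_nat (2 * j + 2) \<noteq> (0 :: complex)" by (simp only: of_nat_eq_0_iff)
  ultimately have "c = of_nat (2 * j + 2) * mixed_moment m j"
    by (metis nonzero_mult_div_cancel_left times_divide_eq_right)
  with bc show "(LINT t:{0..2*pi}|lborel. boundary_val F t * (cis t ^ m * cnj (cis t ^ j)))
      = of_nat (2 * j + 2) * mixed_moment m j"
    by (simp add: G_def)
qed

lemma boundary_power_integral:
  "(LINT t:{0..2*pi}|lborel. of_real (norm (boundary_val F t) powr p) * cis t ^ m)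
    = 1 / of_real N * (\<Sum>j\<le>degree k. cnj (coeff k j) * mixed_moment m j
        * (of_nat (2 + 2 * m) + of_real p * (of_nat j - of_nat m)))"
  unfolding Green(2) powr_mult_power_integral W_mult_power_integral sum_distrib_left sum.distrib[symmetric]
  by (intro sum.cong) (simp_all add: algebra_simps add_divide_distrib)

text \<open>Both sides expand in the moments M(m,j), and the theorem becomes an identity between
  their coefficients.\<close>

lemma boundary_formula:
  fixes h :: "complex poly"
  defines "L \<equiv> (\<lambda>t. of_real (norm (boundary_val F t) powr p) * poly h (cis t))"
  defines "R \<equiv> (\<lambda>t. boundary_val F t *
         (of_real (p/2) * poly h (cis t) * cnj (poly k (cis t)) +
          of_real (1 - p/2) * poly (pderiv (pCons 0 h)) (cis t) * cnj (Kfun k (cis t))))"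
  shows "set_integrable lborel {0..2*pi} L" "set_integrable lborel {0..2*pi} R"
    and "(LINT t:{0..2*pi}|lborel. L t) = 1 / of_real N * (LINT t:{0..2*pi}|lborel. R t)"
proof -
  have L: "L t = (\<Sum>m\<le>degree h. coeff h m * (of_real (norm (boundary_val F t) powr p) * cis t ^ m))" for t
    by (simp add: L_def poly_altdef sum_distrib_left mult_ac)
  \<comment> \<open>In the second summand m + 1 comes from differentiating z h and 1/(j+1) from the
    coefficients of K.\<close>
  define a where "a = (\<lambda>m j. coeff h m * cnj (coeff k j) * (of_real (p/2) + of_real (1 - p/2) * (of_nat (Suc m) / of_nat (Suc j))))"
  have R: "R t = (\<Sum>m\<le>degree h. \<Sum>j\<le>degree k. a m j * (boundary_val F t * (cis t ^ m * cnj (cis t ^ j))))" for t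
  proof -
    let ?b = "boundary_val F t" and ?z = "cis t"
    have 1: "poly h ?z * cnj (poly k ?z) = (\<Sum>m\<le>degree h. \<Sum>j\<le>degree k. (coeff h m * ?z ^ m) * (cnj (coeff k j) * cnj (?z ^ j)))"
      by (simp only: poly_altdef cnj_sum complex_cnj_mult sum_product)
    have 2: "poly (pderiv (pCons 0 h)) ?z * cnj (Kfun k ?z)
      = (\<Sum>m\<le>degree h. \<Sum>j\<le>degree k. (of_nat (Suc m) * coeff h m * ?z ^ m) * (cnj (coeff k j) / of_nat (Suc j) * cnj (?z ^ j)))"
      by (simp only: poly_pderiv_pCons_0 Kfun_eq cnj_sum complex_cnj_mult complex_cnj_divide complex_cnj_of_nat sum_product)
    have "R t = ?b * of_real (p/2) * (poly h ?z * cnj (poly k ?z))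
        + ?b * of_real (1 - p/2) * (poly (pderiv (pCons 0 h)) ?z * cnj (Kfun k ?z))"
      unfolding R_def by (simp only: distrib_left mult.assoc)
    also have "\<dots> = (\<Sum>m\<le>degree h. \<Sum>j\<le>degree k. a m j * (?b * (?z ^ m * cnj (?z ^ j))))"
    proof -
      have "b * P * ((x * y) * (K * w)) + b * Q * ((S * x * y) * (K / T * w)) = x * K * (P + Q * (S / T)) * (b * (y * w))"
        for b P Q S T K w x y :: complex
        unfolding divide_inverse by algebra
      then show ?thesis
        unfolding 1 2 sum_distrib_left sum.distrib[symmetric] a_def by (intro sum.cong refl)
    qed
    finally show ?thesis .
  qed
  show "set_integrable lborel {0..2*pi} L"
    unfolding L by (intro set_integrable_sum(1) set_integrable_mult_right Green(1))
  show "set_integrable lborel {0..2*pi} R"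
    unfolding R by (intro set_integrable_sum(1) set_integrable_mult_right boundary_moment(1))
  have "(LINT t:{0..2*pi}|lborel. L t) = (\<Sum>m\<le>degree h. coeff h m * (LINT t:{0..2*pi}|lborel. of_real (norm (boundary_val F t) powr p) * cis t ^ m))"
    unfolding L by (subst set_integrable_sum(2)) (auto intro!: set_integrable_mult_right Green(1))
  also have "\<dots> = (\<Sum>m\<le>degree h. \<Sum>j\<le>degree k. 1 / of_real N * (a m j * (of_nat (2 * j + 2) * mixed_moment m j)))"
  proof -
    \<comment> \<open>The decisive identity p(j+1) + (2-p)(m+1) = 2(m+1) + p(j-m): on the left the
      circle factor 2j + 2 times the weights p/2 and 1 - p/2, on the right the coefficient from
      Green's formula.\<close>
    have "of_nat (2 * j + 2) * (of_real (p/2) + of_real (1 - p/2) * (of_nat (Suc m) / of_nat (Suc j)))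
       = (of_nat (2 + 2 * m) + of_real p * (of_nat j - of_nat m) :: complex)" for m j :: nat
    proof -
      have "of_nat (2 * j + 2) * (of_nat (Suc m) / of_nat (Suc j)) = (2 * of_nat (Suc m) :: complex)"
        by (simp add: field_simps del: of_nat_Suc) (simp add: algebra_simps)
      then have "of_nat (2 * j + 2) * (of_real (p/2) + of_real (1 - p/2) * (of_nat (Suc m) / of_nat (Suc j)))
        = of_nat (2 * j + 2) * of_real (p/2) + of_real (1 - p/2) * (2 * of_nat (Suc m) :: complex)"
        by (simp only: distrib_left mult.left_commute)
      then show ?thesis by (simp add: algebra_simps)
    qed
    note E = this
    have A: "a m j * (of_nat (2 * j + 2) * mixed_moment m j)
       = coeff h m * (cnj (coeff k j) * mixed_moment m j * (of_nat (2 + 2 * m) + of_real p * (of_nat j - of_nat m)))" for m j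
      unfolding E[symmetric] a_def by (simp only: mult_ac)
    show ?thesis
      unfolding A boundary_power_integral sum_distrib_left by (intro sum.cong refl) (rule mult.left_commute)
  qed
  also have "\<dots> = 1 / of_real N * (\<Sum>m\<le>degree h. \<Sum>j\<le>degree k. a m j * (LINT t:{0..2*pi}|lborel. boundary_val F t * (cis t ^ m * cnj (cis t ^ j))))"
    unfolding boundary_moment(2) by (simp only: sum_distrib_left)
  also have "(\<Sum>m\<le>degree h. \<Sum>j\<le>degree k. a m j * (LINT t:{0..2*pi}|lborel. boundary_val F t * (cis t ^ m * cnj (cis t ^ j))))
     = (LINT t:{0..2*pi}|lborel. R t)"
    unfolding R by (simp add: set_integrable_sum set_integrable_mult_right boundary_moment(1) del: complex_cnj_power)
  finally show "(LINT t:{0..2*pi}|lborel. L t) = 1 / of_real N * (LINT t:{0..2*pi}|lborel. R t)" .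
qed

end

text \<open>Almost everywhere existence of radial limits and integrability of both integrands are
  part of the conclusion, since \<open>boundary_val\<close> is arbitrary where there is no limit and
  a Bochner integral defaults to 0 for a nonintegrable function. The polynomial
  \<open>pderiv (pCons 0 h)\<close> encodes (zh)'.\<close>

theorem theorem2p1:
  fixes p :: real and k h :: "complex poly" and F :: "complex \<Rightarrow> complex"
  assumes "1 < p" and "k \<noteq> 0" and "is_extremal p k F"
  shows "in_Hardy p F \<and>
    (AE \<theta> in lborel. \<theta> \<in> {0..2*pi} \<longrightarrow>
        (\<exists>l. ((\<lambda>r. F (of_real r * cis \<theta>)) \<longlongrightarrow> l) (at_left 1))) \<and>
    set_integrable lborel {0..2*pi}
      (\<lambda>\<theta>. of_real (norm (boundary_val F \<theta>) powr p) * poly h (cis \<theta>)) \<and>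
    set_integrable lborel {0..2*pi}
      (\<lambda>\<theta>. boundary_val F \<theta> *
         (of_real (p/2) * poly h (cis \<theta>) * cnj (poly k (cis \<theta>)) +
          of_real (1 - p/2) * poly (pderiv (pCons 0 h)) (cis \<theta>) * cnj (Kfun k (cis \<theta>)))) \<and>
    (1 / (2 * of_real pi)) *
      (LINT \<theta>:{0..2*pi}|lborel. of_real (norm (boundary_val F \<theta>) powr p) * poly h (cis \<theta>))
    = (1 / (2 * of_real pi * of_real (functional_norm p k))) *
      (LINT \<theta>:{0..2*pi}|lborel. boundary_val F \<theta> *
         (of_real (p/2) * poly h (cis \<theta>) * cnj (poly k (cis \<theta>)) +
          of_real (1 - p/2) * poly (pderiv (pCons 0 h)) (cis \<theta>) * cnj (Kfun k (cis \<theta>))))"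
proof -
  interpret bergman_extremal p k F using assms by unfold_locales
  show ?thesis
  proof (intro conjI)
    show "in_Hardy p F" by (rule F_in_Hardy)
    show "AE \<theta> in lborel. \<theta> \<in> {0..2*pi} \<longrightarrow> (\<exists>l. ((\<lambda>r. F (of_real r * cis \<theta>)) \<longlongrightarrow> l) (at_left 1))"
      using AE_good_ray by eventually_elim (use good_ray_limit in auto)
  qed (use boundary_formula[of h] in \<open>auto simp: N_def\<close>)
qed

end
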